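(* Consider the Schrödinger bridge problem for the reference measure $\mathbf R$ and targets $\rho_0,\rho_T$ under Assumptions (C) and (G). Suppose that Assumption (D) holds and $\mathbf R_0$ admits a density function $x\in\mathbb R^d\mapsto\mathbf R_0(x,i)$ for every $i\in\mathcal S$. In addition, suppose that for every $i,j\in\mathcal S$ the density functions $\rho_0(\cdot,i)$ and $\rho_T(\cdot,j)$ have compact support $A_0^i$ and $A_T^j$ respectively, and the transition density function $p_{ij}(0,\cdot,T,\cdot)$ is continuous and positive on $A_0^i\times A_T^j$. For a function $f$ on $\mathbb R^d\times\mathcal S$ define $$\|f\|^2_{(A_T^1,\dots,A_T^{|\mathcal S|})}:=\sum_{j\in\mathcal S}\|f(\cdot,j)\|^2_{L^2(A_T^j)}.$$ Then, for any starting function $f_0:\mathbb R^d\times\mathcal S\to\mathbb R_+$ that is bounded with $\inf_{A_T^j}f_0(\cdot,j)>0$ for every $j\in\mathcal S$, $$f_k:=\frac{\mathcal C^k(f_0)}{\|\mathcal C^k(f_0)\|_{(A_T^1,\dots,A_T^{|\mathcal S|})}}\longrightarrow f_\infty\quad\text{as }k\to\infty\text{ under }\|\cdot\|_{(A_T^1,\dots,A_T^{|\mathcal S|})},$$ where $f_\infty$ is the unique fixed point of $\mathcal C$ with $\|f_\infty\|_{(A_T^1,\dots,A_T^{|\mathcal S|})}=1$. Moreover, the quadruple $$\widehat\varphi(T,\cdot):=f_\infty,\quad\varphi(T,\cdot):=\rho_T(\cdot)/\widehat\varphi(T,\cdot),\quad\varphi(0,\cdot):=\mathcal E_{\rho_T}\circ\mathcal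 D(f_\infty),\quad\widehat\varphi(0,\cdot):=\rho_0(\cdot)/\varphi(0,\cdot)$$ is the unique solution (up to rescaling by a constant) of the Schrödinger system $$\begin{cases}\varphi(0,x,i)=\sum_{j\in\mathcal S}\int_{\mathbb R^d}p_{ij}(0,x,T,y)\varphi(T,y,j)dy,\\ \widehat\varphi(T,y,j)=\sum_{i\in\mathcal S}\int_{\mathbb R^d}p_{ij}(0,x,T,y)\widehat\varphi(0,x,i)dx,\\ \rho_0(x,i)=\varphi(0,x,i)\widehat\varphi(0,x,i),\\ \rho_T(y,j)=\varphi(T,y,j)\widehat\varphi(T,y,j).\end{cases}$$
   Context: **Path space.** Fix $T>0$, $d,\ell\ge1$ and a finite set of regimes $\mathcal S=\{1,\dots,|\mathcal S|\}$. $\Omega=D([0,T];\mathbb R^d\times\mathcal S)$ is the Skorokhod space of càdlàg paths, with Borel $\sigma$-algebra $\mathcal F$, canonical process $(X_t,\Lambda_t)(\omega)=\omega(t)$ and its natural filtration (or usual augmentation) $\{\mathcal F_t\}$. A path measure is a probability measure on $\Omega$; $\mathbf P_t$ is the law of $(X_t,\Lambda_t)$ under $\mathbf P$. For a measure $\mu$ on $\mathbb R^d\times\mathcal S$, $\mu(\cdot,i)$ is the measure $B\mapsto\mu(B\times\{i\})$ (or its Lebesgue density). $\mathrm{KL}(\mathbf P\|\mathbf R)=\mathbf E_{\mathbf P}[\log\frac{d\mathbf P}{d\mathbf R}]$ if $\mathbf P\ll\mathbf R$, $+\infty$ otherwise. **Reference SDE.** Given $Q_{ij}(t,x)$, fix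 for each $(t,x)$ subsets $\Delta_{ij}(t,x)\subset\mathbb R_+$ with $\Delta_{ii}(t,x)=\emptyset$ and, for $i\ne j$, disjoint intervals $\Delta_{ij}(t,x)$ of length $Q_{ij}(t,x)$. Put $\alpha(t,x,i,w)=\sum_{j}(j-i)\mathbf 1_{\Delta_{ij}(t,x)}(w)$ and $\beta(t,x,i,w)=\sum_j(\psi_{ij}(t,x)-x)\mathbf 1_{\Delta_{ij}(t,x)}(w)$. The reference SDE is $$dX_t=b(t,X_t,\Lambda_t)dt+\sigma(t,X_t,\Lambda_t)dB_t+\int_{|z|\le1}\gamma(t,X_{t-},\Lambda_{t-},z)\tilde N(dt,dz)+\int_{|z|>1}\gamma(t,X_{t-},\Lambda_{t-},z)N(dt,dz)+\int_{\mathbb R_+}\beta(t,X_{t-},\Lambda_{t-},w)N_1(dt,dw),$$ $$d\Lambda_t=\int_{\mathbb R_+}\alpha(t,X_{t-},\Lambda_{t-},w)N_1(dt,dw),$$ with $B$ a standard $d$-dimensional Brownian motion, $N$ a Poisson random measure on $\mathbb R^\ell$ with intensity $\nu(dz)$, $\tilde N=N-\nu(dz)dt$, and $N_1$ a Poisson random measure on $\mathbb R_+$ with Lebesgue intensity. Only weak solutions are considered. **Assumption (C).** $b:[0,T]\times\mathbb R^d\times\mathcal S\to\mathbb R^d$ and $\sigma:[0,T]\times\mathbb R^d\times\mathcal S\to\mathbb R^{d\times d}$ are measurable and locally bounded, $\sigma\sigma^\top$ is non-negative definite; $\gamma:[0,T]\times\mathbb R^d\times\mathcal S\times\mathbb R^\ell\to\mathbb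 R^d$ is measurable, $\gamma(t,x,i,0)=0$ and $\sup_z\frac{|\gamma(t,x,i,z)|}{1\wedge|z|}$ is locally bounded in $(t,x,i)$; $\nu$ is a Lévy measure ($\nu(\{0\})=0$, $\int(1\wedge|z|^2)\nu(dz)<\infty$); each $\psi_{ij}:[0,T]\times\mathbb R^d\to\mathbb R^d$ is measurable and locally bounded with $\psi_{ii}(t,x)=x$; for $i\neq j$, $Q_{ij}:[0,T]\times\mathbb R^d\to\mathbb R_+$ is measurable and locally bounded. **Assumption (G).** (G1) For every $(t,x,i)$ the SDE has a solution $\mathbf P^{t,x,i}$ on $\Omega$, satisfying the SDE for $r\in[t,T]$ with $(X_t,\Lambda_t)\equiv(x,i)$, and the family is strong Markovian: for every stopping time $\tau\in[t,T]$, the conditional law of $\mathbf P^{t,x,i}$ given $\mathcal F_\tau$ is $\mathbf P^{\tau,X_\tau,\Lambda_\tau}$. (G2) $\mathbf R$ is the solution of the SDE with initial law $\mathbf R_0$; its endpoint law satisfies $\mathbf R_{0T}\ll\mathbf R_0\otimes\mathbf R_T$; and the probability measures $\rho_0,\rho_T$ on $\mathbb R^d\times\mathcal S$ satisfy $\mathrm{KL}(\rho_0\otimes\rho_T\|\mathbf R_{0T})<\infty$. Under (G) it is known that the minimizer $\widehat{\mathbf P}$ of $\mathrm{KL}(\mathbf P\|\mathbf R)$ over path measures with $\mathbf P_0=\rho_0$, $\mathbf P_T=\rho_T$ exists, is unique, and has the form $\mathfrak f(X_0,\Lambda_0)\mathfrak g(X_T,\Lambda_T)\mathbf R$ with measurable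 $\mathfrak f,\mathfrak g:\mathbb R^d\times\mathcal S\to\mathbb R_+$ solving $\mathfrak f(x,i)\mathbf E_{\mathbf R}[\mathfrak g(X_T,\Lambda_T)|(X_0,\Lambda_0)=(x,i)]=\frac{d\rho_0}{d\mathbf R_0}(x,i)$ for $\mathbf R_0$-a.e. $(x,i)$ and $\mathfrak g(y,j)\mathbf E_{\mathbf R}[\mathfrak f(X_0,\Lambda_0)|(X_T,\Lambda_T)=(y,j)]=\frac{d\rho_T}{d\mathbf R_T}(y,j)$ for $\mathbf R_T$-a.e. $(y,j)$. **Assumption (D).** (D1) For every $(x,i)$ and $0\le t<s\le T$ there is a function $(y,j)\mapsto p_{ij}(t,x,s,y)$ with $\mathbf R(X_s\in B,\Lambda_s=j|(X_t,\Lambda_t)=(x,i))=\int_Bp_{ij}(t,x,s,y)dy$ for Borel $B\subseteq\mathbb R^d$; and for all $i,j$, $t<s$, $(x,y)\mapsto p_{ij}(t,x,s,y)$ is bounded on $\mathbb R^d\times\mathbb R^d$. (D2) For all $i,j$, $\int_{\mathbb R^d}\mathfrak f(x,i)\mathbf R_0(dx,i)<\infty$ and $\sup_{y\in\mathrm{supp}(\mathbf R_T(\cdot,j))}\mathfrak g(y,j)<\infty$. Under these assumptions $\mathbf R_T$ and hence $\rho_T$ have densities; when $\mathbf R_0$ has a density, so has $\rho_0$. The equations of the Schrödinger system are understood for Lebesgue-a.e. $x,y\in\mathbb R^d$ and all $i,j\in\mathcal S$. **Maps.** For $f$ on $\mathbb R^d\times\mathcal S$ with non-zero values, and $x,y\in\mathbb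 R^d$, $i,j\in\mathcal S$: $\mathcal D(f)(x,i)=1/f(x,i)$; $\mathcal E_{\rho_T}(f)(x,i)=\sum_j\int_{\mathbb R^d}p_{ij}(0,x,T,y)\rho_T(y,j)f(y,j)dy$; $\mathcal E_{\rho_0}(f)(y,j)=\sum_i\int_{\mathbb R^d}p_{ij}(0,x,T,y)\rho_0(x,i)f(x,i)dx$; $\mathcal C:=\mathcal E_{\rho_0}\circ\mathcal D\circ\mathcal E_{\rho_T}\circ\mathcal D$. (Since $\rho_0(\cdot,i)$, $\rho_T(\cdot,j)$ vanish off their supports, only the values of the integrated functions on $A_0^i$, $A_T^j$ matter.)
   Formalization: Uniqueness of the fixed point is among functions positive on the A_T^j; Schrödinger solutions are non-negative, unique up to scaling a.e. where ρ_0, ρ_T are nonzero, and a.e. on all of R^d if φ̂(0,·)=0 off A_0 and φ(T,·)=0 off A_T, since literal uniqueness fails when p vanishes off the supports. *)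

theory Defs
  imports "HOL-Probability.Probability"
begin

section \<open>Coefficients and path space\<close>

text \<open>Regimes are the numbers \<open>1, ..., num_regimes K\<close>; the switching equation adds \<open>j - i\<close> to
  the current regime, so they have to be numbers.  The argument order is
  \<open>drift t x i\<close>, \<open>jump t x i z\<close>, \<open>switch i j t x\<close> (the map psi), \<open>rate i j t x\<close> (the rates Q)
  and \<open>cell i j t x\<close> (the intervals Delta).\<close>

record ('d::finite, 'l::finite) model =
  horizon :: real
  num_regimes :: nat
  drift :: "real \<Rightarrow> real ^ 'd \<Rightarrow> nat \<Rightarrow> real ^ 'd"
  diffusion :: "real \<Rightarrow> real ^ 'd \<Rightarrow> nat \<Rightarrow> real ^ 'd ^ 'd"
  jump :: "real \<Rightarrow> real ^ 'd \<Rightarrow> nat \<Rightarrow> real ^ 'l \<Rightarrow> real ^ 'd"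
  levy :: "(real ^ 'l) measure"
  switch :: "nat \<Rightarrow> nat \<Rightarrow> real \<Rightarrow> real ^ 'd \<Rightarrow> real ^ 'd"
  rate :: "nat \<Rightarrow> nat \<Rightarrow> real \<Rightarrow> real ^ 'd \<Rightarrow> real"
  cell :: "nat \<Rightarrow> nat \<Rightarrow> real \<Rightarrow> real ^ 'd \<Rightarrow> real set"

type_synonym 'd state = "(real ^ 'd) \<times> nat"
type_synonym 'd path = "real \<Rightarrow> (real ^ 'd) \<times> nat"

definition regimes :: "('d::finite, 'l::finite) model \<Rightarrow> nat set" where
  "regimes K = {1..num_regimes K}"

definition state_space :: "('d::finite, 'l::finite) model \<Rightarrow> 'd state measure" where
  "state_space K = borel \<Otimes>\<^sub>M count_space (regimes K)"

definition paths :: "('d::finite, 'l::finite) model \<Rightarrow> 'd path set" where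
  "paths K = {\<omega> \<in> {0..horizon K} \<rightarrow>\<^sub>E UNIV \<times> regimes K.
     (\<forall>t\<in>{0..<horizon K}. (\<omega> \<longlongrightarrow> \<omega> t) (at_right t)) \<and>
     (\<forall>t\<in>{0<..horizon K}. \<exists>l. (\<omega> \<longlongrightarrow> l) (at_left t))}"

definition time_change :: "real \<Rightarrow> (real \<Rightarrow> real) \<Rightarrow> bool" where
  "time_change T \<theta> \<longleftrightarrow>
     \<theta> 0 = 0 \<and> \<theta> T = T \<and> strict_mono_on {0..T} \<theta> \<and> continuous_on {0..T} \<theta>"

text \<open>The open sets of the Skorokhod J1 topology; the regimes carry the discrete metric.\<close>

definition skorokhod_near ::
    "('d::finite, 'l::finite) model \<Rightarrow> real \<Rightarrow> 'd path \<Rightarrow> 'd path \<Rightarrow> bool" where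
  "skorokhod_near K \<epsilon> \<omega> \<omega>' \<longleftrightarrow> (\<exists>\<theta>. time_change (horizon K) \<theta> \<and>
     (\<forall>t\<in>{0..horizon K}. \<bar>\<theta> t - t\<bar> < \<epsilon> \<and>
        dist (fst (\<omega> (\<theta> t))) (fst (\<omega>' t)) < \<epsilon> \<and> snd (\<omega> (\<theta> t)) = snd (\<omega>' t)))"

definition skorokhod_open :: "('d::finite, 'l::finite) model \<Rightarrow> 'd path set \<Rightarrow> bool" where
  "skorokhod_open K U \<longleftrightarrow> U \<subseteq> paths K \<and>
     (\<forall>\<omega>\<in>U. \<exists>\<epsilon>>0. \<forall>\<omega>'\<in>paths K. skorokhod_near K \<epsilon> \<omega> \<omega>' \<longrightarrow> \<omega>' \<in> U)"

definition path_space :: "('d::finite, 'l::finite) model \<Rightarrow> 'd path measure" where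
  "path_space K = sigma (paths K) {U. skorokhod_open K U}"

definition path_measure :: "('d::finite, 'l::finite) model \<Rightarrow> 'd path measure \<Rightarrow> bool" where
  "path_measure K P \<longleftrightarrow> prob_space P \<and> sets P = sets (path_space K)"

definition natural_filtration :: "('d::finite, 'l::finite) model \<Rightarrow> real \<Rightarrow> 'd path measure" where
  "natural_filtration K t = sigma (paths K)
     (\<Union>s\<in>{0..t} \<inter> {0..horizon K}.
        {(\<lambda>\<omega>. \<omega> s) -` A \<inter> paths K | A. A \<in> sets (state_space K)})"

definition marginal ::
    "('d::finite, 'l::finite) model \<Rightarrow> 'd path measure \<Rightarrow> real \<Rightarrow> 'd state measure" where
  "marginal K P t = distr P (state_space K) (\<lambda>\<omega>. \<omega> t)"

definition endpoint_law ::
    "('d::finite, 'l::finite) model \<Rightarrow> 'd path measure \<Rightarrow> ('d state \<times> 'd state) measure" where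
  "endpoint_law K P =
     distr P (state_space K \<Otimes>\<^sub>M state_space K) (\<lambda>\<omega>. (\<omega> 0, \<omega> (horizon K)))"

definition slice :: "'d::finite state measure \<Rightarrow> nat \<Rightarrow> (real ^ 'd) measure" where
  "slice \<mu> i = measure_of UNIV (sets borel) (\<lambda>B. emeasure \<mu> (B \<times> {i}))"

lemma sets_slice [simp]: "sets (slice \<mu> i) = sets borel"
  unfolding slice_def using sets.sigma_sets_eq[of borel] by simp

lemma emeasure_slice:
  fixes K :: "('d::finite, 'l::finite) model"
  assumes "sets \<mu> = sets (state_space K)" "i \<in> regimes K" "B \<in> sets borel"
  shows "emeasure (slice \<mu> i) B = emeasure \<mu> (B \<times> {i})"
proof (rule emeasure_measure_of[OF slice_def])
  have rect: "A \<times> {i} \<in> sets \<mu>" if "A \<in> sets borel" for A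
    using that assms by (simp add: state_space_def)
  show "countably_additive (sets (slice \<mu> i)) (\<lambda>B. emeasure \<mu> (B \<times> {i}))"
  proof (rule countably_additiveI)
    fix A :: "nat \<Rightarrow> (real ^ 'd) set"
    assume A: "range A \<subseteq> sets (slice \<mu> i)" "disjoint_family A"
    have "(\<Sum>n. emeasure \<mu> (A n \<times> {i})) = emeasure \<mu> (\<Union>n. A n \<times> {i})"
    proof (rule suminf_emeasure)
      show "range (\<lambda>n. A n \<times> {i}) \<subseteq> sets \<mu>" using A rect by auto
      show "disjoint_family (\<lambda>n. A n \<times> {i})"
        using A(2) by (auto simp: disjoint_family_on_def)
    qed
    also have "(\<Union>n. A n \<times> {i}) = (\<Union>(range A)) \<times> {i}" by auto
    finally show "(\<Sum>n. emeasure \<mu> (A n \<times> {i})) = emeasure \<mu> (\<Union>(range A) \<times> {i})" .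
  qed
qed (use assms in \<open>auto simp: positive_def\<close>)

definition supp :: "'a::topological_space measure \<Rightarrow> 'a set" where
  "supp \<mu> = {x. \<forall>U. open U \<and> x \<in> U \<longrightarrow> 0 < emeasure \<mu> U}"

text \<open>The expectation of the log-likelihood ratio under \<open>P\<close>, with values in the extended reals.\<close>

definition kl :: "'a measure \<Rightarrow> 'a measure \<Rightarrow> ereal" where
  "kl P R = (if absolutely_continuous R P then
      enn2ereal (\<integral>\<^sup>+\<omega>. ennreal (ln (enn2real (RN_deriv R P \<omega>))) \<partial>P)
    - enn2ereal (\<integral>\<^sup>+\<omega>. ennreal (- ln (enn2real (RN_deriv R P \<omega>))) \<partial>P)
    else \<infinity>)"

section \<open>Driving noise and stochastic integrals\<close>

definition filtered_prob_space :: "'w measure \<Rightarrow> (real \<Rightarrow> 'w measure) \<Rightarrow> real \<Rightarrow> bool" where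
  "filtered_prob_space M F T \<longleftrightarrow> prob_space M \<and> (\<forall>t\<in>{0..T}. subalgebra M (F t)) \<and>
     (\<forall>s t. 0 \<le> s \<and> s \<le> t \<and> t \<le> T \<longrightarrow> sets (F s) \<subseteq> sets (F t))"

definition generated_sets ::
    "'w measure \<Rightarrow> ('i \<Rightarrow> 'w \<Rightarrow> 'b) \<Rightarrow> 'i set \<Rightarrow> 'b measure \<Rightarrow> 'w set set" where
  "generated_sets M X I E =
     sigma_sets (space M) (\<Union>i\<in>I. {X i -` A \<inter> space M | A. A \<in> sets E})"

definition brownian_motion ::
    "'w measure \<Rightarrow> (real \<Rightarrow> 'w measure) \<Rightarrow> real \<Rightarrow> (real \<Rightarrow> 'w \<Rightarrow> real ^ 'd::finite) \<Rightarrow> bool" where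
  "brownian_motion M F T B \<longleftrightarrow>
     (AE w in M. B 0 w = 0 \<and> continuous_on {0..T} (\<lambda>t. B t w)) \<and>
     (\<forall>t\<in>{0..T}. B t \<in> borel_measurable (F t)) \<and>
     (\<forall>s t. 0 \<le> s \<and> s < t \<and> t \<le> T \<longrightarrow>
        prob_space.indep_vars M (\<lambda>_. borel) (\<lambda>k w. (B t w - B s w) $ k) UNIV \<and>
        (\<forall>k. distributed M lborel (\<lambda>w. (B t w - B s w) $ k)
               (\<lambda>u. ennreal (normal_density 0 (sqrt (t - s)) u))))"

text \<open>Poisson random measure on \<open>(0,T] \<times> 'e\<close> with intensity \<open>dt \<otimes> \<mu>\<close>, as a random measure.\<close>

definition poisson_random_measure ::
    "'w measure \<Rightarrow> (real \<Rightarrow> 'w measure) \<Rightarrow> real \<Rightarrow> 'e::euclidean_space measure \<Rightarrow>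
       ('w \<Rightarrow> (real \<times> 'e) measure) \<Rightarrow> bool" where
  "poisson_random_measure M F T \<mu> N \<longleftrightarrow>
     (\<forall>w\<in>space M. sets (N w) = sets borel) \<and>
     (\<forall>t\<in>{0..T}. \<forall>A\<in>sets borel. A \<subseteq> {0<..t} \<times> UNIV \<longrightarrow>
        (\<lambda>w. emeasure (N w) A) \<in> borel_measurable (F t)) \<and>
     (\<forall>A\<in>sets borel. A \<subseteq> {0<..T} \<times> UNIV \<longrightarrow>
        (if emeasure (lborel \<Otimes>\<^sub>M \<mu>) A = \<infinity> then AE w in M. emeasure (N w) A = \<infinity>
         else \<forall>n::nat. measure M {w \<in> space M. emeasure (N w) A = of_nat n} =
           measure (lborel \<Otimes>\<^sub>M \<mu>) A ^ n / fact n * exp (- measure (lborel \<Otimes>\<^sub>M \<mu>) A))) \<and>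
     (\<forall>n::nat. \<forall>A. (\<forall>k<n. A k \<in> sets borel \<and> A k \<subseteq> {0<..T} \<times> UNIV) \<and>
        disjoint_family_on A {..<n} \<longrightarrow>
        prob_space.indep_vars M (\<lambda>_. borel) (\<lambda>k w. emeasure (N w) (A k)) {..<n})"

text \<open>Brownian motion and the two Poisson random measures are independent of each other, and
  after each time \<open>s\<close> they are jointly independent of the past \<open>F s\<close>.\<close>

definition driving_noise ::
    "'w measure \<Rightarrow> (real \<Rightarrow> 'w measure) \<Rightarrow> real \<Rightarrow> 'e::euclidean_space measure \<Rightarrow>
       (real \<Rightarrow> 'w \<Rightarrow> real ^ 'd::finite) \<Rightarrow> ('w \<Rightarrow> (real \<times> 'e) measure) \<Rightarrow>
       ('w \<Rightarrow> (real \<times> real) measure) \<Rightarrow> bool" where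
  "driving_noise M F T \<nu> B N N1 \<longleftrightarrow>
     brownian_motion M F T B \<and>
     poisson_random_measure M F T \<nu> N \<and>
     poisson_random_measure M F T (density lborel (indicator {0..})) N1 \<and>
     (let futureB = (\<lambda>s. generated_sets M (\<lambda>t w. B t w - B s w) {s..T} borel);
          futureN = (\<lambda>s. generated_sets M (\<lambda>A w. emeasure (N w) A)
                       {A \<in> sets borel. A \<subseteq> {s<..T} \<times> UNIV} borel);
          futureN1 = (\<lambda>s. generated_sets M (\<lambda>A w. emeasure (N1 w) A)
                       {A \<in> sets borel. A \<subseteq> {s<..T} \<times> UNIV} borel)
      in prob_space.indep_sets M
           (\<lambda>k::nat. if k = 0 then futureB 0 else if k = 1 then futureN 0 else futureN1 0)
           {0, 1, 2} \<and>
         (\<forall>s\<in>{0..T}. prob_space.indep_set M (sets (F s))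
            (sigma_sets (space M) (futureB s \<union> futureN s \<union> futureN1 s))))"

text \<open>Convergence to 0 in (outer) probability, so that no measurability of \<open>G\<close> is needed.\<close>

definition vanishes_in_prob :: "'w measure \<Rightarrow> (nat \<Rightarrow> 'w \<Rightarrow> ennreal) \<Rightarrow> bool" where
  "vanishes_in_prob M G \<longleftrightarrow> (\<forall>\<epsilon>>0. \<exists>E. (\<forall>n. E n \<in> sets M \<and>
     {w \<in> space M. ennreal \<epsilon> < G n w} \<subseteq> E n) \<and> (\<lambda>n. measure M (E n)) \<longlonglongrightarrow> 0)"

text \<open>Simple integrands: \<open>xi k\<close> on the interval from \<open>p k\<close> to \<open>p (Suc k)\<close>, for \<open>k < n\<close>.\<close>

definition simple_integrand ::
    "'w measure \<Rightarrow> (real \<Rightarrow> 'w measure) \<Rightarrow> real \<Rightarrow> real \<Rightarrow>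
       nat \<Rightarrow> (nat \<Rightarrow> real) \<Rightarrow> (nat \<Rightarrow> 'w \<Rightarrow> real ^ 'd ^ 'd::finite) \<Rightarrow> bool" where
  "simple_integrand M F t0 T n p xi \<longleftrightarrow>
     p 0 = t0 \<and> p n = T \<and> (\<forall>k<n. p k \<le> p (Suc k)) \<and>
     (\<forall>k<n. xi k \<in> borel_measurable (F (p k)) \<and> (\<exists>c. \<forall>w\<in>space M. norm (xi k w) \<le> c))"

definition simple_process ::
    "nat \<Rightarrow> (nat \<Rightarrow> real) \<Rightarrow> (nat \<Rightarrow> 'w \<Rightarrow> real ^ 'd ^ 'd::finite) \<Rightarrow> real \<Rightarrow> 'w \<Rightarrow> real ^ 'd ^ 'd" where
  "simple_process n p xi s w = (\<Sum>k<n. indicator {p k<..p (Suc k)} s *\<^sub>R xi k w)"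

definition simple_integral ::
    "(real \<Rightarrow> 'w \<Rightarrow> real ^ 'd) \<Rightarrow> nat \<Rightarrow> (nat \<Rightarrow> real) \<Rightarrow> (nat \<Rightarrow> 'w \<Rightarrow> real ^ 'd ^ 'd::finite) \<Rightarrow>
       real \<Rightarrow> 'w \<Rightarrow> real ^ 'd" where
  "simple_integral B n p xi r w =
     (\<Sum>k<n. xi k w *v (B (min r (p (Suc k))) w - B (min r (p k)) w))"

text \<open>\<open>I\<close> is (a version of) the Ito integral process of \<open>H\<close> on \<open>[t0,T]\<close>: the uniform limit in
  probability of the integrals of simple integrands approximating \<open>H\<close>.\<close>

definition ito_integral ::
    "'w measure \<Rightarrow> (real \<Rightarrow> 'w measure) \<Rightarrow> real \<Rightarrow> real \<Rightarrow> (real \<Rightarrow> 'w \<Rightarrow> real ^ 'd::finite) \<Rightarrow>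
       (real \<Rightarrow> 'w \<Rightarrow> real ^ 'd ^ 'd) \<Rightarrow> (real \<Rightarrow> 'w \<Rightarrow> real ^ 'd) \<Rightarrow> bool" where
  "ito_integral M F t0 T B H I \<longleftrightarrow>
     (\<exists>n p xi. (\<forall>m. simple_integrand M F t0 T (n m) (p m) (xi m)) \<and>
        vanishes_in_prob M (\<lambda>m w. \<integral>\<^sup>+s\<in>{t0..T}.
          ennreal ((norm (simple_process (n m) (p m) (xi m) s w - H s w))\<^sup>2) \<partial>lborel) \<and>
        vanishes_in_prob M (\<lambda>m w. SUP r\<in>{t0..T}.
          ennreal (norm (simple_integral B (n m) (p m) (xi m) r w - I r w))))"

text \<open>\<open>J\<close> is the integral of \<open>H\<close> over \<open>{norm z \<le> 1}\<close> against the compensated measure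
  \<open>N - dt \<otimes> \<nu>\<close>: the uniform limit in probability of the compensated integrals over
  \<open>{\<delta> < norm z \<le> 1}\<close> as \<open>\<delta> = 1 / (m + 1)\<close> tends to 0.\<close>

definition compensated_integral ::
    "'w measure \<Rightarrow> real \<Rightarrow> real \<Rightarrow> 'e::euclidean_space measure \<Rightarrow> ('w \<Rightarrow> (real \<times> 'e) measure) \<Rightarrow>
       ('w \<Rightarrow> real \<times> 'e \<Rightarrow> 'v::euclidean_space) \<Rightarrow> (real \<Rightarrow> 'w \<Rightarrow> 'v) \<Rightarrow> bool" where
  "compensated_integral M t0 T \<nu> N H J \<longleftrightarrow>
     (let A = (\<lambda>m r. {t0<..r} \<times> {z. 1 / (real m + 1) < norm z \<and> norm z \<le> 1}) in
       (\<forall>m. AE w in M. set_integrable (N w) (A m T) (H w) \<and>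
              set_integrable (lborel \<Otimes>\<^sub>M \<nu>) (A m T) (H w)) \<and>
       vanishes_in_prob M (\<lambda>m w. SUP r\<in>{t0..T}. ennreal (norm (
          set_lebesgue_integral (N w) (A m r) (H w)
        - set_lebesgue_integral (lborel \<Otimes>\<^sub>M \<nu>) (A m r) (H w) - J r w))))"

section \<open>The reference SDE\<close>

definition alpha ::
    "('d::finite, 'l::finite) model \<Rightarrow> real \<Rightarrow> real ^ 'd \<Rightarrow> nat \<Rightarrow> real \<Rightarrow> real" where
  "alpha K t x i u = (\<Sum>j\<in>regimes K. (real j - real i) * indicator (cell K i j t x) u)"

definition beta ::
    "('d::finite, 'l::finite) model \<Rightarrow> real \<Rightarrow> real ^ 'd \<Rightarrow> nat \<Rightarrow> real \<Rightarrow> real ^ 'd" where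
  "beta K t x i u = (\<Sum>j\<in>regimes K. indicator (cell K i j t x) u *\<^sub>R (switch K i j t x - x))"

abbreviation left_limit :: "'d::finite path \<Rightarrow> real \<Rightarrow> 'd state" where
  "left_limit \<omega> s \<equiv> Lim (at_left s) \<omega>"

text \<open>The path \<open>\<omega>\<close> satisfies the two equations on \<open>[t0,T]\<close>, given the values of the Ito integral
  \<open>I\<close>, the compensated integral \<open>J\<close>, and realizations \<open>N\<close>, \<open>N1\<close> of the Poisson random measures.\<close>

definition sde_equations ::
    "('d::finite, 'l::finite) model \<Rightarrow> real \<Rightarrow> 'd path \<Rightarrow> (real \<Rightarrow> real ^ 'd) \<Rightarrow> (real \<Rightarrow> real ^ 'd) \<Rightarrow>
       (real \<times> (real ^ 'l)) measure \<Rightarrow> (real \<times> real) measure \<Rightarrow> bool" where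
  "sde_equations K t0 \<omega> I J N N1 \<longleftrightarrow>
     (let b = (\<lambda>s. drift K s (fst (\<omega> s)) (snd (\<omega> s)));
          c = (\<lambda>(s, z). jump K s (fst (left_limit \<omega> s)) (snd (left_limit \<omega> s)) z);
          be = (\<lambda>(s, u). beta K s (fst (left_limit \<omega> s)) (snd (left_limit \<omega> s)) u);
          al = (\<lambda>(s, u). alpha K s (fst (left_limit \<omega> s)) (snd (left_limit \<omega> s)) u)
      in \<forall>r\<in>{t0..horizon K}.
           set_integrable lborel {t0..r} b \<and>
           set_integrable N ({t0<..r} \<times> {z. 1 < norm z}) c \<and>
           set_integrable N1 ({t0<..r} \<times> {0..}) be \<and>
           set_integrable N1 ({t0<..r} \<times> {0..}) al \<and>
           fst (\<omega> r) = fst (\<omega> t0) + set_lebesgue_integral lborel {t0..r} b + I r + J r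
             + set_lebesgue_integral N ({t0<..r} \<times> {z. 1 < norm z}) c
             + set_lebesgue_integral N1 ({t0<..r} \<times> {0..}) be \<and>
           real (snd (\<omega> r)) = real (snd (\<omega> t0))
             + set_lebesgue_integral N1 ({t0<..r} \<times> {0..}) al)"

text \<open>A sample space large enough to carry the joint law of the solution, the Brownian motion and
  both Poisson random measures; restricting weak solutions to it loses no generality.\<close>

type_synonym ('d, 'l) sample =
  "'d path \<times> (real \<Rightarrow> real ^ 'd) \<times> (real \<times> (real ^ 'l)) measure \<times> (real \<times> real) measure"

text \<open>\<open>P\<close> is the law of a weak solution of the SDE on \<open>[t0,T]\<close>.\<close>

definition sde_solution ::
    "('d::finite, 'l::finite) model \<Rightarrow> real \<Rightarrow> 'd path measure \<Rightarrow> bool" where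
  "sde_solution K t0 P \<longleftrightarrow> path_measure K P \<and>
     (\<exists>(M :: ('d, 'l) sample measure) F Z B N N1 I J.
        filtered_prob_space M F (horizon K) \<and>
        driving_noise M F (horizon K) (levy K) B N N1 \<and>
        Z \<in> M \<rightarrow>\<^sub>M path_space K \<and> distr M (path_space K) Z = P \<and>
        (\<forall>r\<in>{t0..horizon K}. (\<lambda>w. Z w r) \<in> F r \<rightarrow>\<^sub>M state_space K) \<and>
        ito_integral M F t0 (horizon K) B
          (\<lambda>s w. diffusion K s (fst (Z w s)) (snd (Z w s))) I \<and>
        compensated_integral M t0 (horizon K) (levy K) N
          (\<lambda>w (s, z). jump K s (fst (left_limit (Z w) s)) (snd (left_limit (Z w) s)) z) J \<and>
        (AE w in M. sde_equations K t0 (Z w) (\<lambda>r. I r w) (\<lambda>r. J r w) (N w) (N1 w)))"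

section \<open>Standing assumptions\<close>

text \<open>The intervals Delta. Joint measurability makes the SDE integrands measurable.\<close>

definition valid_cells :: "('d::finite, 'l::finite) model \<Rightarrow> bool" where
  "valid_cells K \<longleftrightarrow>
     (\<forall>t\<in>{0..horizon K}. \<forall>x.
        (\<forall>i\<in>regimes K. cell K i i t x = {}) \<and>
        (\<forall>i\<in>regimes K. \<forall>j\<in>regimes K. i \<noteq> j \<longrightarrow> cell K i j t x \<subseteq> {0..} \<and>
           is_interval (cell K i j t x) \<and> emeasure lborel (cell K i j t x) = ennreal (rate K i j t x)) \<and>
        disjoint_family_on (\<lambda>(i, j). cell K i j t x) (regimes K \<times> regimes K)) \<and>
     (\<forall>i\<in>regimes K. \<forall>j\<in>regimes K. (\<lambda>(t, x, u). indicator (cell K i j t x) u :: real)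
        \<in> borel_measurable (restrict_space borel {0..horizon K} \<Otimes>\<^sub>M borel \<Otimes>\<^sub>M borel))"

definition assumption_C :: "('d::finite, 'l::finite) model \<Rightarrow> bool" where
  "assumption_C K \<longleftrightarrow>
     (let T = horizon K; S = regimes K; time = restrict_space borel {0..T};
          locally_bounded = (\<lambda>h :: real \<Rightarrow> real ^ 'd \<Rightarrow> real.
            \<forall>r. \<exists>c. \<forall>t\<in>{0..T}. \<forall>x. norm x \<le> r \<longrightarrow> h t x \<le> c)
      in
       (\<lambda>(t, x, i). drift K t x i) \<in> borel_measurable (time \<Otimes>\<^sub>M state_space K) \<and>
       (\<forall>i\<in>S. locally_bounded (\<lambda>t x. norm (drift K t x i))) \<and>
       (\<lambda>(t, x, i). diffusion K t x i) \<in> borel_measurable (time \<Otimes>\<^sub>M state_space K) \<and>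
       (\<forall>i\<in>S. locally_bounded (\<lambda>t x. norm (diffusion K t x i))) \<and>
       (\<forall>t\<in>{0..T}. \<forall>x. \<forall>i\<in>S. \<forall>v.
          0 \<le> v \<bullet> ((diffusion K t x i ** transpose (diffusion K t x i)) *v v)) \<and>
       (\<lambda>((t, x, i), z). jump K t x i z)
          \<in> borel_measurable ((time \<Otimes>\<^sub>M state_space K) \<Otimes>\<^sub>M borel) \<and>
       (\<forall>t\<in>{0..T}. \<forall>x. \<forall>i\<in>S. jump K t x i 0 = 0) \<and>
       (\<forall>i\<in>S. \<forall>r. \<exists>c. \<forall>t\<in>{0..T}. \<forall>x. norm x \<le> r \<longrightarrow>
          (\<forall>z. norm (jump K t x i z) / min 1 (norm z) \<le> c)) \<and>
       sets (levy K) = sets borel \<and> emeasure (levy K) {0} = 0 \<and>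
       (\<integral>\<^sup>+z. ennreal (min 1 ((norm z)\<^sup>2)) \<partial>levy K) < \<infinity> \<and>
       (\<forall>i\<in>S. \<forall>j\<in>S. (\<lambda>(t, x). switch K i j t x) \<in> borel_measurable (time \<Otimes>\<^sub>M borel) \<and>
          locally_bounded (\<lambda>t x. norm (switch K i j t x))) \<and>
       (\<forall>i\<in>S. \<forall>t\<in>{0..T}. \<forall>x. switch K i i t x = x) \<and>
       (\<forall>i\<in>S. \<forall>j\<in>S. i \<noteq> j \<longrightarrow>
          (\<lambda>(t, x). rate K i j t x) \<in> borel_measurable (time \<Otimes>\<^sub>M borel) \<and>
          (\<forall>t\<in>{0..T}. \<forall>x. 0 \<le> rate K i j t x) \<and>
          locally_bounded (\<lambda>t x. rate K i j t x)))"

text \<open>A path measure started at time \<open>s\<close> says nothing about the past of the path, so laws are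
  compared after freezing the path before \<open>s\<close> at its value at \<open>s\<close>.\<close>

definition freeze :: "('d::finite, 'l::finite) model \<Rightarrow> real \<Rightarrow> 'd path \<Rightarrow> 'd path" where
  "freeze K s \<omega> = (\<lambda>r\<in>{0..horizon K}. \<omega> (max s r))"

text \<open>Under \<open>P\<close>, the conditional law of the path after \<open>\<tau>\<close> given the past up to \<open>\<tau>\<close> is that of
  the family member started at \<open>(\<tau>, \<omega> \<tau>)\<close>.\<close>

definition restarts_at ::
    "('d::finite, 'l::finite) model \<Rightarrow> (real \<Rightarrow> 'd state \<Rightarrow> 'd path measure) \<Rightarrow> 'd path measure \<Rightarrow>
       ('d path \<Rightarrow> real) \<Rightarrow> bool" where
  "restarts_at K Pfam P \<tau> \<longleftrightarrow> (\<forall>A\<in>sets (path_space K). AE \<omega> in P.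
     measure (Pfam (\<tau> \<omega>) (\<omega> (\<tau> \<omega>))) (freeze K (\<tau> \<omega>) -` A \<inter> paths K) =
     real_cond_exp P (filtration.pre_sigma (paths K) (natural_filtration K) \<tau>)
       (indicator {\<omega> \<in> paths K. freeze K (\<tau> \<omega>) \<omega> \<in> A}) \<omega>)"

definition assumption_G1 ::
    "('d::finite, 'l::finite) model \<Rightarrow> (real \<Rightarrow> 'd state \<Rightarrow> 'd path measure) \<Rightarrow> bool" where
  "assumption_G1 K Pfam \<longleftrightarrow> (\<forall>t\<in>{0..horizon K}. \<forall>x. \<forall>i\<in>regimes K.
     sde_solution K t (Pfam t (x, i)) \<and> (AE \<omega> in Pfam t (x, i). \<omega> t = (x, i)) \<and>
     (\<forall>\<tau>. stopping_time (natural_filtration K) \<tau> \<and>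
        (\<forall>\<omega>\<in>paths K. t \<le> \<tau> \<omega> \<and> \<tau> \<omega> \<le> horizon K) \<longrightarrow>
        restarts_at K Pfam (Pfam t (x, i)) \<tau>))"

text \<open>\<open>R\<close> is the solution obtained from the family by randomizing the initial state.\<close>

definition assumption_G2 ::
    "('d::finite, 'l::finite) model \<Rightarrow> (real \<Rightarrow> 'd state \<Rightarrow> 'd path measure) \<Rightarrow> 'd path measure \<Rightarrow>
       'd state measure \<Rightarrow> 'd state measure \<Rightarrow> bool" where
  "assumption_G2 K Pfam R \<rho>0 \<rho>T \<longleftrightarrow>
     sde_solution K 0 R \<and> restarts_at K Pfam R (\<lambda>_. 0) \<and>
     absolutely_continuous (marginal K R 0 \<Otimes>\<^sub>M marginal K R (horizon K)) (endpoint_law K R) \<and>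
     prob_space \<rho>0 \<and> sets \<rho>0 = sets (state_space K) \<and>
     prob_space \<rho>T \<and> sets \<rho>T = sets (state_space K) \<and>
     kl (\<rho>0 \<Otimes>\<^sub>M \<rho>T) (endpoint_law K R) < \<infinity>"

definition schroedinger_bridge ::
    "('d::finite, 'l::finite) model \<Rightarrow> 'd path measure \<Rightarrow> 'd state measure \<Rightarrow> 'd state measure \<Rightarrow>
       'd path measure \<Rightarrow> bool" where
  "schroedinger_bridge K R \<rho>0 \<rho>T P \<longleftrightarrow>
     (let admissible = (\<lambda>P'. path_measure K P' \<and>
            marginal K P' 0 = \<rho>0 \<and> marginal K P' (horizon K) = \<rho>T)
      in admissible P \<and> (\<forall>P'. admissible P' \<longrightarrow> kl P R \<le> kl P' R))"

text \<open>The functions f, g in the representation of the bridge as \<open>f(X_0) g(X_T) R\<close>.\<close>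

definition bridge_factors ::
    "('d::finite, 'l::finite) model \<Rightarrow> 'd path measure \<Rightarrow> 'd state measure \<Rightarrow> 'd state measure \<Rightarrow>
       ('d state \<Rightarrow> real) \<Rightarrow> ('d state \<Rightarrow> real) \<Rightarrow> bool" where
  "bridge_factors K R \<rho>0 \<rho>T f g \<longleftrightarrow>
     (let T = horizon K in
       f \<in> borel_measurable (state_space K) \<and> (\<forall>z\<in>space (state_space K). 0 \<le> f z) \<and>
       g \<in> borel_measurable (state_space K) \<and> (\<forall>z\<in>space (state_space K). 0 \<le> g z) \<and>
       schroedinger_bridge K R \<rho>0 \<rho>T (density R (\<lambda>\<omega>. ennreal (f (\<omega> 0) * g (\<omega> T)))) \<and>
       (AE \<omega> in R. ennreal (f (\<omega> 0)) *
          nn_cond_exp R (vimage_algebra (space R) (\<lambda>\<omega>. \<omega> 0) (state_space K))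
            (\<lambda>\<omega>. ennreal (g (\<omega> T))) \<omega> = RN_deriv (marginal K R 0) \<rho>0 (\<omega> 0)) \<and>
       (AE \<omega> in R. ennreal (g (\<omega> T)) *
          nn_cond_exp R (vimage_algebra (space R) (\<lambda>\<omega>. \<omega> T) (state_space K))
            (\<lambda>\<omega>. ennreal (f (\<omega> 0))) \<omega> = RN_deriv (marginal K R T) \<rho>T (\<omega> T)))"

type_synonym 'd transition_density = "nat \<Rightarrow> nat \<Rightarrow> real \<Rightarrow> real ^ 'd \<Rightarrow> real \<Rightarrow> real ^ 'd \<Rightarrow> real"

text \<open>The argument order is \<open>p i j t x s y\<close>. The conditional law of \<open>R\<close> given the state \<open>(x, i)\<close> at
  time \<open>t\<close> is taken in the version provided by the Markov family.\<close>

definition assumption_D1 ::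
    "('d::finite, 'l::finite) model \<Rightarrow> (real \<Rightarrow> 'd state \<Rightarrow> 'd path measure) \<Rightarrow>
       'd transition_density \<Rightarrow> bool" where
  "assumption_D1 K Pfam p \<longleftrightarrow>
     (\<forall>i\<in>regimes K. \<forall>j\<in>regimes K. \<forall>t s. 0 \<le> t \<and> t < s \<and> s \<le> horizon K \<longrightarrow>
        (\<lambda>(x, y). p i j t x s y) \<in> borel_measurable (borel \<Otimes>\<^sub>M borel) \<and>
        (\<forall>x y. 0 \<le> p i j t x s y) \<and>
        (\<forall>x. \<forall>B\<in>sets borel. emeasure (Pfam t (x, i)) {\<omega> \<in> paths K. fst (\<omega> s) \<in> B \<and> snd (\<omega> s) = j} =
           (\<integral>\<^sup>+y\<in>B. ennreal (p i j t x s y) \<partial>lborel)) \<and>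
        (\<exists>c. \<forall>x y. p i j t x s y \<le> c))"

definition assumption_D2 ::
    "('d::finite, 'l::finite) model \<Rightarrow> 'd path measure \<Rightarrow> ('d state \<Rightarrow> real) \<Rightarrow>
       ('d state \<Rightarrow> real) \<Rightarrow> bool" where
  "assumption_D2 K R f g \<longleftrightarrow>
     (\<forall>i\<in>regimes K. (\<integral>\<^sup>+x. ennreal (f (x, i)) \<partial>slice (marginal K R 0) i) < \<infinity>) \<and>
     (\<forall>j\<in>regimes K. bdd_above ((\<lambda>y. g (y, j)) ` supp (slice (marginal K R (horizon K)) j)))"

section \<open>Densities, iteration maps and the Schroedinger system\<close>

definition is_density ::
    "('d::finite, 'l::finite) model \<Rightarrow> 'd state measure \<Rightarrow> ('d state \<Rightarrow> real) \<Rightarrow> bool" where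
  "is_density K \<rho> r \<longleftrightarrow>
     r \<in> borel_measurable (state_space K) \<and> (\<forall>z\<in>space (state_space K). 0 \<le> r z) \<and>
     (\<forall>i\<in>regimes K. slice \<rho> i = density lborel (\<lambda>x. ennreal (r (x, i))))"

definition density_support :: "('d::finite state \<Rightarrow> real) \<Rightarrow> nat \<Rightarrow> (real ^ 'd) set" where
  "density_support r i = closure {x. r (x, i) \<noteq> 0}"

definition map_D :: "('d::finite state \<Rightarrow> real) \<Rightarrow> 'd state \<Rightarrow> real" where
  "map_D f = (\<lambda>z. 1 / f z)"

definition map_ET ::
    "('d::finite, 'l::finite) model \<Rightarrow> 'd transition_density \<Rightarrow> ('d state \<Rightarrow> real) \<Rightarrow>
       ('d state \<Rightarrow> real) \<Rightarrow> 'd state \<Rightarrow> real" where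
  "map_ET K p rT f = (\<lambda>(x, i). \<Sum>j\<in>regimes K.
     LINT y|lborel. p i j 0 x (horizon K) y * rT (y, j) * f (y, j))"

definition map_E0 ::
    "('d::finite, 'l::finite) model \<Rightarrow> 'd transition_density \<Rightarrow> ('d state \<Rightarrow> real) \<Rightarrow>
       ('d state \<Rightarrow> real) \<Rightarrow> 'd state \<Rightarrow> real" where
  "map_E0 K p r0 f = (\<lambda>(y, j). \<Sum>i\<in>regimes K.
     LINT x|lborel. p i j 0 x (horizon K) y * r0 (x, i) * f (x, i))"

definition map_C ::
    "('d::finite, 'l::finite) model \<Rightarrow> 'd transition_density \<Rightarrow> ('d state \<Rightarrow> real) \<Rightarrow>
       ('d state \<Rightarrow> real) \<Rightarrow> ('d state \<Rightarrow> real) \<Rightarrow> 'd state \<Rightarrow> real" where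
  "map_C K p r0 rT = map_E0 K p r0 \<circ> map_D \<circ> map_ET K p rT \<circ> map_D"

text \<open>\<open>L2_norm\<close> is meaningful only for functions in \<open>L2_on\<close>.\<close>

definition L2_on ::
    "('d::finite, 'l::finite) model \<Rightarrow> (nat \<Rightarrow> (real ^ 'd) set) \<Rightarrow> ('d state \<Rightarrow> real) \<Rightarrow> bool" where
  "L2_on K A f \<longleftrightarrow> f \<in> borel_measurable (state_space K) \<and>
     (\<forall>j\<in>regimes K. set_integrable lborel (A j) (\<lambda>y. (f (y, j))\<^sup>2))"

definition L2_norm ::
    "('d::finite, 'l::finite) model \<Rightarrow> (nat \<Rightarrow> (real ^ 'd) set) \<Rightarrow> ('d state \<Rightarrow> real) \<Rightarrow> real" where
  "L2_norm K A f = sqrt (\<Sum>j\<in>regimes K. LINT y:A j|lborel. (f (y, j))\<^sup>2)"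

text \<open>Nonnegative square-integrable functions that are nonzero where the iteration divides by them,
  normalized to norm one.\<close>

definition normalized_positive ::
    "('d::finite, 'l::finite) model \<Rightarrow> (nat \<Rightarrow> (real ^ 'd) set) \<Rightarrow> ('d state \<Rightarrow> real) \<Rightarrow> bool" where
  "normalized_positive K A f \<longleftrightarrow> L2_on K A f \<and> L2_norm K A f = 1 \<and>
     (\<forall>j\<in>regimes K. (\<forall>y. 0 \<le> f (y, j)) \<and> (\<forall>y\<in>A j. 0 < f (y, j)))"

text \<open>The unknowns are nonnegative; integrals are taken in \<open>[0,\<infinity>]\<close>, so the first two equations
  include that they are finite almost everywhere.\<close>

definition schroedinger_system ::
    "('d::finite, 'l::finite) model \<Rightarrow> 'd transition_density \<Rightarrow> ('d state \<Rightarrow> real) \<Rightarrow>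
       ('d state \<Rightarrow> real) \<Rightarrow> ('d state \<Rightarrow> real) \<Rightarrow> ('d state \<Rightarrow> real) \<Rightarrow> ('d state \<Rightarrow> real) \<Rightarrow>
       ('d state \<Rightarrow> real) \<Rightarrow> bool" where
  "schroedinger_system K p r0 rT phi0 phiT hphi0 hphiT \<longleftrightarrow>
     (\<forall>h\<in>{phi0, phiT, hphi0, hphiT}.
        h \<in> borel_measurable (state_space K) \<and> (\<forall>z\<in>space (state_space K). 0 \<le> h z)) \<and>
     (\<forall>i\<in>regimes K. AE x in lborel. ennreal (phi0 (x, i)) =
        (\<Sum>j\<in>regimes K. \<integral>\<^sup>+y. ennreal (p i j 0 x (horizon K) y * phiT (y, j)) \<partial>lborel)) \<and>
     (\<forall>j\<in>regimes K. AE y in lborel. ennreal (hphiT (y, j)) =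
        (\<Sum>i\<in>regimes K. \<integral>\<^sup>+x. ennreal (p i j 0 x (horizon K) y * hphi0 (x, i)) \<partial>lborel)) \<and>
     (\<forall>i\<in>regimes K. AE x in lborel. r0 (x, i) = phi0 (x, i) * hphi0 (x, i)) \<and>
     (\<forall>j\<in>regimes K. AE y in lborel. rT (y, j) = phiT (y, j) * hphiT (y, j))"

end

theory Submission
  imports Defs
begin

text \<open>On \<open>A0 \<times> AT\<close> the kernel lies between two positive constants \<open>m \<le> b\<close>.  If
  \<open>a g \<le> f \<le> a (1 + \<theta>) g\<close> on \<open>AT\<close>, Doeblin's argument gives such bounds for the images of
  \<open>f\<close> and \<open>g\<close> with \<open>\<theta>\<close> replaced by \<open>(1 - m / b) \<theta>\<close>; a two-sided bound of this shape is
  symmetric under inversion, so it passes through \<open>D\<close>.  Since the mean of \<open>C f / f\<close> under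
  \<open>\<rho>T\<close> is one, consecutive iterates agree up to factors \<open>1 + O((1 - m / b)^n)\<close>: the iterates
  converge to a fixed point, and any two fixed points are proportional.  A solution of the
  Schroedinger system yields a fixed point because, by Fubini, nothing it carries outside the
  supports of the targets is transported to where a target density is nonzero.\<close>

section \<open>Contraction for kernels bounded above and below\<close>

text \<open>\<open>C\<close> preserves order and is homogeneous of degree one, so contraction alone
  determines only a direction: the factor \<open>a\<close> in the two-sided bounds is not controlled
  and could drift with \<open>n\<close>. Such an argument by itself yields an eigenfunction; the
  mean-one identity forces the eigenvalue to be one. The bounds express Hilbert's projective metric
  without logarithms. The constants have different origins: \<open>b\<close> comes from the global
  boundedness of the transition density, \<open>m\<close> from its minimum over the compact
  supports. A support is a closure, so a target density may vanish on part of it: pointwise bounds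
  hold on the support, while integrals see only points of nonzero density. Competitors in the
  uniqueness claims satisfy their equations almost everywhere and need have no positive lower bound,
  so the contraction does not apply to them at once. One step of the iteration repairs this: the
  image of a positive function whose inverse is integrable against \<open>rT\<close> lies between
  positive constants on \<open>AT\<close>. That integrability has to be earned, since Bochner
  integrals and division by zero default to zero.\<close>

definition kernel_op ::
    "'a measure \<Rightarrow> ('a \<Rightarrow> 'a \<Rightarrow> real) \<Rightarrow> ('a \<Rightarrow> real) \<Rightarrow> ('a \<Rightarrow> real) \<Rightarrow> 'a \<Rightarrow> real" where
  "kernel_op L k s u x = (\<integral>y. k x y * s y * u y \<partial>L)"

text \<open>Measurability is asked on all of \<open>L\<close>, bounds on \<open>B\<close> only,
  because integration is against a density that vanishes off \<open>B\<close>. Any two members have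
  a quotient bounded above and below on \<open>B\<close>, which starts the contraction.\<close>

definition positive_on :: "'a measure \<Rightarrow> 'a set \<Rightarrow> ('a \<Rightarrow> real) \<Rightarrow> bool" where
  "positive_on L B f \<longleftrightarrow> f \<in> borel_measurable L \<and> (\<exists>c d. 0 < c \<and> (\<forall>y\<in>B. c \<le> f y \<and> f y \<le> d))"

locale bounded_kernel = sigma_finite_measure L
  for L :: "'a measure" +
  fixes k :: "'a \<Rightarrow> 'a \<Rightarrow> real" and r s :: "'a \<Rightarrow> real" and A B :: "'a set" and m b :: real
  assumes kernel_measurable [measurable]: "(\<lambda>(x, y). k x y) \<in> borel_measurable (L \<Otimes>\<^sub>M L)"
    and kernel_nonneg: "\<And>x y. x \<in> space L \<Longrightarrow> y \<in> space L \<Longrightarrow> 0 \<le> k x y"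
    and kernel_le: "\<And>x y. x \<in> space L \<Longrightarrow> y \<in> space L \<Longrightarrow> k x y \<le> b"
    and m_pos: "0 < m"
    and kernel_ge: "\<And>x y. x \<in> A \<Longrightarrow> y \<in> B \<Longrightarrow> m \<le> k x y"
    and r_int [measurable]: "integrable L r" and s_int [measurable]: "integrable L s"
    and r_one: "(\<integral>x. r x \<partial>L) = 1" and s_one: "(\<integral>y. s y \<partial>L) = 1"
    and r_nonneg: "\<And>x. x \<in> space L \<Longrightarrow> 0 \<le> r x" and s_nonneg: "\<And>y. y \<in> space L \<Longrightarrow> 0 \<le> s y"
    and A_space: "A \<subseteq> space L" and B_space: "B \<subseteq> space L"
    and r_supp: "\<And>x. x \<in> space L \<Longrightarrow> r x \<noteq> 0 \<Longrightarrow> x \<in> A"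
    and s_supp: "\<And>y. y \<in> space L \<Longrightarrow> s y \<noteq> 0 \<Longrightarrow> y \<in> B"
begin

section \<open>Elementary properties of the forward and backward operators\<close>

text \<open>Exchanging the two marginals preserves all assumptions. Proofs below interpret the
  locale a second time, as \<open>F\<close>, to read each fact about \<open>fwd\<close> as one about
  \<open>bwd\<close>.\<close>

lemma flip: "bounded_kernel L (\<lambda>x y. k y x) s r B A m b"
proof unfold_locales
  have "(\<lambda>(x, y). k x y) \<circ> (\<lambda>(x, y). (y, x)) \<in> borel_measurable (L \<Otimes>\<^sub>M L)"
    by measurable
  then show "(\<lambda>(x, y). k y x) \<in> borel_measurable (L \<Otimes>\<^sub>M L)"
    by (simp add: comp_def case_prod_beta)
qed (use kernel_nonneg kernel_le m_pos kernel_ge r_int s_int r_one s_one r_nonneg s_nonneg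
    A_space B_space r_supp s_supp in auto)

abbreviation "fwd \<equiv> kernel_op L k s"
abbreviation "bwd \<equiv> kernel_op L (\<lambda>x y. k y x) r"

text \<open>The map \<open>C\<close> in abstract form, with \<open>fwd\<close> and
  \<open>bwd\<close> in the roles of the two integral maps: one full round of Sinkhorn's iteration
  (iterative proportional fitting).\<close>

definition sinkhorn :: "('a \<Rightarrow> real) \<Rightarrow> 'a \<Rightarrow> real" where
  "sinkhorn f = bwd (\<lambda>x. 1 / fwd (\<lambda>y. 1 / f y) x)"

lemma s_meas [measurable]: "s \<in> borel_measurable L"
  and r_meas [measurable]: "r \<in> borel_measurable L"
  using s_int r_int by auto

lemma kernel_op_measurable [measurable]:
  assumes [measurable]: "u \<in> borel_measurable L"
  shows "fwd u \<in> borel_measurable L" "bwd u \<in> borel_measurable L"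
proof -
  interpret F: bounded_kernel L "\<lambda>x y. k y x" s r B A m b by (rule flip)
  note F.kernel_measurable [measurable]
  show "fwd u \<in> borel_measurable L" "bwd u \<in> borel_measurable L"
    unfolding kernel_op_def[abs_def] by measurable
qed

lemma sinkhorn_measurable [measurable]:
  assumes [measurable]: "f \<in> borel_measurable L"
  shows "sinkhorn f \<in> borel_measurable L"
  unfolding sinkhorn_def by measurable

lemma s_mult_nonneg:
  assumes "\<And>y. y \<in> B \<Longrightarrow> 0 \<le> u y" "y \<in> space L"
  shows "0 \<le> s y * u y"
  using assms s_nonneg[of y] s_supp[of y] by (cases "s y = 0") auto

lemma fwd_integrable:
  assumes [measurable]: "u \<in> borel_measurable L" and su: "integrable L (\<lambda>y. s y * u y)"
    and x[measurable]: "x \<in> space L"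
  shows "integrable L (\<lambda>y. k x y * s y * u y)"
proof (rule Bochner_Integration.integrable_bound)
  show "integrable L (\<lambda>y. b * (s y * u y))" using su by simp
  have "\<bar>k x y * (s y * u y)\<bar> \<le> \<bar>b * (s y * u y)\<bar>" if "y \<in> space L" for y
    using kernel_nonneg[OF x that] kernel_le[OF x that]
    unfolding abs_mult[of _ "s y * u y"] by (intro mult_right_mono) auto
  then show "AE y in L. norm (k x y * s y * u y) \<le> norm (b * (s y * u y))"
    by (intro AE_I2) (simp add: mult.assoc)
qed measurable

text \<open>The integral sees only points of \<open>B\<close>, where the kernel lies between
  \<open>m\<close> and \<open>b\<close>. Up to the factor \<open>b / m\<close> the image is
  therefore constant on \<open>A\<close>, whatever the shape of \<open>u\<close>.\<close>

lemma fwd_bounds: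
  assumes u[measurable]: "u \<in> borel_measurable L" and su: "integrable L (\<lambda>y. s y * u y)"
    and nn: "\<And>y. y \<in> B \<Longrightarrow> 0 \<le> u y"
  shows "x \<in> space L \<Longrightarrow> 0 \<le> fwd u x"
    and "x \<in> space L \<Longrightarrow> fwd u x \<le> b * (\<integral>y. s y * u y \<partial>L)"
    and "x \<in> A \<Longrightarrow> m * (\<integral>y. s y * u y \<partial>L) \<le> fwd u x"
proof -
  show "0 \<le> fwd u x" if x: "x \<in> space L"
    unfolding kernel_op_def mult.assoc
    by (intro integral_nonneg_AE AE_I2 mult_nonneg_nonneg kernel_nonneg s_mult_nonneg nn x) auto
  show "fwd u x \<le> b * (\<integral>y. s y * u y \<partial>L)" if x: "x \<in> space L"
  proof -
    have "fwd u x \<le> (\<integral>y. b * (s y * u y) \<partial>L)"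
      unfolding kernel_op_def
      by (intro integral_mono fwd_integrable su x u)
         (use su kernel_le[OF x] s_mult_nonneg[of u, OF nn] in \<open>auto simp: mult.assoc intro: mult_right_mono\<close>)
    then show ?thesis by simp
  qed
  show "m * (\<integral>y. s y * u y \<partial>L) \<le> fwd u x" if x: "x \<in> A"
  proof -
    have "m * (s y * u y) \<le> k x y * (s y * u y)" if y: "y \<in> space L" for y
      using s_mult_nonneg[of u, OF nn y] kernel_ge[OF x] s_supp[OF y]
      by (cases "s y = 0") (auto intro: mult_right_mono)
    then have "(\<integral>y. m * (s y * u y) \<partial>L) \<le> fwd u x"
      unfolding kernel_op_def using x A_space su
      by (intro integral_mono fwd_integrable su u) (auto simp: mult.assoc)
    then show ?thesis by simp
  qed
qed

lemma fwd_cong: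
  assumes "\<And>y. y \<in> B \<Longrightarrow> u y = v y"
  shows "fwd u = fwd v"
  unfolding kernel_op_def[abs_def]
proof (rule ext, rule Bochner_Integration.integral_cong[OF refl])
  show "k x y * s y * u y = k x y * s y * v y" if "y \<in> space L" for x y
    using assms[of y] s_supp[OF that] by (cases "s y = 0") auto
qed

lemma sinkhorn_cong:
  assumes "\<And>y. y \<in> B \<Longrightarrow> f y = g y"
  shows "sinkhorn f = sinkhorn g"
  unfolding sinkhorn_def using fwd_cong[of "\<lambda>y. 1 / f y" "\<lambda>y. 1 / g y"] assms by simp

lemma fwd_mono:
  assumes "u \<in> borel_measurable L" "integrable L (\<lambda>y. s y * u y)"
    and "v \<in> borel_measurable L" "integrable L (\<lambda>y. s y * v y)"
    and "\<And>y. y \<in> B \<Longrightarrow> u y \<le> v y" and x: "x \<in> space L"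
  shows "fwd u x \<le> fwd v x"
  unfolding kernel_op_def
proof (intro integral_mono fwd_integrable assms)
  show "k x y * s y * u y \<le> k x y * s y * v y" if "y \<in> space L" for y
    using assms(5)[of y] s_supp[OF that] kernel_nonneg[OF x that] s_nonneg[OF that]
    by (cases "s y = 0") (auto intro!: mult_left_mono)
qed

lemma fwd_scale: "fwd (\<lambda>y. c * u y) x = c * fwd u x"
  unfolding kernel_op_def by (simp flip: integral_mult_right_zero add: ac_simps)

lemma fwd_add_scaled:
  assumes "u \<in> borel_measurable L" "integrable L (\<lambda>y. s y * u y)"
    and "v \<in> borel_measurable L" "integrable L (\<lambda>y. s y * v y)" and x: "x \<in> space L"
  shows "fwd (\<lambda>y. a * u y + c * v y) x = a * fwd u x + c * fwd v x"
proof -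
  have "fwd (\<lambda>y. a * u y + c * v y) x = (\<integral>y. a * (k x y * s y * u y) + c * (k x y * s y * v y) \<partial>L)"
    unfolding kernel_op_def by (simp add: algebra_simps)
  also have "\<dots> = a * fwd u x + c * fwd v x"
    unfolding kernel_op_def using assms by (simp add: fwd_integrable)
  finally show ?thesis .
qed

lemma not_AE_s_zero: "\<not> (AE y in L. s y = 0)"
proof
  assume "AE y in L. s y = 0"
  then have "(\<integral>y. s y \<partial>L) = (\<integral>y. 0 \<partial>L)" by (intro integral_cong_AE) auto
  then show False using s_one by simp
qed

lemma B_nonempty: "B \<noteq> {}"
  using not_AE_s_zero s_supp by (auto intro!: AE_I2)

lemma A_nonempty: "A \<noteq> {}"
proof -
  interpret F: bounded_kernel L "\<lambda>x y. k y x" s r B A m b by (rule flip)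
  show ?thesis by (rule F.B_nonempty)
qed

lemma m_le_b: "m \<le> b"
proof -
  obtain x y where "x \<in> A" "y \<in> B" using A_nonempty B_nonempty by auto
  then show ?thesis using kernel_ge[of x y] kernel_le[of x y] A_space B_space by fastforce
qed

lemma integral_s_mult_pos:
  assumes [measurable]: "u \<in> borel_measurable L" and su: "integrable L (\<lambda>y. s y * u y)"
    and nn: "\<And>y. y \<in> B \<Longrightarrow> 0 \<le> u y" and pos: "AE y in L. s y \<noteq> 0 \<longrightarrow> 0 < u y"
  shows "0 < (\<integral>y. s y * u y \<partial>L)"
proof -
  have ge: "AE y in L. 0 \<le> s y * u y" using s_mult_nonneg[of u, OF nn] by auto
  have "\<not> (AE y in L. s y * u y = 0)"
  proof
    assume "AE y in L. s y * u y = 0"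
    with pos have "AE y in L. s y = 0" by eventually_elim auto
    then show False using not_AE_s_zero by simp
  qed
  then show ?thesis
    using integral_nonneg_eq_0_iff_AE[OF su ge] integral_nonneg_AE[OF ge] by linarith
qed

lemma integrable_s_mult_bounded:
  assumes [measurable]: "u \<in> borel_measurable L" and "\<And>y. y \<in> B \<Longrightarrow> \<bar>u y\<bar> \<le> d"
  shows "integrable L (\<lambda>y. s y * u y)"
proof (rule Bochner_Integration.integrable_bound)
  show "integrable L (\<lambda>y. d * s y)" using s_int by simp
  have "\<bar>s y * u y\<bar> \<le> \<bar>d * s y\<bar>" if "y \<in> space L" for y
    using assms(2)[of y] s_nonneg[OF that] s_supp[OF that]
    by (cases "s y = 0") (auto simp: abs_mult mult.commute intro: mult_right_mono)
  then show "AE y in L. norm (s y * u y) \<le> norm (d * s y)" by auto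
qed measurable

text \<open>Doeblin's argument: replacing \<open>k\<close> by its lower bound \<open>m\<close> in both \<open>fwd (u - a v)\<close> and
  \<open>fwd (a (1 + \<theta>) v - u)\<close> narrows the range of the quotient from both sides.\<close>

lemma fwd_contraction:
  assumes u[measurable]: "u \<in> borel_measurable L" "integrable L (\<lambda>y. s y * u y)"
    and v[measurable]: "v \<in> borel_measurable L" "integrable L (\<lambda>y. s y * v y)"
    and vnn: "\<And>y. y \<in> B \<Longrightarrow> 0 \<le> v y" and J: "0 < (\<integral>y. s y * v y \<partial>L)"
    and a: "0 < a" and \<theta>: "0 \<le> \<theta>"
    and le: "\<And>y. y \<in> B \<Longrightarrow> a * v y \<le> u y \<and> u y \<le> a * (1 + \<theta>) * v y"
  shows "\<exists>a'>0. \<forall>x\<in>A. a' * fwd v x \<le> fwd u x \<and> fwd u x \<le> a' * (1 + (1 - m / b) * \<theta>) * fwd v x"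
proof -
  define I J where "I = (\<integral>y. s y * u y \<partial>L)" and "J = (\<integral>y. s y * v y \<partial>L)"
  define \<delta> where "\<delta> = m / b"
  have \<delta>: "0 < \<delta>" "\<delta> \<le> 1" "m = \<delta> * b" "0 < b" using m_pos m_le_b by (auto simp: \<delta>_def)
  \<comment> \<open>\<open>I / J\<close> is the mean of the quotient \<open>u / v\<close> under the
    weight \<open>s v\<close>; \<open>t\<close> is its height above the lower end
    \<open>a\<close>.\<close>
  define t where "t = I / J - a"
  have J0: "0 < J" using J by (simp add: J_def)
  have aJ: "a * J \<le> I"
  proof -
    have "(\<integral>y. a * (s y * v y) \<partial>L) \<le> I"
      unfolding I_def
    proof (intro integral_mono)
      show "a * (s y * v y) \<le> s y * u y" if "y \<in> space L" for y
        using le[of y] s_nonneg[OF that] s_supp[OF that]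
        by (cases "s y = 0") (auto simp: mult.left_commute[of a])
    qed (use u v in auto)
    then show ?thesis by (simp add: J_def)
  qed
  have t0: "0 \<le> t" using aJ J0 by (simp add: t_def pos_le_divide_eq)
  have I_eq: "I = (a + t) * J" using J0 by (simp add: t_def)
  \<comment> \<open>The lower end moves towards the mean \<open>I / J\<close> by the fraction
    \<open>\<delta>\<close>. The upper end will move down towards the same mean by the same
    fraction, so the width shrinks by \<open>1 - \<delta>\<close>.\<close>
  define a' where "a' = a + \<delta> * t"
  have a'a: "a \<le> a'" using \<delta> t0 by (simp add: a'_def)
  have "a' * fwd v x \<le> fwd u x \<and> fwd u x \<le> a' * (1 + (1 - m / b) * \<theta>) * fwd v x" if x: "x \<in> A" for x
  proof -
    have xs: "x \<in> space L" using x A_space by auto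
    \<comment> \<open>Converts the constant \<open>m * J\<close>, gained from the lower kernel
      bound, into a multiple of \<open>fwd v x\<close>; this is where the upper bound
      \<open>b\<close> enters.\<close>
    have V: "0 \<le> fwd v x" "\<delta> * fwd v x \<le> m * J"
      using fwd_bounds[OF v vnn, of x] xs \<delta> by (auto simp: J_def)
    have i1: "integrable L (\<lambda>y. s y * (1 * u y + (- a) * v y))"
      using u v by (simp add: algebra_simps)
    have "m * (\<integral>y. s y * (1 * u y + (- a) * v y) \<partial>L) \<le> fwd (\<lambda>y. 1 * u y + (- a) * v y) x"
      using x le by (intro fwd_bounds i1) auto
    moreover have "(\<integral>y. s y * (1 * u y + (- a) * v y) \<partial>L) = I - a * J"
    proof -
      have "(\<integral>y. s y * (1 * u y + (- a) * v y) \<partial>L) = (\<integral>y. s y * u y - a * (s y * v y) \<partial>L)"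
        by (intro Bochner_Integration.integral_cong) (auto simp: algebra_simps)
      then show ?thesis using u v by (simp add: I_def J_def)
    qed
    ultimately have lo: "m * (I - a * J) \<le> fwd u x - a * fwd v x"
      using fwd_add_scaled[OF u v xs, of 1 "- a"] by simp
    have i2: "integrable L (\<lambda>y. s y * ((-1) * u y + a * (1 + \<theta>) * v y))"
    proof -
      have "integrable L (\<lambda>y. a * (1 + \<theta>) * (s y * v y) - s y * u y)" using u v by auto
      then show ?thesis by (simp add: algebra_simps)
    qed
    have "m * (\<integral>y. s y * ((-1) * u y + a * (1 + \<theta>) * v y) \<partial>L) \<le>
        fwd (\<lambda>y. (-1) * u y + a * (1 + \<theta>) * v y) x"
      using x le by (intro fwd_bounds i2) auto
    moreover have "(\<integral>y. s y * ((-1) * u y + a * (1 + \<theta>) * v y) \<partial>L) = a * (1 + \<theta>) * J - I"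
    proof -
      have "(\<integral>y. s y * ((-1) * u y + a * (1 + \<theta>) * v y) \<partial>L) =
          (\<integral>y. a * (1 + \<theta>) * (s y * v y) - s y * u y \<partial>L)"
        by (intro Bochner_Integration.integral_cong) (auto simp: algebra_simps)
      then show ?thesis using u v by (simp add: I_def J_def)
    qed
    ultimately have hi: "m * (a * (1 + \<theta>) * J - I) \<le> a * (1 + \<theta>) * fwd v x - fwd u x"
      using fwd_add_scaled[OF u v xs, of "-1" "a * (1 + \<theta>)"] by simp
    have "\<delta> * t * fwd v x \<le> m * (I - a * J)"
      using mult_left_mono[OF V(2) t0] by (simp add: I_eq algebra_simps)
    with lo have L1: "a' * fwd v x \<le> fwd u x" by (simp add: a'_def algebra_simps)
    have "t * J \<le> a * \<theta> * J"
    proof -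
      have "I \<le> a * (1 + \<theta>) * J"
      proof -
        have "0 \<le> (\<integral>y. s y * ((-1) * u y + a * (1 + \<theta>) * v y) \<partial>L)"
          by (intro integral_nonneg_AE AE_I2 s_mult_nonneg) (use le in auto)
        then show ?thesis
          using \<open>(\<integral>y. s y * ((-1) * u y + a * (1 + \<theta>) * v y) \<partial>L) = a * (1 + \<theta>) * J - I\<close> by simp
      qed
      then show ?thesis by (simp add: I_eq algebra_simps)
    qed
    then have t1: "t \<le> a * \<theta>" using J0 by simp
    have "\<delta> * (a * \<theta> - t) * fwd v x \<le> m * (a * (1 + \<theta>) * J - I)"
      using mult_left_mono[OF V(2), of "a * \<theta> - t"] t1 by (simp add: I_eq algebra_simps)
    with hi have "fwd u x \<le> (a * (1 + \<theta>) - \<delta> * (a * \<theta> - t)) * fwd v x"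
      by (simp add: algebra_simps)
    also have "a * (1 + \<theta>) - \<delta> * (a * \<theta> - t) = a' + a * ((1 - \<delta>) * \<theta>)"
      by (simp add: a'_def algebra_simps)
    \<comment> \<open>The width is measured relative to \<open>a\<close>; as
      \<open>a \<le> a'\<close>, it may be measured relative to the new lower end.\<close>
    also have "(a' + a * ((1 - \<delta>) * \<theta>)) * fwd v x \<le> (a' + a' * ((1 - \<delta>) * \<theta>)) * fwd v x"
      by (intro mult_right_mono add_left_mono) (use a'a V \<delta> \<theta> in auto)
    finally have "fwd u x \<le> a' * (1 + (1 - m / b) * \<theta>) * fwd v x"
      by (simp add: \<delta>_def algebra_simps)
    with L1 show ?thesis by simp
  qed
  moreover have "0 < a'" using a a'a by simp
  ultimately show ?thesis by blast
qed

section \<open>Functions between positive constants; order and scaling\<close>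

lemma positive_onD:
  assumes "positive_on L B f"
  shows "f \<in> borel_measurable L" "\<And>y. y \<in> B \<Longrightarrow> 0 < f y"
  using assms unfolding positive_on_def by fastforce+

lemma positive_on_inverse:
  assumes f: "positive_on L B f"
  shows "integrable L (\<lambda>y. s y * (1 / f y))" and "0 < (\<integral>y. s y * (1 / f y) \<partial>L)"
proof -
  note [measurable] = positive_onD(1)[OF f]
  obtain c where c: "0 < c" "\<And>y. y \<in> B \<Longrightarrow> c \<le> f y"
    using f by (auto simp: positive_on_def)
  have "\<bar>1 / f y\<bar> \<le> 1 / c" if "y \<in> B" for y
    using c(1) c(2)[OF that] by (auto simp: divide_simps)
  then show i: "integrable L (\<lambda>y. s y * (1 / f y))"
    by (intro integrable_s_mult_bounded) auto
  show "0 < (\<integral>y. s y * (1 / f y) \<partial>L)"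
    using positive_onD(2)[OF f] s_supp by (intro integral_s_mult_pos i) (auto intro: less_imp_le)
qed

text \<open>The gain of regularity: \<open>u\<close> is merely integrable against \<open>s\<close>,
  yet averaging with a kernel between \<open>m\<close> and \<open>b\<close> yields positive bounds
  on both sides. This is how unbounded competitors enter the contraction.\<close>

lemma positive_on_fwd:
  assumes [measurable]: "u \<in> borel_measurable L" and i: "integrable L (\<lambda>y. s y * u y)"
    and nn: "\<And>y. y \<in> B \<Longrightarrow> 0 \<le> u y" and pos: "0 < (\<integral>y. s y * u y \<partial>L)"
  shows "positive_on L A (fwd u)"
proof -
  have "0 < m * (\<integral>y. s y * u y \<partial>L)" using m_pos pos by simp
  moreover have "m * (\<integral>y. s y * u y \<partial>L) \<le> fwd u x \<and> fwd u x \<le> b * (\<integral>y. s y * u y \<partial>L)"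
    if "x \<in> A" for x
    using fwd_bounds[OF _ i nn, of x] that A_space by auto
  ultimately show ?thesis unfolding positive_on_def using kernel_op_measurable(1)[OF assms(1)] by blast
qed

lemma positive_on_fwd_inverse:
  assumes f: "positive_on L B f"
  shows "positive_on L A (fwd (\<lambda>y. 1 / f y))"
  using positive_on_inverse[OF f] positive_onD[OF f]
  by (intro positive_on_fwd) (auto intro: less_imp_le)

lemma positive_on_bwd_inverse:
  assumes "positive_on L A v"
  shows "positive_on L B (bwd (\<lambda>x. 1 / v x))"
proof -
  interpret F: bounded_kernel L "\<lambda>x y. k y x" s r B A m b by (rule flip)
  show ?thesis by (rule F.positive_on_fwd_inverse) fact
qed

lemma positive_on_sinkhorn:
  "positive_on L B f \<Longrightarrow> positive_on L B (sinkhorn f)"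
  unfolding sinkhorn_def by (intro positive_on_bwd_inverse positive_on_fwd_inverse)

lemma sinkhorn_nonneg:
  assumes f: "positive_on L B f" and y: "y \<in> space L"
  shows "0 \<le> sinkhorn f y"
proof -
  interpret F: bounded_kernel L "\<lambda>x y. k y x" s r B A m b by (rule flip)
  note P = positive_on_fwd_inverse[OF f]
  show ?thesis
    unfolding sinkhorn_def
    by (rule F.fwd_bounds)
      (use F.positive_on_inverse[OF P] F.positive_onD[OF P] y in \<open>auto intro: less_imp_le\<close>)
qed

lemma bwd_inverse_antimono:
  assumes v: "positive_on L A v" and w: "positive_on L A w" and a: "0 < a"
    and le: "\<And>x. x \<in> A \<Longrightarrow> w x \<le> a * v x" and y: "y \<in> space L"
  shows "bwd (\<lambda>x. 1 / v x) y \<le> a * bwd (\<lambda>x. 1 / w x) y"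
proof -
  interpret F: bounded_kernel L "\<lambda>x y. k y x" s r B A m b by (rule flip)
  have "bwd (\<lambda>x. 1 / v x) y \<le> bwd (\<lambda>x. a * (1 / w x)) y"
  proof (rule F.fwd_mono[OF _ _ _ _ _ y])
    show "1 / v x \<le> a * (1 / w x)" if "x \<in> A" for x
      using le[OF that] F.positive_onD(2)[OF v that] F.positive_onD(2)[OF w that]
      by (simp add: divide_simps mult.commute)
    show "integrable L (\<lambda>x. r x * (1 / v x))" using F.positive_on_inverse[OF v] by simp
    show "integrable L (\<lambda>x. r x * (a * (1 / w x)))"
      using integrable_mult_right[OF F.positive_on_inverse(1)[OF w], of a]
      by (simp only: mult.left_commute[of _ a])
  qed (use F.positive_onD(1) v w in auto)
  then show ?thesis by (simp only: F.fwd_scale)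
qed

lemma fwd_inverse_antimono:
  assumes "positive_on L B f" "positive_on L B g" "0 < a"
    and "\<And>y. y \<in> B \<Longrightarrow> g y \<le> a * f y" and "x \<in> space L"
  shows "fwd (\<lambda>y. 1 / f y) x \<le> a * fwd (\<lambda>y. 1 / g y) x"
proof -
  interpret F: bounded_kernel L "\<lambda>x y. k y x" s r B A m b by (rule flip)
  show ?thesis using F.bwd_inverse_antimono[OF assms] .
qed

text \<open>Each half step inverts once and so reverses the order; the two reversals cancel, and the
  factor \<open>a\<close> passes through both.\<close>

lemma sinkhorn_mono:
  assumes f: "positive_on L B f" and g: "positive_on L B g" and a: "0 < a"
    and le: "\<And>y. y \<in> B \<Longrightarrow> f y \<le> a * g y" and y: "y \<in> space L"
  shows "sinkhorn f y \<le> a * sinkhorn g y"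
  unfolding sinkhorn_def
  by (intro bwd_inverse_antimono positive_on_fwd_inverse fwd_inverse_antimono assms)
    (use A_space in auto)

lemma fwd_inverse_scale: "fwd (\<lambda>y. 1 / (c * f y)) x = (1 / c) * fwd (\<lambda>y. 1 / f y) x"
  using fwd_scale[of "1 / c" "\<lambda>y. 1 / f y" x] by (simp add: field_simps)

text \<open>The two inversions cancel on the constant. No sign condition on \<open>c\<close>
  appears: even \<open>c = 0\<close> is covered by the convention \<open>1 / 0 = 0\<close>. Fixed
  points can thus be normalized.\<close>

lemma sinkhorn_scale:
  "sinkhorn (\<lambda>y. c * f y) y = c * sinkhorn f y"
proof -
  interpret F: bounded_kernel L "\<lambda>x y. k y x" s r B A m b by (rule flip)
  show ?thesis
    unfolding sinkhorn_def fwd_inverse_scale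
    using F.fwd_inverse_scale[of "1 / c" "\<lambda>x. fwd (\<lambda>y. 1 / f y) x" y] by simp
qed

text \<open>Inversion exchanges the two ends of the bounds and keeps \<open>\<theta>\<close>. Only
  the forward half step is used as a contraction, the backward one merely as monotone; hence the
  factor \<open>1 - m / b\<close> and not its square.\<close>

lemma sinkhorn_contraction:
  assumes f: "positive_on L B f" and g: "positive_on L B g" and a: "0 < a" and \<theta>: "0 \<le> \<theta>"
    and le: "\<And>y. y \<in> B \<Longrightarrow> a * g y \<le> f y \<and> f y \<le> a * (1 + \<theta>) * g y"
  shows "\<exists>a'>0. \<forall>y\<in>space L. a' * sinkhorn g y \<le> sinkhorn f y \<and>
      sinkhorn f y \<le> a' * (1 + (1 - m / b) * \<theta>) * sinkhorn g y"
proof -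
  define \<kappa> where "\<kappa> = (1 - m / b) * \<theta>"
  have \<kappa>: "0 \<le> \<kappa>" unfolding \<kappa>_def using m_pos m_le_b \<theta> by (intro mult_nonneg_nonneg) auto
  have "\<exists>a'>0. \<forall>x\<in>A. a' * fwd (\<lambda>y. 1 / g y) x \<le> fwd (\<lambda>y. 1 / f y) x \<and>
      fwd (\<lambda>y. 1 / f y) x \<le> a' * (1 + (1 - m / b) * \<theta>) * fwd (\<lambda>y. 1 / g y) x"
  proof (rule fwd_contraction)
    show "1 / (a * (1 + \<theta>)) * (1 / g y) \<le> 1 / f y \<and>
        1 / f y \<le> 1 / (a * (1 + \<theta>)) * (1 + \<theta>) * (1 / g y)" if "y \<in> B" for y
      using le[OF that] positive_onD(2)[OF f that] positive_onD(2)[OF g that] a \<theta>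
      by (simp add: divide_simps mult.commute)
  qed (use positive_onD f g positive_on_inverse a \<theta> in \<open>auto intro: less_imp_le\<close>)
  then obtain c where c: "0 < c" and
    lo: "\<And>x. x \<in> A \<Longrightarrow> c * fwd (\<lambda>y. 1 / g y) x \<le> fwd (\<lambda>y. 1 / f y) x" and
    up: "\<And>x. x \<in> A \<Longrightarrow> fwd (\<lambda>y. 1 / f y) x \<le> c * (1 + \<kappa>) * fwd (\<lambda>y. 1 / g y) x"
    unfolding \<kappa>_def by blast
  note P = positive_on_fwd_inverse[OF f] positive_on_fwd_inverse[OF g]
  have c1: "0 < c * (1 + \<kappa>)" using c \<kappa> by simp
  have "1 / (c * (1 + \<kappa>)) * sinkhorn g y \<le> sinkhorn f y \<and>
      sinkhorn f y \<le> 1 / (c * (1 + \<kappa>)) * (1 + \<kappa>) * sinkhorn g y" if y: "y \<in> space L" for y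
  proof
    have "sinkhorn g y \<le> c * (1 + \<kappa>) * sinkhorn f y"
      unfolding sinkhorn_def by (rule bwd_inverse_antimono) (use P c1 up y in auto)
    then show "1 / (c * (1 + \<kappa>)) * sinkhorn g y \<le> sinkhorn f y"
      using c1 by (simp add: pos_divide_le_eq mult.commute)
    have "sinkhorn f y \<le> 1 / c * sinkhorn g y"
      unfolding sinkhorn_def by (rule bwd_inverse_antimono) (use P c lo y in \<open>auto simp: field_simps\<close>)
    then show "sinkhorn f y \<le> 1 / (c * (1 + \<kappa>)) * (1 + \<kappa>) * sinkhorn g y" using \<kappa> by simp
  qed
  moreover have "0 < 1 / (c * (1 + \<kappa>))" using c1 by simp
  ultimately show ?thesis unfolding \<kappa>_def by blast
qed

text \<open>Fubini for the coupling density \<open>h\<close>: integrating out \<open>y\<close> gives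
  \<open>r\<close>, since \<open>\<Phi>\<close> is exactly the normalizing factor; integrating out
  \<open>x\<close> gives \<open>s\<close> times the quotient. Both marginals have the mass of
  \<open>r\<close>, which is one.\<close>

lemma sinkhorn_conservation:
  assumes f: "positive_on L B f"
  shows "integrable L (\<lambda>y. s y * (sinkhorn f y / f y))"
    and "(\<integral>y. s y * (sinkhorn f y / f y) \<partial>L) = 1"
proof -
  interpret P: pair_sigma_finite L L ..
  define \<Phi> where "\<Phi> = fwd (\<lambda>y. 1 / f y)"
  note P = positive_on_fwd_inverse[OF f, folded \<Phi>_def]
  interpret F: bounded_kernel L "\<lambda>x y. k y x" s r B A m b by (rule flip)
  note [measurable] = positive_onD(1)[OF f] F.positive_onD(1)[OF P]
  define h where "h = (\<lambda>x y. r x * (1 / \<Phi> x) * (k x y * s y * (1 / f y)))"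
  have hm: "case_prod h \<in> borel_measurable (L \<Otimes>\<^sub>M L)" unfolding h_def by measurable
  \<comment> \<open>The function \<open>\<Phi>\<close> may vanish off \<open>A\<close>, but there
    both sides are zero because \<open>r\<close> is.\<close>
  have inner: "(\<integral>y. h x y \<partial>L) = r x" if "x \<in> space L" for x
  proof -
    have "(\<integral>y. h x y \<partial>L) = r x * (1 / \<Phi> x) * \<Phi> x"
      by (simp only: h_def \<Phi>_def kernel_op_def integral_mult_right_zero)
    then show ?thesis using F.positive_onD(2)[OF P] r_supp[OF that] by (cases "r x = 0") force+
  qed
  have hnn: "0 \<le> h x y" if "x \<in> space L" "y \<in> space L" for x y
    unfolding h_def mult.assoc[of "k x y"]
    by (intro mult_nonneg_nonneg kernel_nonneg s_mult_nonneg F.s_mult_nonneg that)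
      (use positive_onD(2)[OF f] F.positive_onD(2)[OF P] in \<open>auto intro: less_imp_le\<close>)
  have int: "integrable (L \<Otimes>\<^sub>M L) (case_prod h)"
  proof (rule P.Fubini_integrable[OF hm])
    have "(\<integral>y. norm (case_prod h (x, y)) \<partial>L) = r x" if "x \<in> space L" for x
      using inner[OF that] hnn[OF that] by (simp cong: Bochner_Integration.integral_cong)
    then show "integrable L (\<lambda>x. \<integral>y. norm (case_prod h (x, y)) \<partial>L)"
      using r_int by (simp cong: Bochner_Integration.integrable_cong)
    show "AE x in L. integrable L (\<lambda>y. case_prod h (x, y))"
      unfolding h_def prod.case
      by (intro AE_I2 integrable_mult_right fwd_integrable positive_on_inverse f) measurable
  qed
  have eq: "(\<integral>x. h x y \<partial>L) = s y * (sinkhorn f y / f y)" for y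
  proof -
    have "(\<integral>x. h x y \<partial>L) = (\<integral>x. (s y / f y) * (k x y * r x * (1 / \<Phi> x)) \<partial>L)"
      unfolding h_def by (intro Bochner_Integration.integral_cong) (auto simp: ac_simps)
    also have "\<dots> = (s y / f y) * (\<integral>x. k x y * r x * (1 / \<Phi> x) \<partial>L)"
      by (rule integral_mult_right_zero)
    finally show ?thesis unfolding sinkhorn_def \<Phi>_def kernel_op_def by simp
  qed
  show "integrable L (\<lambda>y. s y * (sinkhorn f y / f y))"
    using P.integrable_snd[OF int] by (simp add: eq)
  have "(\<integral>y. s y * (sinkhorn f y / f y) \<partial>L) = (\<integral>x. (\<integral>y. h x y \<partial>L) \<partial>L)"
    using P.Fubini_integral[OF int] by (simp add: eq)
  also have "\<dots> = (\<integral>x. r x \<partial>L)" by (intro Bochner_Integration.integral_cong) (auto simp: inner)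
  finally show "(\<integral>y. s y * (sinkhorn f y / f y) \<partial>L) = 1" by (simp add: r_one)
qed

section \<open>Iterates, and existence and uniqueness of the fixed point\<close>

lemma positive_on_funpow:
  "positive_on L B f \<Longrightarrow> positive_on L B ((sinkhorn ^^ n) f)"
  by (induction n) (auto intro: positive_on_sinkhorn)

lemma contraction_factor: "0 \<le> 1 - m / b" "1 - m / b < 1"
  using m_pos m_le_b by (auto simp: divide_simps)

lemma sinkhorn_funpow_contraction:
  assumes f: "positive_on L B f" and g: "positive_on L B g"
  shows "\<exists>\<theta>\<ge>0. \<forall>n. \<exists>a>0. \<forall>y\<in>B. a * (sinkhorn ^^ n) g y \<le> (sinkhorn ^^ n) f y \<and>
      (sinkhorn ^^ n) f y \<le> a * (1 + (1 - m / b) ^ n * \<theta>) * (sinkhorn ^^ n) g y"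
proof -
  obtain c d where c: "0 < c" "\<And>y. y \<in> B \<Longrightarrow> c \<le> f y \<and> f y \<le> d"
    using f by (auto simp: positive_on_def)
  obtain c' d' where c': "0 < c'" "\<And>y. y \<in> B \<Longrightarrow> c' \<le> g y \<and> g y \<le> d'"
    using g by (auto simp: positive_on_def)
  obtain y0 where "y0 \<in> B" using B_nonempty by auto
  then have d: "c \<le> d" "c' \<le> d'" using c(2) c'(2) by force+
  \<comment> \<open>On \<open>B\<close> the quotient \<open>f / g\<close> ranges between
    \<open>c / d'\<close> and \<open>d / c'\<close>; \<open>1 + \<theta>\<close> is the quotient of
    these extremes.\<close>
  define a where "a = c / d'"
  have a: "0 < a" using c c' d by (simp add: a_def)
  define \<theta> where "\<theta> = d * d' / (c * c') - 1"
  have "c * c' \<le> d * d'" using c c' d by (intro mult_mono) auto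
  then have \<theta>: "0 \<le> \<theta>" using c c' by (simp add: \<theta>_def)
  have a\<theta>: "a * (1 + \<theta>) = d / c'" using c c' d by (simp add: a_def \<theta>_def)
  have start: "a * g y \<le> f y \<and> f y \<le> a * (1 + \<theta>) * g y" if "y \<in> B" for y
  proof
    have "a * g y \<le> a * d'" using a c'(2)[OF that] by simp
    also have "\<dots> = c" using c' d by (simp add: a_def)
    finally show "a * g y \<le> f y" using c(2)[OF that] by simp
    have "f y \<le> d / c' * c'" using c(2)[OF that] c' by simp
    also have "\<dots> \<le> d / c' * g y" using c c' d c'(2)[OF that] by (intro mult_left_mono) auto
    finally show "f y \<le> a * (1 + \<theta>) * g y" by (simp add: a\<theta>)
  qed
  have "\<exists>a>0. \<forall>y\<in>B. a * (sinkhorn ^^ n) g y \<le> (sinkhorn ^^ n) f y \<and>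
      (sinkhorn ^^ n) f y \<le> a * (1 + (1 - m / b) ^ n * \<theta>) * (sinkhorn ^^ n) g y" for n
  proof (induction n)
    case 0
    then show ?case using a start by auto
  next
    case (Suc n)
    then obtain a where a: "0 < a" and le: "\<And>y. y \<in> B \<Longrightarrow> a * (sinkhorn ^^ n) g y \<le> (sinkhorn ^^ n) f y \<and>
        (sinkhorn ^^ n) f y \<le> a * (1 + (1 - m / b) ^ n * \<theta>) * (sinkhorn ^^ n) g y" by blast
    have "0 \<le> (1 - m / b) ^ n * \<theta>" using contraction_factor \<theta> by simp
    from sinkhorn_contraction[OF positive_on_funpow[OF f] positive_on_funpow[OF g] a this le]
    obtain a' where "0 < a'" "\<forall>y\<in>space L. a' * sinkhorn ((sinkhorn ^^ n) g) y \<le> sinkhorn ((sinkhorn ^^ n) f) y \<and>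
        sinkhorn ((sinkhorn ^^ n) f) y \<le> a' * (1 + (1 - m / b) * ((1 - m / b) ^ n * \<theta>)) * sinkhorn ((sinkhorn ^^ n) g) y"
      by blast
    then show ?case using B_space by (intro exI[of _ a']) (auto simp: mult.assoc)
  qed
  then show ?thesis using \<theta> by blast
qed

lemma sinkhorn_funpow_fixed:
  assumes "\<And>y. y \<in> B \<Longrightarrow> sinkhorn g y = g y" "y \<in> B"
  shows "(sinkhorn ^^ n) g y = g y"
  using assms(2)
proof (induction n arbitrary: y)
  case (Suc n)
  have "sinkhorn ((sinkhorn ^^ n) g) = sinkhorn g" by (intro sinkhorn_cong Suc.IH)
  then show ?case using assms(1) Suc.prems by simp
qed simp

text \<open>Fixed points equal their own iterates, so the bounds hold for every \<open>n\<close>.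
  The scale \<open>a\<close> may depend on \<open>n\<close>; comparing the bounds at two points
  \<open>y\<close> and \<open>z\<close> eliminates it, and letting \<open>n\<close> grow leaves an
  inequality that is symmetric in \<open>y\<close> and \<open>z\<close>, hence an equality.\<close>

lemma sinkhorn_fixed_proportional:
  assumes f: "positive_on L B f" and g: "positive_on L B g"
    and ff: "\<And>y. y \<in> B \<Longrightarrow> sinkhorn f y = f y" and gf: "\<And>y. y \<in> B \<Longrightarrow> sinkhorn g y = g y"
  shows "\<exists>t>0. \<forall>y\<in>B. f y = t * g y"
proof -
  obtain \<theta> where \<theta>: "0 \<le> \<theta>" and le: "\<And>n. \<exists>a>0. \<forall>y\<in>B. a * g y \<le> f y \<and>
      f y \<le> a * (1 + (1 - m / b) ^ n * \<theta>) * g y"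
    using sinkhorn_funpow_contraction[OF f g] sinkhorn_funpow_fixed[OF ff] sinkhorn_funpow_fixed[OF gf]
    by auto
  have cross: "f y * g z \<le> f z * g y" if yz: "y \<in> B" "z \<in> B" for y z
  proof (rule LIMSEQ_le_const)
    have "(\<lambda>n. (1 - m / b) ^ n) \<longlonglongrightarrow> 0" using contraction_factor by (rule LIMSEQ_realpow_zero)
    then have "(\<lambda>n. (1 + (1 - m / b) ^ n * \<theta>) * (f z * g y)) \<longlonglongrightarrow> (1 + 0 * \<theta>) * (f z * g y)"
      by (intro tendsto_add tendsto_mult tendsto_const)
    then show "(\<lambda>n. (1 + (1 - m / b) ^ n * \<theta>) * (f z * g y)) \<longlonglongrightarrow> f z * g y" by simp
    have "f y * g z \<le> (1 + (1 - m / b) ^ n * \<theta>) * (f z * g y)" for n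
    proof -
      define q where "q = 1 + (1 - m / b) ^ n * \<theta>"
      have q: "0 \<le> q" using contraction_factor \<theta> by (simp add: q_def)
      obtain a where a: "0 < a" "a * g z \<le> f z" "f y \<le> a * q * g y"
        using le[of n] yz unfolding q_def by blast
      have "f y * g z \<le> a * q * g y * g z"
        using a positive_onD(2)[OF g yz(2)] by (intro mult_right_mono) auto
      also have "\<dots> = q * ((a * g z) * g y)" by simp
      also have "\<dots> \<le> q * (f z * g y)"
        using a q positive_onD(2)[OF g yz(1)] by (intro mult_left_mono mult_right_mono) auto
      finally show ?thesis by (simp add: q_def)
    qed
    then show "\<exists>N. \<forall>n\<ge>N. f y * g z \<le> (1 + (1 - m / b) ^ n * \<theta>) * (f z * g y)" by blast
  qed
  obtain y0 where y0: "y0 \<in> B" using B_nonempty by auto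
  have "f y = f y0 / g y0 * g y" if "y \<in> B" for y
    using cross[OF that y0] cross[OF y0 that] positive_onD(2)[OF g y0] by (simp add: field_simps)
  moreover have "0 < f y0 / g y0" using y0 positive_onD(2)[OF g y0] positive_onD(2)[OF f y0] by simp
  ultimately show ?thesis by blast
qed

text \<open>By conservation the quotient of consecutive iterates has \<open>s\<close>-mean one, so it straddles one.\<close>

lemma sinkhorn_ratio_bounds:
  assumes f: "positive_on L B f" and a: "0 < a" and q: "1 \<le> q"
    and le: "\<And>y. y \<in> B \<Longrightarrow> a * f y \<le> sinkhorn f y \<and> sinkhorn f y \<le> a * q * f y"
    and y: "y \<in> B"
  shows "f y \<le> q * sinkhorn f y" "sinkhorn f y \<le> q * f y"
proof -
  have quot: "a \<le> sinkhorn f y / f y" "sinkhorn f y / f y \<le> a * q" if "y \<in> B" for y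
    using le[OF that] positive_onD(2)[OF f that] by (simp_all add: pos_le_divide_eq pos_divide_le_eq)
  have "(\<integral>y. s y * a \<partial>L) \<le> (\<integral>y. s y * (sinkhorn f y / f y) \<partial>L)"
  proof (intro integral_mono sinkhorn_conservation f)
    show "s y * a \<le> s y * (sinkhorn f y / f y)" if "y \<in> space L" for y
      using quot(1)[of y] s_supp[OF that] s_nonneg[OF that]
      by (cases "s y = 0") (auto intro!: mult_left_mono simp del: times_divide_eq_right)
  qed (use s_int in auto)
  then have a1: "a \<le> 1" using sinkhorn_conservation(2)[OF f] by (simp add: s_one)
  have "(\<integral>y. s y * (sinkhorn f y / f y) \<partial>L) \<le> (\<integral>y. s y * (a * q) \<partial>L)"
  proof (intro integral_mono sinkhorn_conservation f)
    show "s y * (sinkhorn f y / f y) \<le> s y * (a * q)" if "y \<in> space L" for y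
      using quot(2)[of y] s_supp[OF that] s_nonneg[OF that]
      by (cases "s y = 0") (auto intro!: mult_left_mono simp del: times_divide_eq_right)
  qed (use s_int in auto)
  then have aq: "1 \<le> a * q" using sinkhorn_conservation(2)[OF f] by (simp add: s_one)
  have fy: "0 < f y" using positive_onD(2)[OF f y] .
  have "f y \<le> q * a * f y" using aq fy by (simp add: mult.commute)
  also have "\<dots> \<le> q * sinkhorn f y" using le[OF y] q by (simp add: mult.assoc)
  finally show "f y \<le> q * sinkhorn f y" .
  have "sinkhorn f y \<le> a * (q * f y)" using le[OF y] by (simp add: mult.assoc)
  also have "\<dots> \<le> q * f y" using a1 q fy by (intro mult_left_le_one_le) (use a in auto)
  finally show "sinkhorn f y \<le> q * f y" .
qed

text \<open>The iterates of the constant one have logarithms with geometrically small increments,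
  uniformly on \<open>B\<close>. Pointwise limits with the uniform factor \<open>exp (c n)\<close>
  suffice: \<open>sinkhorn\<close> is monotone and homogeneous, so these bounds pass through it and
  no limit is taken under an integral.\<close>

lemma sinkhorn_fixed_point_exists:
  "\<exists>f. positive_on L B f \<and> (\<forall>y\<in>space L. sinkhorn f y = f y \<and> 0 \<le> f y)"
proof -
  define \<kappa> where "\<kappa> = 1 - m / b"
  have \<kappa>: "0 \<le> \<kappa>" "\<kappa> < 1" using contraction_factor by (auto simp: \<kappa>_def)
  have P1: "positive_on L B (\<lambda>_. 1)" unfolding positive_on_def by (auto intro!: exI[of _ 1])
  define F where "F n = (sinkhorn ^^ n) (\<lambda>_. 1)" for n
  have F: "positive_on L B (F n)" for n unfolding F_def by (intro positive_on_funpow P1)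
  have F_Suc: "F (Suc n) = sinkhorn (F n)" for n by (simp add: F_def)
  note Fpos = positive_onD(2)[OF F]
  \<comment> \<open>Starting the two sequences at \<open>sinkhorn 1\<close> and \<open>1\<close>
    makes the contraction compare consecutive iterates.\<close>
  obtain \<theta> where \<theta>: "0 \<le> \<theta>" and le: "\<And>n. \<exists>a>0. \<forall>y\<in>B. a * F n y \<le> F (Suc n) y \<and>
      F (Suc n) y \<le> a * (1 + \<kappa> ^ n * \<theta>) * F n y"
    using sinkhorn_funpow_contraction[OF positive_on_sinkhorn[OF P1] P1]
    unfolding F_def \<kappa>_def funpow_swap1[symmetric] by auto
  have ratio: "F n y \<le> (1 + \<kappa> ^ n * \<theta>) * F (Suc n) y" "F (Suc n) y \<le> (1 + \<kappa> ^ n * \<theta>) * F n y"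
    if y: "y \<in> B" for n y
  proof -
    obtain a where a: "0 < a" "\<forall>y\<in>B. a * F n y \<le> F (Suc n) y \<and>
        F (Suc n) y \<le> a * (1 + \<kappa> ^ n * \<theta>) * F n y" using le by blast
    have "1 \<le> 1 + \<kappa> ^ n * \<theta>" using \<kappa> \<theta> by simp
    from sinkhorn_ratio_bounds[OF F a(1) this _ y] a(2)
    show "F n y \<le> (1 + \<kappa> ^ n * \<theta>) * F (Suc n) y" "F (Suc n) y \<le> (1 + \<kappa> ^ n * \<theta>) * F n y"
      by (auto simp: F_Suc)
  qed
  have lnle: "ln (F n y) \<le> \<theta> * \<kappa> ^ n + ln (F (Suc n) y)" "ln (F (Suc n) y) \<le> \<theta> * \<kappa> ^ n + ln (F n y)"
    if y: "y \<in> B" for n y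
  proof -
    have q: "0 < 1 + \<kappa> ^ n * \<theta>" using \<kappa> \<theta> by (intro add_pos_nonneg) auto
    have l: "ln (1 + \<kappa> ^ n * \<theta>) \<le> \<theta> * \<kappa> ^ n"
      using ln_add_one_self_le_self[of "\<kappa> ^ n * \<theta>"] \<kappa> \<theta> by (simp add: mult.commute)
    have "ln (F n y) \<le> ln ((1 + \<kappa> ^ n * \<theta>) * F (Suc n) y)"
      "ln (F (Suc n) y) \<le> ln ((1 + \<kappa> ^ n * \<theta>) * F n y)"
      using ratio[OF y, of n] Fpos[OF y] by (simp_all add: ln_mono)
    then show "ln (F n y) \<le> \<theta> * \<kappa> ^ n + ln (F (Suc n) y)" "ln (F (Suc n) y) \<le> \<theta> * \<kappa> ^ n + ln (F n y)"
      using l q Fpos[OF y] by (simp_all add: ln_mult_pos)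
  qed
  \<comment> \<open>The tail from \<open>n\<close> on of the geometric series bounding the
    increments, so that \<open>ln (F n y) - c n\<close> increases and
    \<open>ln (F n y) + c n\<close> decreases in \<open>n\<close>.\<close>
  define c where "c n = \<theta> * \<kappa> ^ n / (1 - \<kappa>)" for n
  have c_Suc: "c n = \<theta> * \<kappa> ^ n + c (Suc n)" for n
    using \<kappa> by (simp add: c_def field_simps)
  have c0: "0 \<le> c n" for n using \<kappa> \<theta> by (simp add: c_def)
  have c_lim: "c \<longlonglongrightarrow> 0"
  proof -
    have "(\<lambda>n. \<theta> * \<kappa> ^ n / (1 - \<kappa>)) \<longlonglongrightarrow> \<theta> * 0 / (1 - \<kappa>)"
      using \<kappa> by (intro tendsto_intros LIMSEQ_realpow_zero) auto
    then show ?thesis by (simp add: c_def[abs_def])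
  qed
  \<comment> \<open>Off \<open>B\<close> the sequence need not converge; \<open>lim\<close> then has
    an arbitrary value, but \<open>G\<close> is still measurable on the whole space.\<close>
  define G where "G y = lim (\<lambda>n. ln (F n y))" for y
  define H where "H y = exp (G y)" for y
  have lims: "(\<lambda>n. ln (F n y)) \<longlonglongrightarrow> G y \<and> (\<forall>n. ln (F n y) - c n \<le> G y \<and> G y \<le> ln (F n y) + c n)"
    if y: "y \<in> B" for y
  proof -
    have "\<exists>l. ((\<forall>n. ln (F n y) - c n \<le> l) \<and> (\<lambda>n. ln (F n y) - c n) \<longlonglongrightarrow> l) \<and>
        ((\<forall>n. l \<le> ln (F n y) + c n) \<and> (\<lambda>n. ln (F n y) + c n) \<longlonglongrightarrow> l)"
    proof (rule nested_sequence_unique)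
      show "\<forall>n. ln (F n y) - c n \<le> ln (F (Suc n) y) - c (Suc n)"
        using lnle(1)[OF y] c_Suc by (smt (verit))
      show "\<forall>n. ln (F (Suc n) y) + c (Suc n) \<le> ln (F n y) + c n"
        using lnle(2)[OF y] c_Suc by (smt (verit))
      show "\<forall>n. ln (F n y) - c n \<le> ln (F n y) + c n" using c0 by (simp add: field_simps)
      have "(\<lambda>n. - 2 * c n) \<longlonglongrightarrow> - 2 * 0" by (intro tendsto_intros c_lim)
      then show "(\<lambda>n. ln (F n y) - c n - (ln (F n y) + c n)) \<longlonglongrightarrow> 0" by simp
    qed
    then obtain l where l: "\<And>n. ln (F n y) - c n \<le> l" "\<And>n. l \<le> ln (F n y) + c n"
      "(\<lambda>n. ln (F n y) - c n) \<longlonglongrightarrow> l" by blast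
    have "(\<lambda>n. ln (F n y)) \<longlonglongrightarrow> l" using tendsto_add[OF l(3) c_lim] by simp
    moreover from this have "G y = l" unfolding G_def by (rule limI)
    ultimately show ?thesis using l by simp
  qed
  have H_le: "H y \<le> exp (c n) * F n y" "F n y \<le> exp (c n) * H y" if y: "y \<in> B" for n y
  proof -
    have "H y \<le> exp (ln (F n y) + c n)" unfolding H_def using lims[OF y] by simp
    then show "H y \<le> exp (c n) * F n y" using Fpos[OF y] by (simp add: exp_add mult.commute)
    have "exp (ln (F n y)) \<le> exp (c n + G y)" using lims[OF y] by (smt (verit) exp_le_cancel_iff)
    then show "F n y \<le> exp (c n) * H y" using Fpos[OF y] by (simp add: exp_add H_def)
  qed
  have H: "positive_on L B H"
  proof -
    have [measurable]: "F n \<in> borel_measurable L" for n by (rule positive_onD(1)[OF F])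
    have "H \<in> borel_measurable L" unfolding H_def[abs_def] G_def[abs_def] by measurable
    moreover have "exp (- c 0) \<le> H y \<and> H y \<le> exp (c 0)" if "y \<in> B" for y
      using H_le[OF that, of 0] by (simp add: F_def exp_minus field_simps)
    ultimately show ?thesis
      unfolding positive_on_def using exp_gt_zero[of "- c 0"] by blast
  qed
  have exp_c: "(\<lambda>n. exp (c n)) \<longlonglongrightarrow> 1" using tendsto_exp[OF c_lim] by simp
  have fixed: "sinkhorn H y = H y" if y: "y \<in> B" for y
  proof (rule antisym)
    have "(\<lambda>n. exp (ln (F n y))) \<longlonglongrightarrow> exp (G y)" using lims[OF y] by (intro tendsto_intros) auto
    then have "(\<lambda>n. F n y) \<longlonglongrightarrow> H y" using Fpos[OF y] by (simp add: H_def)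
    then have F_lim: "(\<lambda>n. F (Suc n) y) \<longlonglongrightarrow> H y" by (rule LIMSEQ_Suc)
    have ys: "y \<in> space L" using y B_space by auto
    show "sinkhorn H y \<le> H y"
    proof (rule LIMSEQ_le_const)
      show "(\<lambda>n. exp (c n) * F (Suc n) y) \<longlonglongrightarrow> H y"
        using tendsto_mult[OF exp_c F_lim] by simp
      show "\<exists>N. \<forall>n\<ge>N. sinkhorn H y \<le> exp (c n) * F (Suc n) y"
        using sinkhorn_mono[OF H F _ H_le(1) ys] by (simp add: F_Suc)
    qed
    show "H y \<le> sinkhorn H y"
    proof (rule LIMSEQ_le)
      show "(\<lambda>n. F (Suc n) y) \<longlonglongrightarrow> H y" by fact
      show "(\<lambda>n. exp (c n) * sinkhorn H y) \<longlonglongrightarrow> sinkhorn H y"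
        using tendsto_mult_right[OF exp_c, of "sinkhorn H y"] by simp
      show "\<exists>N. \<forall>n\<ge>N. F (Suc n) y \<le> exp (c n) * sinkhorn H y"
        using sinkhorn_mono[OF F H _ H_le(2) ys] by (simp add: F_Suc)
    qed
  qed
  \<comment> \<open>\<open>H\<close> is fixed on \<open>B\<close> only. Its image is fixed
    everywhere, because \<open>sinkhorn\<close> sees nothing but the values on
    \<open>B\<close>.\<close>
  have "sinkhorn (sinkhorn H) = sinkhorn H" by (intro sinkhorn_cong fixed)
  then show ?thesis using positive_on_sinkhorn[OF H] sinkhorn_nonneg[OF H] by auto
qed

text \<open>For a competitor without a positive lower bound: its image is in the class where
  contraction applies, and the two agree almost everywhere where \<open>s\<close> is nonzero, so
  \<open>fwd\<close> cannot tell their inverses apart.\<close>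

lemma sinkhorn_fixed_of_integrable:
  assumes h[measurable]: "h \<in> borel_measurable L" and nn: "\<And>y. y \<in> B \<Longrightarrow> 0 \<le> h y"
    and i: "integrable L (\<lambda>y. s y * (1 / h y))" and pos: "AE y in L. s y \<noteq> 0 \<longrightarrow> 0 < h y"
    and fixed: "AE y in L. s y \<noteq> 0 \<longrightarrow> sinkhorn h y = h y"
  shows "positive_on L B (sinkhorn h)" "\<And>x. x \<in> space L \<Longrightarrow> fwd (\<lambda>y. 1 / sinkhorn h y) x = fwd (\<lambda>y. 1 / h y) x"
    "sinkhorn (sinkhorn h) = sinkhorn h"
proof -
  have "positive_on L A (fwd (\<lambda>y. 1 / h y))"
  proof (rule positive_on_fwd[OF _ i])
    show "0 < (\<integral>y. s y * (1 / h y) \<partial>L)" using pos nn by (intro integral_s_mult_pos i) auto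
  qed (use nn in auto)
  then show P: "positive_on L B (sinkhorn h)" unfolding sinkhorn_def by (rule positive_on_bwd_inverse)
  show eq: "fwd (\<lambda>y. 1 / sinkhorn h y) x = fwd (\<lambda>y. 1 / h y) x" if x[measurable]: "x \<in> space L" for x
  proof -
    have [measurable]: "(\<lambda>y. k x y) \<in> borel_measurable L" by measurable
    have "AE y in L. k x y * s y * (1 / sinkhorn h y) = k x y * s y * (1 / h y)"
      using fixed by eventually_elim auto
    then show ?thesis unfolding kernel_op_def by (intro integral_cong_AE) auto
  qed
  interpret F: bounded_kernel L "\<lambda>x y. k y x" s r B A m b by (rule flip)
  show "sinkhorn (sinkhorn h) = sinkhorn h"
    by (subst (1 3) sinkhorn_def) (rule F.fwd_cong, use eq A_space in auto)
qed

end

section \<open>Uniqueness for the Schroedinger system\<close>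

text \<open>\<open>\<psi>0\<close> and \<open>\<psi>T\<close> are the hatted unknowns. With the
  regimes absorbed into \<open>L\<close>, sums over regimes become part of the integrals.\<close>

definition system_on ::
    "'a measure \<Rightarrow> ('a \<Rightarrow> 'a \<Rightarrow> real) \<Rightarrow> ('a \<Rightarrow> real) \<Rightarrow> ('a \<Rightarrow> real) \<Rightarrow>
      ('a \<Rightarrow> real) \<Rightarrow> ('a \<Rightarrow> real) \<Rightarrow> ('a \<Rightarrow> real) \<Rightarrow> ('a \<Rightarrow> real) \<Rightarrow> bool" where
  "system_on L k r s \<phi>0 \<phi>T \<psi>0 \<psi>T \<longleftrightarrow>
     (\<forall>h\<in>{\<phi>0, \<phi>T, \<psi>0, \<psi>T}. h \<in> borel_measurable L \<and> (\<forall>z\<in>space L. 0 \<le> h z)) \<and>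
     (AE x in L. ennreal (\<phi>0 x) = (\<integral>\<^sup>+y. ennreal (k x y * \<phi>T y) \<partial>L)) \<and>
     (AE y in L. ennreal (\<psi>T y) = (\<integral>\<^sup>+x. ennreal (k x y * \<psi>0 x) \<partial>L)) \<and>
     (AE x in L. r x = \<phi>0 x * \<psi>0 x) \<and>
     (AE y in L. s y = \<phi>T y * \<psi>T y)"

text \<open>Time reversal; it turns each result on the first integral equation into one on the
  second.\<close>

lemma system_on_flip:
  "system_on L k r s \<phi>0 \<phi>T \<psi>0 \<psi>T \<Longrightarrow> system_on L (\<lambda>x y. k y x) s r \<psi>T \<psi>0 \<phi>T \<phi>0"
  unfolding system_on_def by (auto simp: mult.commute)

context bounded_kernel
begin

lemma system_onD:
  assumes "system_on L k r s \<phi>0 \<phi>T \<psi>0 \<psi>T"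
  shows "\<phi>0 \<in> borel_measurable L" "\<phi>T \<in> borel_measurable L"
    "\<psi>0 \<in> borel_measurable L" "\<psi>T \<in> borel_measurable L"
    "\<And>z. z \<in> space L \<Longrightarrow> 0 \<le> \<phi>0 z" "\<And>z. z \<in> space L \<Longrightarrow> 0 \<le> \<phi>T z"
    "\<And>z. z \<in> space L \<Longrightarrow> 0 \<le> \<psi>0 z" "\<And>z. z \<in> space L \<Longrightarrow> 0 \<le> \<psi>T z"
    "AE x in L. ennreal (\<phi>0 x) = (\<integral>\<^sup>+y. ennreal (k x y * \<phi>T y) \<partial>L)"
    "AE y in L. ennreal (\<psi>T y) = (\<integral>\<^sup>+x. ennreal (k x y * \<psi>0 x) \<partial>L)"
    "AE x in L. r x = \<phi>0 x * \<psi>0 x" "AE y in L. s y = \<phi>T y * \<psi>T y"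
  using assms unfolding system_on_def by auto

lemma system_on_pos:
  assumes sys: "system_on L k r s \<phi>0 \<phi>T \<psi>0 \<psi>T"
  shows "AE x in L. r x \<noteq> 0 \<longrightarrow> 0 < \<phi>0 x \<and> 0 < \<psi>0 x" "AE y in L. s y \<noteq> 0 \<longrightarrow> 0 < \<phi>T y \<and> 0 < \<psi>T y"
proof -
  note D = system_onD[OF sys]
  show "AE x in L. r x \<noteq> 0 \<longrightarrow> 0 < \<phi>0 x \<and> 0 < \<psi>0 x"
    using D(11) AE_space by eventually_elim (use D(5,7) in \<open>auto simp: less_le\<close>)
  show "AE y in L. s y \<noteq> 0 \<longrightarrow> 0 < \<phi>T y \<and> 0 < \<psi>T y"
    using D(12) AE_space by eventually_elim (use D(6,8) in \<open>auto simp: less_le\<close>)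
qed

text \<open>A solution may live outside the supports, but the mass of \<open>\<phi>T\<close> on \<open>s = 0\<close> sits where
  \<open>\<psi>T\<close> vanishes, so by Fubini the kernel transports none of it to points with \<open>r \<noteq> 0\<close>.\<close>

lemma system_on_no_leak:
  assumes sys: "system_on L k r s \<phi>0 \<phi>T \<psi>0 \<psi>T"
  shows "AE x in L. r x \<noteq> 0 \<longrightarrow>
    ennreal (\<phi>0 x) = (\<integral>\<^sup>+y. ennreal (k x y * s y * (1 / \<psi>T y)) \<partial>L)"
proof -
  interpret P: pair_sigma_finite L L ..
  note D = system_onD[OF sys]
  note [measurable] = D(1-4)
  define w where "w y = (if s y = 0 then \<phi>T y else 0)" for y
  have [measurable]: "w \<in> borel_measurable L" unfolding w_def[abs_def] by measurable
  have w0: "0 \<le> w y" if "y \<in> space L" for y using D(6)[OF that] by (simp add: w_def)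
  define H where "H x y = ennreal (\<psi>0 x) * ennreal (k x y * w y)" for x y
  have Hm[measurable]: "case_prod H \<in> borel_measurable (L \<Otimes>\<^sub>M L)" unfolding H_def by measurable
  have "(\<integral>\<^sup>+x. (\<integral>\<^sup>+y. H x y \<partial>L) \<partial>L) = (\<integral>\<^sup>+y. (\<integral>\<^sup>+x. H x y \<partial>L) \<partial>L)"
    using P.Fubini'[OF Hm] by simp
  also have "\<dots> = (\<integral>\<^sup>+y. 0 \<partial>L)"
  proof (rule nn_integral_cong_AE)
    show "AE y in L. (\<integral>\<^sup>+x. H x y \<partial>L) = 0"
      using D(10) D(12) AE_space
    proof eventually_elim
      case (elim y)
      have [measurable]: "y \<in> space L" by fact
      have "(\<integral>\<^sup>+x. H x y \<partial>L) = (\<integral>\<^sup>+x. ennreal (w y) * ennreal (k x y * \<psi>0 x) \<partial>L)"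
      proof (rule nn_integral_cong)
        fix x assume x: "x \<in> space L"
        have "\<psi>0 x * (k x y * w y) = w y * (k x y * \<psi>0 x)" by simp
        then show "H x y = ennreal (w y) * ennreal (k x y * \<psi>0 x)"
          unfolding H_def using w0[OF elim(3)] D(7)[OF x] kernel_nonneg[OF x elim(3)]
          by (simp flip: ennreal_mult)
      qed
      also have "\<dots> = ennreal (w y) * ennreal (\<psi>T y)"
        by (subst nn_integral_cmult) (auto simp: elim(1))
      also have "\<dots> = 0" using elim(2) by (auto simp: w_def)
      finally show ?case .
    qed
  qed
  finally have "(\<integral>\<^sup>+x. (\<integral>\<^sup>+y. H x y \<partial>L) \<partial>L) = 0" by simp
  then have "AE x in L. (\<integral>\<^sup>+y. H x y \<partial>L) = 0" by (subst (asm) nn_integral_0_iff_AE) auto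
  then show ?thesis
    using D(9) system_on_pos(1)[OF sys] AE_space
  proof eventually_elim
    case (elim x)
    note [measurable] = elim(4)
    show ?case
    proof
      assume rx: "r x \<noteq> 0"
      have "AE y in L. H x y = 0"
        using elim(1) by (subst (asm) nn_integral_0_iff_AE) auto
      then have "AE y in L. k x y * \<phi>T y = k x y * s y * (1 / \<psi>T y)"
        using D(12) AE_space
      proof eventually_elim
        case y: (elim y)
        have "k x y * w y \<le> 0"
          using y(1) elim(3) rx by (auto simp: H_def ennreal_eq_0_iff)
        then have "k x y * w y = 0" using kernel_nonneg[OF elim(4) y(3)] w0[OF y(3)]
          by (intro antisym mult_nonneg_nonneg) auto
        then show ?case using y(2) by (auto simp: w_def split: if_splits)
      qed
      then show "ennreal (\<phi>0 x) = (\<integral>\<^sup>+y. ennreal (k x y * s y * (1 / \<psi>T y)) \<partial>L)"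
        unfolding elim(2) by (intro nn_integral_cong_AE) auto
    qed
  qed
qed

text \<open>At a point with \<open>r x \<noteq> 0\<close> the value \<open>\<phi>0 x\<close> is
  finite and at least \<open>m\<close> times the integral of \<open>s / \<psi>T\<close>. Finiteness
  at one point thus gives integrability, after which the extended integrals are Bochner
  integrals.\<close>

lemma system_on_fwd:
  assumes sys: "system_on L k r s \<phi>0 \<phi>T \<psi>0 \<psi>T"
  shows "integrable L (\<lambda>y. s y * (1 / \<psi>T y))"
    and "AE x in L. r x \<noteq> 0 \<longrightarrow> \<phi>0 x = fwd (\<lambda>y. 1 / \<psi>T y) x"
proof -
  interpret F: bounded_kernel L "\<lambda>x y. k y x" s r B A m b by (rule flip)
  note D = system_onD[OF sys]
  note [measurable] = D(1-4)
  have nn: "0 \<le> s y * (1 / \<psi>T y)" if "y \<in> space L" for y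
    using s_nonneg[OF that] D(8)[OF that] by simp
  \<comment> \<open>Such a point exists because \<open>r\<close> has mass one and so is not almost
    everywhere zero.\<close>
  obtain x where x: "x \<in> space L" "r x \<noteq> 0"
    "ennreal (\<phi>0 x) = (\<integral>\<^sup>+y. ennreal (k x y * s y * (1 / \<psi>T y)) \<partial>L)"
  proof -
    have "\<not> (AE x in L. \<not> (x \<in> space L \<and> r x \<noteq> 0 \<and>
        ennreal (\<phi>0 x) = (\<integral>\<^sup>+y. ennreal (k x y * s y * (1 / \<psi>T y)) \<partial>L)))"
    proof
      assume "AE x in L. \<not> (x \<in> space L \<and> r x \<noteq> 0 \<and>
        ennreal (\<phi>0 x) = (\<integral>\<^sup>+y. ennreal (k x y * s y * (1 / \<psi>T y)) \<partial>L))"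
      with system_on_no_leak[OF sys] AE_space have "AE x in L. r x = 0" by eventually_elim auto
      then show False using F.not_AE_s_zero by simp
    qed
    then show ?thesis using that by (metis (mono_tags, lifting) AE_I2)
  qed
  have xA: "x \<in> A" using r_supp x by auto
  have "ennreal m * (\<integral>\<^sup>+y. ennreal (s y * (1 / \<psi>T y)) \<partial>L) =
      (\<integral>\<^sup>+y. ennreal m * ennreal (s y * (1 / \<psi>T y)) \<partial>L)"
    by (rule nn_integral_cmult[symmetric]) measurable
  also have "\<dots> \<le> ennreal (\<phi>0 x)"
    unfolding x(3)
  proof (rule nn_integral_mono)
    fix y assume y: "y \<in> space L"
    have "m * (s y * (1 / \<psi>T y)) \<le> k x y * (s y * (1 / \<psi>T y))"
      using kernel_ge[OF xA] s_supp[OF y] nn[OF y] by (cases "s y = 0") (auto intro!: mult_right_mono simp del: times_divide_eq_right)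
    then show "ennreal m * ennreal (s y * (1 / \<psi>T y)) \<le> ennreal (k x y * s y * (1 / \<psi>T y))"
      using nn[OF y] m_pos by (simp add: mult.assoc ennreal_leI flip: ennreal_mult)
  qed
  finally have fin: "ennreal m * (\<integral>\<^sup>+y. ennreal (s y * (1 / \<psi>T y)) \<partial>L) < \<infinity>"
    by (rule order.strict_trans1) simp
  then have "(\<integral>\<^sup>+y. ennreal (s y * (1 / \<psi>T y)) \<partial>L) < \<infinity>"
    using m_pos by (auto simp: ennreal_mult_less_top)
  then show i: "integrable L (\<lambda>y. s y * (1 / \<psi>T y))"
    using nn by (intro integrableI_nonneg) auto
  show "AE x in L. r x \<noteq> 0 \<longrightarrow> \<phi>0 x = fwd (\<lambda>y. 1 / \<psi>T y) x"
    using system_on_no_leak[OF sys] AE_space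
  proof eventually_elim
    case (elim x)
    have "(\<integral>\<^sup>+y. ennreal (k x y * s y * (1 / \<psi>T y)) \<partial>L) = ennreal (fwd (\<lambda>y. 1 / \<psi>T y) x)"
      unfolding kernel_op_def
    proof (intro nn_integral_eq_integral fwd_integrable i elim(2) AE_I2)
      show "0 \<le> k x y * s y * (1 / \<psi>T y)" if "y \<in> space L" for y
        unfolding mult.assoc by (intro mult_nonneg_nonneg nn kernel_nonneg elim(2) that)
    qed measurable
    moreover have "0 \<le> fwd (\<lambda>y. 1 / \<psi>T y) x"
      by (rule fwd_bounds(1)[OF _ i]) (use elim D(8) B_space in auto)
    ultimately show ?case using elim D(5)[OF elim(2)] by auto
  qed
qed

text \<open>The product equations eliminate \<open>\<phi>T\<close> and \<open>\<psi>0\<close>; what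
  is left says that \<open>\<psi>T\<close> is a fixed point of \<open>sinkhorn\<close> wherever
  \<open>s\<close> is nonzero. After one regularizing step it must be a multiple of
  \<open>f\<close>, and \<open>c\<close> is the inverse of that multiple.\<close>

lemma system_on_fixed:
  assumes sys: "system_on L k r s \<phi>0 \<phi>T \<psi>0 \<psi>T"
    and f: "positive_on L B f" and ff: "\<And>y. y \<in> B \<Longrightarrow> sinkhorn f y = f y"
  shows "\<exists>c>0. (AE x in L. r x \<noteq> 0 \<longrightarrow> \<phi>0 x = c * fwd (\<lambda>y. 1 / f y) x) \<and>
    (AE y in L. s y \<noteq> 0 \<longrightarrow> \<psi>T y = f y / c)"
proof -
  interpret F: bounded_kernel L "\<lambda>x y. k y x" s r B A m b by (rule flip)
  note D = system_onD[OF sys]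
  note [measurable] = D(1-4)
  note fw = system_on_fwd[OF sys]
  note bw = F.system_on_fwd[OF system_on_flip[OF sys]]
  have eq: "sinkhorn \<psi>T y = bwd (\<lambda>x. 1 / \<phi>0 x) y" if y[measurable]: "y \<in> space L" for y
  proof -
    have "AE x in L. k x y * r x * (1 / fwd (\<lambda>y. 1 / \<psi>T y) x) = k x y * r x * (1 / \<phi>0 x)"
      using fw(2) by eventually_elim auto
    then show ?thesis unfolding sinkhorn_def kernel_op_def[of L "\<lambda>x y. k y x" r]
      by (intro integral_cong_AE) auto
  qed
  have fixed: "AE y in L. s y \<noteq> 0 \<longrightarrow> sinkhorn \<psi>T y = \<psi>T y"
    using bw(2) AE_space by eventually_elim (auto simp: eq)
  have nn: "0 \<le> \<psi>T y" if "y \<in> B" for y using that D(8) B_space by auto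
  have pos: "AE y in L. s y \<noteq> 0 \<longrightarrow> 0 < \<psi>T y" using system_on_pos(2)[OF sys] by eventually_elim auto
  note h = sinkhorn_fixed_of_integrable[OF D(4) nn fw(1) pos fixed]
  obtain t where t: "0 < t" "\<And>y. y \<in> B \<Longrightarrow> sinkhorn \<psi>T y = t * f y"
    using sinkhorn_fixed_proportional[OF h(1) f _ ff] h(3) by auto
  have "AE y in L. s y \<noteq> 0 \<longrightarrow> \<psi>T y = f y / (1 / t)"
    using fixed AE_space by eventually_elim (use t(2) s_supp in \<open>auto simp: mult.commute\<close>)
  moreover have "AE x in L. r x \<noteq> 0 \<longrightarrow> \<phi>0 x = 1 / t * fwd (\<lambda>y. 1 / f y) x"
    using fw(2) AE_space
  proof eventually_elim
    case (elim x)
    have "fwd (\<lambda>y. 1 / sinkhorn \<psi>T y) = fwd (\<lambda>y. 1 / (t * f y))"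
      by (rule fwd_cong) (simp add: t)
    then show ?case using elim h(2)[of x] by (simp add: fwd_inverse_scale)
  qed
  moreover have "0 < 1 / t" using t by simp
  ultimately show ?thesis by blast
qed

text \<open>A zero of \<open>\<psi>T\<close> in \<open>B\<close> would force \<open>\<psi>0\<close>
  to vanish almost everywhere where \<open>r\<close> is nonzero, since the kernel is at least
  \<open>m\<close> there. This covers the points of \<open>B\<close> with \<open>s y = 0\<close>,
  where the product equation alone says nothing about the sign of \<open>\<psi>T\<close>.\<close>

lemma system_on_pos_B:
  assumes sys: "system_on L k r s \<phi>0 \<phi>T \<psi>0 \<psi>T"
  shows "AE y in L. y \<in> B \<longrightarrow> 0 < \<psi>T y"
proof -
  interpret F: bounded_kernel L "\<lambda>x y. k y x" s r B A m b by (rule flip)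
  note D = system_onD[OF sys]
  note [measurable] = D(1-4)
  show ?thesis
    using D(10) AE_space
  proof eventually_elim
    case (elim y)
    note [measurable] = elim(2)
    show ?case
    proof (rule impI, rule ccontr)
      assume y: "y \<in> B" and "\<not> 0 < \<psi>T y"
      then have "(\<integral>\<^sup>+x. ennreal (k x y * \<psi>0 x) \<partial>L) = 0" using elim(1) by (simp add: ennreal_neg)
      then have "AE x in L. ennreal (k x y * \<psi>0 x) = 0"
        by (subst (asm) nn_integral_0_iff_AE) auto
      then have "AE x in L. r x = 0"
        using system_on_pos(1)[OF sys] AE_space
      proof eventually_elim
        case x: (elim x)
        show ?case
        proof (rule ccontr)
          assume rx: "r x \<noteq> 0"
          then have "0 < k x y * \<psi>0 x"
            using x m_pos kernel_ge[OF r_supp[OF x(3) rx] y] by (intro mult_pos_pos) auto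
          then show False using x(1) by (auto simp: ennreal_eq_0_iff)
        qed
      qed
      then show False using F.not_AE_s_zero by simp
    qed
  qed
qed

lemma nn_integral_fwd_inverse:
  assumes f: "positive_on L B f" and x: "x \<in> space L"
  shows "(\<integral>\<^sup>+y. ennreal (k x y * (s y / f y)) \<partial>L) = ennreal (fwd (\<lambda>y. 1 / f y) x)"
proof -
  note [measurable] = positive_onD(1)[OF f]
  have nn: "0 \<le> s y * (1 / f y)" if "y \<in> space L" for y
    by (rule s_mult_nonneg) (use positive_onD(2)[OF f] that in \<open>auto intro: less_imp_le\<close>)
  have "(\<integral>\<^sup>+y. ennreal (k x y * s y * (1 / f y)) \<partial>L) = ennreal (fwd (\<lambda>y. 1 / f y) x)"
    unfolding kernel_op_def
  proof (intro nn_integral_eq_integral fwd_integrable positive_on_inverse f x AE_I2)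
    show "0 \<le> k x y * s y * (1 / f y)" if "y \<in> space L" for y
      unfolding mult.assoc by (intro mult_nonneg_nonneg nn kernel_nonneg x that)
  qed measurable
  then show ?thesis by simp
qed

text \<open>A denominator can vanish only where its numerator does, so the product equations survive
  the convention that division by zero gives zero.\<close>

lemma system_on_solution:
  assumes f: "positive_on L B f" and fnn: "\<And>y. y \<in> space L \<Longrightarrow> 0 \<le> f y"
    and ff: "\<And>y. y \<in> space L \<Longrightarrow> sinkhorn f y = f y"
  defines "\<Phi> \<equiv> fwd (\<lambda>y. 1 / f y)"
  shows "system_on L k r s \<Phi> (\<lambda>y. s y / f y) (\<lambda>x. r x / \<Phi> x) f"
proof -
  interpret F: bounded_kernel L "\<lambda>x y. k y x" s r B A m b by (rule flip)
  have \<Phi>: "positive_on L A \<Phi>" unfolding \<Phi>_def by (rule positive_on_fwd_inverse[OF f])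
  note [measurable] = positive_onD(1)[OF f] F.positive_onD(1)[OF \<Phi>]
  have \<Phi>nn: "0 \<le> \<Phi> x" if "x \<in> space L" for x
    unfolding \<Phi>_def
    by (rule fwd_bounds(1)) (use positive_on_inverse[OF f] positive_onD[OF f] that in \<open>auto intro: less_imp_le\<close>)
  have \<Phi>0: "r x = 0" if "x \<in> space L" "\<Phi> x = 0" for x
    using F.positive_onD(2)[OF \<Phi>, of x] r_supp[of x] that by force
  have f0: "s y = 0" if "y \<in> space L" "f y = 0" for y
    using positive_onD(2)[OF f, of y] s_supp[of y] that by force
  show ?thesis
    unfolding system_on_def
  proof (intro conjI)
    show "AE x in L. ennreal (\<Phi> x) = (\<integral>\<^sup>+y. ennreal (k x y * (s y / f y)) \<partial>L)"
      using nn_integral_fwd_inverse[OF f] by (intro AE_I2) (simp add: \<Phi>_def)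
    show "AE y in L. ennreal (f y) = (\<integral>\<^sup>+x. ennreal (k x y * (r x / \<Phi> x)) \<partial>L)"
      using F.nn_integral_fwd_inverse[OF \<Phi>] ff by (intro AE_I2) (simp add: sinkhorn_def \<Phi>_def)
    show "AE x in L. r x = \<Phi> x * (r x / \<Phi> x)"
      using \<Phi>0 by (intro AE_I2) simp
    show "AE y in L. s y = s y / f y * f y"
      using f0 by (intro AE_I2) simp
  qed (use \<Phi>nn fnn r_nonneg s_nonneg in auto)
qed

text \<open>Where \<open>s\<close> vanishes, the product equation leaves \<open>\<phi>T\<close> free
  at zeros of \<open>\<psi>T\<close>. On \<open>B\<close> there are almost surely no such zeros, and
  off \<open>B\<close> the hypothesis \<open>off\<close> fixes \<open>\<phi>T\<close>; then
  \<open>\<phi>0\<close> is determined at almost every point, not only where \<open>r\<close> is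
  nonzero.\<close>

lemma system_on_full:
  assumes sys: "system_on L k r s \<phi>0 \<phi>T \<psi>0 \<psi>T"
    and f: "positive_on L B f" and c: "0 < c"
    and \<psi>: "AE y in L. s y \<noteq> 0 \<longrightarrow> \<psi>T y = f y / c"
    and off: "AE y in L. y \<notin> B \<longrightarrow> \<phi>T y = 0"
  shows "AE y in L. \<phi>T y = c * (s y / f y)" "AE x in L. \<phi>0 x = c * fwd (\<lambda>y. 1 / f y) x"
proof -
  note D = system_onD[OF sys]
  note [measurable] = D(1-4) positive_onD(1)[OF f]
  show \<phi>T: "AE y in L. \<phi>T y = c * (s y / f y)"
    using \<psi> off D(12) system_on_pos_B[OF sys] AE_space
  proof eventually_elim
    case (elim y)
    show ?case
    proof (cases "s y = 0")
      case True
      then have "\<phi>T y * \<psi>T y = 0" using elim(3) by simp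
      then have "\<phi>T y = 0" using elim(2,4) by (cases "y \<in> B") auto
      then show ?thesis using True by simp
    next
      case False
      then have "s y = \<phi>T y * (f y / c)" "f y \<noteq> 0" using elim(1,3) by auto
      then show ?thesis using c by simp
    qed
  qed
  show "AE x in L. \<phi>0 x = c * fwd (\<lambda>y. 1 / f y) x"
    using D(9) AE_space
  proof eventually_elim
    case (elim x)
    note [measurable] = elim(2)
    have fnn: "0 \<le> fwd (\<lambda>y. 1 / f y) x"
      by (rule fwd_bounds(1)) (use positive_on_inverse[OF f] positive_onD[OF f] elim in \<open>auto intro: less_imp_le\<close>)
    have "ennreal (\<phi>0 x) = (\<integral>\<^sup>+y. ennreal c * ennreal (k x y * (s y / f y)) \<partial>L)"
      unfolding elim(1)
    proof (rule nn_integral_cong_AE)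
      show "AE y in L. ennreal (k x y * \<phi>T y) = ennreal c * ennreal (k x y * (s y / f y))"
        using \<phi>T
      proof eventually_elim
        case (elim y)
        have "k x y * \<phi>T y = c * (k x y * (s y / f y))" unfolding elim by (rule mult.left_commute)
        then show ?case using c by (simp only: ennreal_mult' less_imp_le)
      qed
    qed
    also have "\<dots> = ennreal c * ennreal (fwd (\<lambda>y. 1 / f y) x)"
      unfolding nn_integral_fwd_inverse[OF f elim(2), symmetric] by (rule nn_integral_cmult) measurable
    also have "\<dots> = ennreal (c * fwd (\<lambda>y. 1 / f y) x)" using c by (simp add: ennreal_mult')
    finally show ?case using c fnn D(5)[OF elim(2)] by simp
  qed
qed

text \<open>A single constant must serve all four functions. It is obtained from
  \<open>\<psi>T\<close>; the time-reversed application of \<open>system_on_full\<close> runs with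
  \<open>1 / c\<close>.\<close>

lemma system_on_unique:
  assumes sys: "system_on L k r s \<phi>0 \<phi>T \<psi>0 \<psi>T"
    and f: "positive_on L B f" and ff: "\<And>y. y \<in> space L \<Longrightarrow> sinkhorn f y = f y"
  defines "\<Phi> \<equiv> fwd (\<lambda>y. 1 / f y)"
  shows "\<exists>c>0. (AE x in L. r x \<noteq> 0 \<longrightarrow> \<phi>0 x = c * \<Phi> x \<and> \<psi>0 x = r x / \<Phi> x / c) \<and>
    (AE y in L. s y \<noteq> 0 \<longrightarrow> \<phi>T y = c * (s y / f y) \<and> \<psi>T y = f y / c) \<and>
    ((AE x in L. x \<notin> A \<longrightarrow> \<psi>0 x = 0) \<and> (AE y in L. y \<notin> B \<longrightarrow> \<phi>T y = 0) \<longrightarrow>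
      (AE x in L. \<phi>0 x = c * \<Phi> x \<and> \<psi>0 x = r x / \<Phi> x / c) \<and>
      (AE y in L. \<phi>T y = c * (s y / f y) \<and> \<psi>T y = f y / c))"
proof -
  interpret F: bounded_kernel L "\<lambda>x y. k y x" s r B A m b by (rule flip)
  note D = system_onD[OF sys]
  have \<Phi>: "positive_on L A \<Phi>" unfolding \<Phi>_def by (rule positive_on_fwd_inverse[OF f])
  obtain c where c: "0 < c" and \<phi>0: "AE x in L. r x \<noteq> 0 \<longrightarrow> \<phi>0 x = c * \<Phi> x"
    and \<psi>T: "AE y in L. s y \<noteq> 0 \<longrightarrow> \<psi>T y = f y / c"
    using system_on_fixed[OF sys f] ff B_space unfolding \<Phi>_def by blast
  have "AE x in L. r x \<noteq> 0 \<longrightarrow> \<phi>0 x = c * \<Phi> x \<and> \<psi>0 x = r x / \<Phi> x / c"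
    using \<phi>0 D(11) by eventually_elim (use c in auto)
  moreover have "AE y in L. s y \<noteq> 0 \<longrightarrow> \<phi>T y = c * (s y / f y) \<and> \<psi>T y = f y / c"
    using \<psi>T D(12) by eventually_elim (use c in auto)
  moreover have "(AE x in L. \<phi>0 x = c * \<Phi> x \<and> \<psi>0 x = r x / \<Phi> x / c) \<and>
      (AE y in L. \<phi>T y = c * (s y / f y) \<and> \<psi>T y = f y / c)"
    if off: "AE x in L. x \<notin> A \<longrightarrow> \<psi>0 x = 0" "AE y in L. y \<notin> B \<longrightarrow> \<phi>T y = 0"
  proof -
    have c': "0 < 1 / c" using c by simp
    have "AE x in L. r x \<noteq> 0 \<longrightarrow> \<phi>0 x = \<Phi> x / (1 / c)" using \<phi>0 by (simp add: mult.commute)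
    note bw = F.system_on_full[OF system_on_flip[OF sys] \<Phi> c' this off(1)]
    note fw = system_on_full[OF sys f c \<psi>T off(2), folded \<Phi>_def]
    have bw2: "AE y in L. \<psi>T y = f y / c"
      using bw(2) AE_space by eventually_elim (use ff in \<open>simp add: sinkhorn_def \<Phi>_def\<close>)
    show ?thesis
    proof
      show "AE x in L. \<phi>0 x = c * \<Phi> x \<and> \<psi>0 x = r x / \<Phi> x / c"
        using bw(1) fw(2) by eventually_elim simp
      show "AE y in L. \<phi>T y = c * (s y / f y) \<and> \<psi>T y = f y / c"
        using bw2 fw(1) by eventually_elim simp
    qed
  qed
  ultimately show ?thesis using c by blast
qed

end

section \<open>Convergence of the normalized iteration\<close>

definition l2_on :: "'a measure \<Rightarrow> 'a set \<Rightarrow> ('a \<Rightarrow> real) \<Rightarrow> real" where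
  "l2_on L B f = sqrt (\<integral>z. indicator B z * (f z)\<^sup>2 \<partial>L)"

text \<open>Integrability is asked of the dominating side only: if the square of \<open>f\<close> is
  not integrable, its integral has the default value zero and the bound still holds.\<close>

lemma l2_on_mono:
  assumes g: "integrable L (\<lambda>z. indicator B z * (g z)\<^sup>2)" and c: "0 \<le> c"
    and le: "\<And>z. z \<in> B \<Longrightarrow> \<bar>f z\<bar> \<le> c * \<bar>g z\<bar>"
  shows "l2_on L B f \<le> c * l2_on L B g"
proof -
  have "(\<integral>z. indicator B z * (f z)\<^sup>2 \<partial>L) \<le> (\<integral>z. c\<^sup>2 * (indicator B z * (g z)\<^sup>2) \<partial>L)"
  proof (rule integral_mono')
    show "indicator B z * (f z)\<^sup>2 \<le> c\<^sup>2 * (indicator B z * (g z)\<^sup>2)" for z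
    proof (cases "z \<in> B")
      case True
      have "(f z)\<^sup>2 = \<bar>f z\<bar>\<^sup>2" by simp
      also have "\<dots> \<le> (c * \<bar>g z\<bar>)\<^sup>2" by (rule power_mono[OF le[OF True]]) simp
      finally show ?thesis using True by (simp add: power_mult_distrib)
    qed simp
  qed (use g in auto)
  also have "\<dots> = c\<^sup>2 * (\<integral>z. indicator B z * (g z)\<^sup>2 \<partial>L)" by simp
  finally show ?thesis
    unfolding l2_on_def using c by (smt (verit) real_sqrt_abs real_sqrt_le_mono real_sqrt_mult)
qed

lemma l2_on_scale: "l2_on L B (\<lambda>z. c * f z) = \<bar>c\<bar> * l2_on L B f"
proof -
  have "(\<lambda>z. indicator B z * (c * f z)\<^sup>2) = (\<lambda>z. c\<^sup>2 * (indicator B z * (f z)\<^sup>2))"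
    by (auto simp: power_mult_distrib)
  then show ?thesis unfolding l2_on_def by (simp only: integral_mult_right_zero real_sqrt_mult real_sqrt_abs)
qed

lemma l2_on_nonneg: "0 \<le> l2_on L B f"
  unfolding l2_on_def by (intro real_sqrt_ge_zero integral_nonneg) (auto simp: indicator_def)

context bounded_kernel
begin

context
  assumes B_sets [measurable]: "B \<in> sets L" and B_fin: "emeasure L B < \<infinity>"
begin

lemma integrable_square_bounded:
  fixes f :: "'a \<Rightarrow> real"
  assumes [measurable]: "f \<in> borel_measurable L" and d: "\<And>y. y \<in> B \<Longrightarrow> \<bar>f y\<bar> \<le> d"
  shows "integrable L (\<lambda>z. indicator B z * (f z)\<^sup>2)"
proof (rule Bochner_Integration.integrable_bound[of L "\<lambda>z. d\<^sup>2 * indicat_real B z"])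
  show "integrable L (\<lambda>z. d\<^sup>2 * indicator B z :: real)" using B_fin by simp
  have "(f z)\<^sup>2 \<le> d\<^sup>2" if "z \<in> B" for z
    using power_mono[OF d[OF that], of 2] by simp
  then show "AE z in L. norm (indicator B z * (f z)\<^sup>2) \<le> norm (d\<^sup>2 * indicator B z)"
    by (intro AE_I2) (auto simp: indicator_def)
qed measurable

lemma integrable_square_positive_on:
  assumes f: "positive_on L B f"
  shows "integrable L (\<lambda>z. indicator B z * (f z)\<^sup>2)"
proof -
  obtain c d where "0 < c" "\<forall>y\<in>B. c \<le> f y \<and> f y \<le> d" using f unfolding positive_on_def by blast
  then have "\<And>y. y \<in> B \<Longrightarrow> \<bar>f y\<bar> \<le> d" by fastforce
  then show ?thesis using positive_onD(1)[OF f] by (rule integrable_square_bounded[rotated])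
qed

lemma l2_on_pos:
  assumes f: "positive_on L B f"
  shows "0 < l2_on L B f"
proof -
  note i = integrable_square_positive_on[OF f]
  have nn: "AE z in L. 0 \<le> indicator B z * (f z)\<^sup>2" by (auto simp: indicator_def)
  have "(\<integral>z. indicator B z * (f z)\<^sup>2 \<partial>L) \<noteq> 0"
  proof
    assume "(\<integral>z. indicator B z * (f z)\<^sup>2 \<partial>L) = 0"
    then have "AE z in L. indicator B z * (f z)\<^sup>2 = 0"
      using integral_nonneg_eq_0_iff_AE[OF i nn] by simp
    then have "AE z in L. s z = 0"
      using AE_space by eventually_elim (use positive_onD(2)[OF f] s_supp in \<open>force simp: indicator_def\<close>)
    then show False using not_AE_s_zero by simp
  qed
  then show ?thesis unfolding l2_on_def using integral_nonneg_AE[OF nn] by (simp add: less_le)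
qed

text \<open>If an iterate lies between \<open>a g\<close> and \<open>a (1 + q) g\<close>, its norm
  lies between \<open>a\<close> and \<open>a (1 + q)\<close>, as \<open>g\<close> has norm one.
  Normalizing therefore cancels the uncontrolled scale \<open>a\<close>, and the pointwise error is
  at most \<open>q g\<close>, with \<open>q\<close> decaying geometrically.\<close>

lemma sinkhorn_normalized_tendsto:
  assumes f: "positive_on L B f" and g: "positive_on L B g"
    and gf: "\<And>y. y \<in> B \<Longrightarrow> sinkhorn g y = g y" and g1: "l2_on L B g = 1"
  shows "(\<lambda>n. l2_on L B (\<lambda>z. (sinkhorn ^^ n) f z / l2_on L B ((sinkhorn ^^ n) f) - g z)) \<longlonglongrightarrow> 0"
proof -
  obtain \<theta> where \<theta>: "0 \<le> \<theta>" and le: "\<And>n. \<exists>a>0. \<forall>y\<in>B. a * g y \<le> (sinkhorn ^^ n) f y \<and>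
      (sinkhorn ^^ n) f y \<le> a * (1 + (1 - m / b) ^ n * \<theta>) * g y"
    using sinkhorn_funpow_contraction[OF f g] sinkhorn_funpow_fixed[OF gf] by auto
  have bound: "l2_on L B (\<lambda>z. (sinkhorn ^^ n) f z / l2_on L B ((sinkhorn ^^ n) f) - g z)
      \<le> (1 - m / b) ^ n * \<theta>" for n
  proof -
    define F where "F = (sinkhorn ^^ n) f"
    define q where "q = (1 - m / b) ^ n * \<theta>"
    define N where "N = l2_on L B F"
    have F: "positive_on L B F" unfolding F_def by (rule positive_on_funpow[OF f])
    have q: "0 \<le> q" using contraction_factor \<theta> by (simp add: q_def)
    obtain a where a: "0 < a" and FF: "\<And>y. y \<in> B \<Longrightarrow> a * g y \<le> F y \<and> F y \<le> a * (1 + q) * g y"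
      using le[of n] unfolding F_def q_def by blast
    have N0: "0 < N" unfolding N_def by (rule l2_on_pos[OF F])
    have "N \<le> a * (1 + q) * l2_on L B g"
      unfolding N_def
      by (rule l2_on_mono[OF integrable_square_positive_on[OF g]])
        (use a q FF positive_onD(2)[OF F] positive_onD(2)[OF g] in \<open>auto simp: abs_of_pos\<close>)
    then have N_le: "N \<le> a * (1 + q)" by (simp add: g1)
    have "l2_on L B g \<le> 1 / a * N"
      unfolding N_def
    proof (rule l2_on_mono[OF integrable_square_positive_on[OF F]])
      show "\<bar>g z\<bar> \<le> 1 / a * \<bar>F z\<bar>" if "z \<in> B" for z
        using a FF[OF that] positive_onD(2)[OF F that] positive_onD(2)[OF g that]
        by (simp add: pos_le_divide_eq mult.commute)
    qed (use a in auto)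
    then have N_ge: "a \<le> N" using a by (simp add: g1 pos_le_divide_eq)
    have "l2_on L B (\<lambda>z. F z / N - g z) \<le> q * l2_on L B g"
    proof (rule l2_on_mono[OF integrable_square_positive_on[OF g] q])
      fix z assume z: "z \<in> B"
      have gz: "0 < g z" by (rule positive_onD(2)[OF g z])
      have "F z \<le> a * (1 + q) * g z" using FF[OF z] by simp
      also have "\<dots> \<le> N * (1 + q) * g z" using N_ge q gz by (intro mult_right_mono) auto
      finally have "F z / N \<le> (1 + q) * g z" using N0 by (simp add: pos_divide_le_eq ac_simps)
      moreover have "(1 - q) * g z \<le> F z / N"
      \<comment> \<open>For \<open>q \<le> 1\<close> the bound follows from
        \<open>(1 + q) (1 - q) \<le> 1\<close>; for larger \<open>q\<close> its left side is
        negative.\<close>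
      proof (cases "q \<le> 1")
        case True
        have "N * (1 - q) \<le> a * (1 + q) * (1 - q)" using N_le True by (intro mult_right_mono) auto
        also have "\<dots> = a - a * q\<^sup>2" by (simp add: power2_eq_square algebra_simps)
        also have "\<dots> \<le> a" using a by simp
        finally have "N * (1 - q) * g z \<le> a * g z" using gz by (intro mult_right_mono) auto
        also have "\<dots> \<le> F z" using FF[OF z] by simp
        finally show ?thesis using N0 by (simp add: pos_le_divide_eq ac_simps)
      next
        case False
        then have "(1 - q) * g z \<le> 0" using gz by (intro mult_nonpos_nonneg) auto
        also have "\<dots> \<le> F z / N" using N0 positive_onD(2)[OF F z] by simp
        finally show ?thesis .
      qed
      ultimately show "\<bar>F z / N - g z\<bar> \<le> q * \<bar>g z\<bar>" using gz by (simp add: abs_le_iff algebra_simps)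
    qed
    then show ?thesis by (simp add: F_def N_def q_def g1)
  qed
  have "(\<lambda>n. (1 - m / b) ^ n) \<longlonglongrightarrow> 0" using contraction_factor by (rule LIMSEQ_realpow_zero)
  then have "(\<lambda>n. (1 - m / b) ^ n * \<theta>) \<longlonglongrightarrow> 0" by (rule tendsto_mult_left_zero)
  then show ?thesis
    by (rule Lim_null_comparison[rotated]) (use bound in \<open>auto simp: l2_on_nonneg\<close>)
qed

end

end

section \<open>States with finitely many regimes\<close>

text \<open>Lebesgue measure in space times counting measure on the regimes: the coupled system over
  all regimes becomes a single kernel problem.\<close>

definition base :: "('d::finite, 'l::finite) model \<Rightarrow> 'd state measure" where
  "base K = lborel \<Otimes>\<^sub>M count_space (regimes K)"

definition state_kernel ::
    "('d::finite, 'l::finite) model \<Rightarrow> 'd transition_density \<Rightarrow> 'd state \<Rightarrow> 'd state \<Rightarrow> real" where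
  "state_kernel K p z w = p (snd z) (snd w) 0 (fst z) (horizon K) (fst w)"

definition regime_sets ::
    "('d::finite, 'l::finite) model \<Rightarrow> (nat \<Rightarrow> (real ^ 'd) set) \<Rightarrow> 'd state set" where
  "regime_sets K A = {(x, i). i \<in> regimes K \<and> x \<in> A i}"

lemma finite_regimes [simp]: "finite (regimes K)"
  by (simp add: regimes_def)

lemma sets_base [measurable_cong, simp]: "sets (base K) = sets (state_space K)"
  unfolding base_def state_space_def by (intro sets_pair_measure_cong) auto

lemma measurable_state_space: "measurable (state_space K) M = measurable (base K) M"
  by (intro measurable_cong_sets) auto

lemma space_base [simp]: "space (base K) = UNIV \<times> regimes K"
  by (simp add: base_def space_pair_measure)

lemma space_state_space [simp]: "space (state_space K) = UNIV \<times> regimes K"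
  by (simp add: state_space_def space_pair_measure)

lemma pair_sigma_finite_regimes:
  "pair_sigma_finite (lborel :: (real ^ 'd::finite) measure) (count_space (regimes K))"
  by (simp add: pair_sigma_finite_def sigma_finite_measure_count_space_finite lborel.sigma_finite_measure_axioms)

lemma sigma_finite_base:
  fixes K :: "('d::finite, 'l::finite) model"
  shows "sigma_finite_measure (base K)"
proof -
  interpret P: pair_sigma_finite "lborel :: (real ^ 'd) measure" "count_space (regimes K)" by (rule pair_sigma_finite_regimes)
  show ?thesis unfolding base_def by (rule P.P.sigma_finite_measure_axioms)
qed

lemma measurable_slice_base:
  assumes "f \<in> measurable (base K) M" "i \<in> regimes K"
  shows "(\<lambda>x. f (x, i)) \<in> measurable lborel M"
  using measurable_Pair1[OF assms(1)[unfolded base_def]] assms(2) by simp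

lemma nn_integral_base:
  fixes K :: "('d::finite, 'l::finite) model"
  assumes f: "f \<in> borel_measurable (base K)"
  shows "(\<integral>\<^sup>+z. f z \<partial>base K) = (\<Sum>i\<in>regimes K. \<integral>\<^sup>+x. f (x, i) \<partial>lborel)"
proof -
  interpret P: pair_sigma_finite "lborel :: (real ^ 'd) measure" "count_space (regimes K)" by (rule pair_sigma_finite_regimes)
  show ?thesis
    using P.nn_integral_snd[of f] f
    by (simp add: base_def nn_integral_count_space_finite)
qed

lemma integrable_base_iff:
  fixes K :: "('d::finite, 'l::finite) model" and f :: "'d state \<Rightarrow> real"
  assumes f: "f \<in> borel_measurable (base K)"
  shows "integrable (base K) f \<longleftrightarrow> (\<forall>i\<in>regimes K. integrable lborel (\<lambda>x. f (x, i)))"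
  using f measurable_slice_base[OF f]
  by (simp add: integrable_iff_bounded nn_integral_base ennreal_sum_less_top)

lemma integral_base:
  fixes K :: "('d::finite, 'l::finite) model" and f :: "'d state \<Rightarrow> real"
  assumes f: "integrable (base K) f"
  shows "(\<integral>z. f z \<partial>base K) = (\<Sum>i\<in>regimes K. \<integral>x. f (x, i) \<partial>lborel)"
proof -
  interpret P: pair_sigma_finite "lborel :: (real ^ 'd) measure" "count_space (regimes K)" by (rule pair_sigma_finite_regimes)
  show ?thesis
    using P.integral_snd[of "\<lambda>x i. f (x, i)"] f
    by (simp add: base_def lebesgue_integral_count_space_finite)
qed

text \<open>There are finitely many regimes, so the null sets covering the exceptional points of
  each combine into one; this works for arbitrary \<open>P\<close>.\<close>

lemma AE_base_iff:
  fixes K :: "('d::finite, 'l::finite) model"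
  shows "(AE z in base K. P z) \<longleftrightarrow> (\<forall>i\<in>regimes K. AE x in lborel. P (x, i))"
proof
  interpret P: pair_sigma_finite "lborel :: (real ^ 'd) measure" "count_space (regimes K)" by (rule pair_sigma_finite_regimes)
  assume "AE z in base K. P z"
  then have "AE x in lborel. AE i in count_space (regimes K). P (x, i)"
    unfolding base_def by (rule P.AE_pair)
  then show "\<forall>i\<in>regimes K. AE x in lborel. P (x, i)"
    by (auto simp: AE_count_space elim: eventually_mono)
next
  assume "\<forall>i\<in>regimes K. AE x in lborel. P (x, i)"
  then have "\<forall>i\<in>regimes K. \<exists>N. N \<in> null_sets lborel \<and> {x. \<not> P (x, i)} \<subseteq> N"
    by (auto simp: eventually_ae_filter)
  then obtain N where N: "\<And>i. i \<in> regimes K \<Longrightarrow> N i \<in> null_sets lborel"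
    "\<And>i. i \<in> regimes K \<Longrightarrow> {x. \<not> P (x, i)} \<subseteq> N i"
    by metis
  have "N i \<times> {i} \<in> null_sets (base K)" if i: "i \<in> regimes K" for i
  proof -
    have "emeasure (base K) (N i \<times> {i}) = emeasure lborel (N i) * emeasure (count_space (regimes K)) {i}"
      unfolding base_def using N(1)[OF i] i
      by (intro sigma_finite_measure.emeasure_pair_measure_Times sigma_finite_measure_count_space_finite) auto
    moreover have "N i \<times> {i} \<in> sets (base K)"
      unfolding base_def using N(1)[OF i] i by (intro pair_measureI) auto
    ultimately show ?thesis using N(1)[OF i] by (auto simp: null_sets_def)
  qed
  then have "(\<Union>i\<in>regimes K. N i \<times> {i}) \<in> null_sets (base K)" by (intro null_sets.finite_UN) auto
  then show "AE z in base K. P z"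
    by (rule AE_I') (use N(2) in auto)
qed

locale regime_kernel =
  bounded_kernel "base K" "state_kernel K p" r0 rT "regime_sets K A0" "regime_sets K AT" m b
  for K :: "('d::finite, 'l::finite) model" and p r0 rT A0 AT m b +
  assumes AT_compact: "\<And>j. j \<in> regimes K \<Longrightarrow> compact (AT j)"
begin

abbreviation "L \<equiv> base K"
abbreviation "A \<equiv> regime_sets K A0"
abbreviation "B \<equiv> regime_sets K AT"

lemma B_sets: "B \<in> sets L" and B_fin: "emeasure L B < \<infinity>"
proof -
  have "B = (\<Union>j\<in>regimes K. AT j \<times> {j})" by (auto simp: regime_sets_def)
  moreover have "AT j \<times> {j} \<in> sets L" if "j \<in> regimes K" for j
    unfolding base_def using compact_imp_closed[OF AT_compact[OF that]] that
    by (intro pair_measureI) auto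
  ultimately show B: "B \<in> sets L" by auto
  have "emeasure L B = (\<integral>\<^sup>+z. indicator B z \<partial>L)" using B by simp
  also have "\<dots> = (\<Sum>j\<in>regimes K. \<integral>\<^sup>+y. indicator B (y, j) \<partial>lborel)"
    using B by (intro nn_integral_base) auto
  also have "\<dots> = (\<Sum>j\<in>regimes K. emeasure lborel (AT j))"
  proof (rule sum.cong[OF refl])
    fix j assume j: "j \<in> regimes K"
    have "(\<integral>\<^sup>+y. indicator B (y, j) \<partial>lborel) = (\<integral>\<^sup>+y. indicator (AT j) y \<partial>lborel)"
      using j by (intro nn_integral_cong) (auto simp: indicator_def regime_sets_def)
    then show "(\<integral>\<^sup>+y. indicator B (y, j) \<partial>lborel) = emeasure lborel (AT j)"
      using compact_imp_closed[OF AT_compact[OF j]] by simp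
  qed
  also have "\<dots> < \<infinity>" using emeasure_compact_finite[OF AT_compact] by simp
  finally show "emeasure L B < \<infinity>" .
qed

lemmas l2_facts = integrable_square_positive_on[OF B_sets B_fin] l2_on_pos[OF B_sets B_fin]
  sinkhorn_normalized_tendsto[OF B_sets B_fin]

section \<open>The concrete iteration maps as kernel operators\<close>

text \<open>Integrability matters: the left side is a sum of Bochner integrals that may default to
  zero one by one, the right side a single integral that defaults as a whole.\<close>

lemma map_ET_eq:
  assumes "u \<in> borel_measurable L" "integrable L (\<lambda>w. rT w * u w)" "z \<in> space L"
  shows "map_ET K p rT u z = fwd u z"
  unfolding kernel_op_def integral_base[OF fwd_integrable[OF assms]]
  by (cases z) (simp add: map_ET_def state_kernel_def)

lemma map_E0_eq:
  assumes "v \<in> borel_measurable L" "integrable L (\<lambda>w. r0 w * v w)" "z \<in> space L"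
  shows "map_E0 K p r0 v z = bwd v z"
proof -
  interpret F: bounded_kernel L "\<lambda>x y. state_kernel K p y x" rT r0 B A m b by (rule flip)
  show ?thesis
    unfolding kernel_op_def integral_base[OF F.fwd_integrable[OF assms]]
    by (cases z) (simp add: map_E0_def state_kernel_def)
qed

lemma map_ET_cong:
  assumes "\<And>w. w \<in> B \<Longrightarrow> u w = v w"
  shows "map_ET K p rT u = map_ET K p rT v"
proof -
  have "rT (y, j) * u (y, j) = rT (y, j) * v (y, j)" if "j \<in> regimes K" for y j
    using assms s_supp[of "(y, j)"] that by (cases "rT (y, j) = 0") auto
  then show ?thesis
    unfolding map_ET_def mult.assoc by (auto intro!: ext sum.cong Bochner_Integration.integral_cong)
qed

lemma map_E0_cong:
  assumes "\<And>w. w \<in> A \<Longrightarrow> u w = v w"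
  shows "map_E0 K p r0 u = map_E0 K p r0 v"
proof -
  have "r0 (x, i) * u (x, i) = r0 (x, i) * v (x, i)" if "i \<in> regimes K" for x i
    using assms r_supp[of "(x, i)"] that by (cases "r0 (x, i) = 0") auto
  then show ?thesis
    unfolding map_E0_def mult.assoc by (auto intro!: ext sum.cong Bochner_Integration.integral_cong)
qed

lemma map_C_cong:
  assumes "\<And>w. w \<in> B \<Longrightarrow> f w = g w"
  shows "map_C K p r0 rT f = map_C K p r0 rT g"
proof -
  have "map_ET K p rT (map_D f) = map_ET K p rT (map_D g)"
    using assms by (intro map_ET_cong) (simp add: map_D_def)
  then show ?thesis by (simp add: map_C_def)
qed

lemma map_C_eq_of_integrable:
  assumes f[measurable]: "f \<in> borel_measurable L" and i: "integrable L (\<lambda>w. rT w * (1 / f w))"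
    and pos: "positive_on L A (fwd (\<lambda>w. 1 / f w))" and z: "z \<in> space L"
  shows "map_C K p r0 rT f z = sinkhorn f z"
proof -
  interpret F: bounded_kernel L "\<lambda>x y. state_kernel K p y x" rT r0 B A m b by (rule flip)
  have eq: "map_E0 K p r0 (\<lambda>w. 1 / map_ET K p rT (\<lambda>w. 1 / f w) w) =
      map_E0 K p r0 (\<lambda>w. 1 / fwd (\<lambda>w. 1 / f w) w)"
    by (rule map_E0_cong) (use A_space map_ET_eq[OF _ i] in auto)
  have "map_E0 K p r0 (\<lambda>w. 1 / fwd (\<lambda>w. 1 / f w) w) z = bwd (\<lambda>w. 1 / fwd (\<lambda>w. 1 / f w) w) z"
    using F.positive_on_inverse(1)[OF pos] F.positive_onD(1)[OF pos] z by (intro map_E0_eq) auto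
  then show ?thesis by (simp only: map_C_def map_D_def sinkhorn_def comp_def eq)
qed

lemma map_C_eq:
  assumes f: "positive_on L B f" and z: "z \<in> space L"
  shows "map_C K p r0 rT f z = sinkhorn f z"
  using positive_onD(1)[OF f] positive_on_inverse(1)[OF f] positive_on_fwd_inverse[OF f] z
  by (rule map_C_eq_of_integrable)

text \<open>The two sides are compared on the state space only, where the kernel bounds hold; the
  induction closes because \<open>map_C\<close> reads nothing but values on
  \<open>B\<close>.\<close>

lemma map_C_funpow_eq:
  assumes f: "positive_on L B f" and z: "z \<in> space L"
  shows "(map_C K p r0 rT ^^ n) f z = (sinkhorn ^^ n) f z"
  using z
proof (induction n arbitrary: z)
  case (Suc n)
  have "map_C K p r0 rT ((map_C K p r0 rT ^^ n) f) = map_C K p r0 rT ((sinkhorn ^^ n) f)"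
    using Suc.IH B_space by (intro map_C_cong) auto
  then show ?case using map_C_eq[OF positive_on_funpow[OF f] Suc.prems] by simp
qed simp

lemma positive_on_cong:
  assumes "positive_on L B f" "\<And>z. z \<in> space L \<Longrightarrow> f z = g z"
  shows "positive_on L B g"
proof -
  have "f \<in> borel_measurable L \<longleftrightarrow> g \<in> borel_measurable L"
    by (rule measurable_cong) (rule assms(2))
  moreover have "\<And>y. y \<in> B \<Longrightarrow> f y = g y" using assms(2) B_space by auto
  ultimately show ?thesis using assms(1) unfolding positive_on_def by auto
qed

section \<open>Norms, and the normalized fixed point\<close>

lemma L2_on_iff:
  "L2_on K AT f \<longleftrightarrow> f \<in> borel_measurable L \<and> integrable L (\<lambda>z. indicator B z * (f z)\<^sup>2)"
proof -
  have "f \<in> borel_measurable L \<longleftrightarrow> f \<in> borel_measurable (state_space K)"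
    by (simp only: measurable_state_space)
  moreover have "integrable L (\<lambda>z. indicator B z * (f z)\<^sup>2) \<longleftrightarrow>
      (\<forall>j\<in>regimes K. set_integrable lborel (AT j) (\<lambda>y. (f (y, j))\<^sup>2))" if [measurable]: "f \<in> borel_measurable L"
  proof -
    note B_sets [measurable]
    have "(\<lambda>z. indicator B z * (f z)\<^sup>2) \<in> borel_measurable L" by measurable
    moreover have "(\<lambda>y. indicator B (y, j) * (f (y, j))\<^sup>2) = (\<lambda>y. indicator (AT j) y * (f (y, j))\<^sup>2)"
      if "j \<in> regimes K" for j
      using that by (auto simp: indicator_def regime_sets_def)
    ultimately show ?thesis by (simp add: integrable_base_iff set_integrable_def)
  qed
  ultimately show ?thesis unfolding L2_on_def by blast
qed

lemma L2_norm_eq: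
  assumes "L2_on K AT f"
  shows "L2_norm K AT f = l2_on L B f"
proof -
  have "(\<integral>z. indicator B z * (f z)\<^sup>2 \<partial>L) = (\<Sum>j\<in>regimes K. \<integral>y. indicator B (y, j) * (f (y, j))\<^sup>2 \<partial>lborel)"
    using assms unfolding L2_on_iff by (intro integral_base) auto
  also have "\<dots> = (\<Sum>j\<in>regimes K. LINT y:AT j|lborel. (f (y, j))\<^sup>2)"
    unfolding set_lebesgue_integral_def
    by (intro sum.cong Bochner_Integration.integral_cong) (auto simp: indicator_def regime_sets_def)
  finally show ?thesis by (simp add: L2_norm_def l2_on_def)
qed

lemma positive_on_L2:
  assumes f: "positive_on L B f"
  shows "L2_on K AT f" "L2_norm K AT f = l2_on L B f"
proof -
  show "L2_on K AT f" unfolding L2_on_iff using positive_onD(1)[OF f] l2_facts(1)[OF f] by simp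
  then show "L2_norm K AT f = l2_on L B f" by (rule L2_norm_eq)
qed

lemma map_C_fixed_point_exists:
  "\<exists>f. positive_on L B f \<and> (\<forall>z\<in>space L. 0 \<le> f z \<and> sinkhorn f z = f z) \<and>
    l2_on L B f = 1 \<and> map_C K p r0 rT f = f"
proof -
  obtain g where g: "positive_on L B g" "\<And>z. z \<in> space L \<Longrightarrow> sinkhorn g z = g z \<and> 0 \<le> g z"
    using sinkhorn_fixed_point_exists by blast
  define N where "N = l2_on L B g"
  have N: "0 < N" unfolding N_def by (rule l2_facts(2)[OF g(1)])
  define h where "h = (\<lambda>z. 1 / N * g z)"
  have h: "positive_on L B h"
  proof -
    obtain c d where "0 < c" "\<And>y. y \<in> B \<Longrightarrow> c \<le> g y \<and> g y \<le> d"
      using g(1) unfolding positive_on_def by blast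
    then have "0 < 1 / N * c" "\<And>y. y \<in> B \<Longrightarrow> 1 / N * c \<le> h y \<and> h y \<le> 1 / N * d"
      using N by (auto simp: h_def divide_right_mono)
    moreover have "h \<in> borel_measurable L" using positive_onD(1)[OF g(1)] by (simp add: h_def)
    ultimately show ?thesis unfolding positive_on_def by blast
  qed
  have h2: "l2_on L B h = 1" using N by (simp only: h_def l2_on_scale) (simp add: N_def)
  have h3: "sinkhorn h z = h z" if "z \<in> space L" for z
    using g(2)[OF that] by (simp only: h_def sinkhorn_scale)
  \<comment> \<open>Applying \<open>map_C\<close> once more gives a fixed point as a function on the
    whole type, including regime numbers outside the model: \<open>f\<close> agrees with
    \<open>h\<close> on \<open>B\<close>, and only those values matter to
    \<open>map_C\<close>.\<close>
  define f where "f = map_C K p r0 rT h"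
  have fh: "f z = h z" if "z \<in> space L" for z
    using map_C_eq[OF h that] h3[OF that] by (simp add: f_def)
  have fB: "f w = h w" if "w \<in> B" for w using fh that B_space by auto
  have "map_C K p r0 rT f = f" using map_C_cong[of f h] fB by (simp add: f_def)
  moreover have "positive_on L B f" using positive_on_cong[OF h, of f] fh by simp
  moreover have "0 \<le> f z \<and> sinkhorn f z = f z" if z: "z \<in> space L" for z
    using sinkhorn_cong[of f h, OF fB] h3[OF z] fh[OF z] g(2)[OF z] N by (simp add: h_def)
  moreover have "l2_on L B f = 1"
  proof -
    have "(\<lambda>z. indicator B z * (f z)\<^sup>2) = (\<lambda>z. indicat_real B z * (h z)\<^sup>2)"
      using fB by (auto simp: indicator_def)
    then show ?thesis using h2 by (simp add: l2_on_def)
  qed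
  ultimately show ?thesis by blast
qed

lemma normalized_positive_fixed:
  assumes f: "positive_on L B f" and "\<And>z. z \<in> space L \<Longrightarrow> 0 \<le> f z" and "l2_on L B f = 1"
  shows "normalized_positive K AT f"
proof -
  have "0 < f (y, j)" if "j \<in> regimes K" "y \<in> AT j" for y j
    using that by (intro positive_onD(2)[OF f]) (simp add: regime_sets_def)
  then show ?thesis
    unfolding normalized_positive_def using positive_on_L2[OF f] assms(2,3) by simp
qed

text \<open>If \<open>rT / h\<close> is not integrable in some regime, the corresponding summand of \<open>map_ET\<close> is the
  junk value zero; \<open>u\<close> discards these regimes, and the lower bound on the kernel makes the
  remaining sum bounded away from zero unless it vanishes identically.\<close>

lemma integrable_of_map_C_fixed:
  assumes h: "normalized_positive K AT h"
    and fixed: "AE z in L. z \<in> B \<longrightarrow> map_C K p r0 rT h z = h z"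
  shows "integrable L (\<lambda>z. rT z * (1 / h z))"
proof -
  interpret F: bounded_kernel L "\<lambda>x y. state_kernel K p y x" rT r0 B A m b by (rule flip)
  have hm[measurable]: "h \<in> borel_measurable L"
    using h by (simp add: normalized_positive_def L2_on_iff)
  have hpos: "0 < h z" if "z \<in> B" for z
    using h that by (auto simp: normalized_positive_def regime_sets_def)
  have hnn: "0 \<le> h z" if "z \<in> space L" for z
    using h that by (auto simp: normalized_positive_def)
  \<comment> \<open>The property depends on the regime alone: as the kernel is at least
    \<open>m\<close>, a summand with non-integrable \<open>rT / h\<close> is non-integrable at every
    point of \<open>A\<close> simultaneously.\<close>
  define good where "good j \<longleftrightarrow> integrable lborel (\<lambda>y. rT (y, j) * (1 / h (y, j)))" for j
  define u where "u z = (if good (snd z) then 1 / h z else 0)" for z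
  have [measurable]: "Measurable.pred L (\<lambda>z. good (snd z))"
    unfolding base_def by (rule measurable_compose[OF measurable_snd]) simp
  have um[measurable]: "u \<in> borel_measurable L" unfolding u_def[abs_def] by measurable
  have unn: "0 \<le> u z" if "z \<in> B" for z using hpos[OF that] by (simp add: u_def)
  have i: "integrable L (\<lambda>z. rT z * u z)"
  proof (subst integrable_base_iff)
    show "\<forall>j\<in>regimes K. integrable lborel (\<lambda>y. rT (y, j) * u (y, j))"
    proof
      fix j show "integrable lborel (\<lambda>y. rT (y, j) * u (y, j))"
        by (cases "good j") (simp_all add: u_def good_def)
    qed
  qed measurable
  have discard: "map_ET K p rT (map_D h) z = fwd u z" if z: "z \<in> A" for z
  proof -
    obtain x k where zx: "z = (x, k)" by (cases z)
    have "map_ET K p rT (map_D h) z = map_ET K p rT u z"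
      unfolding map_ET_def zx prod.case
    proof (rule sum.cong[OF refl])
      fix j assume j: "j \<in> regimes K"
      show "(LINT y|lborel. p k j 0 x (horizon K) y * rT (y, j) * map_D h (y, j)) =
          (LINT y|lborel. p k j 0 x (horizon K) y * rT (y, j) * u (y, j))"
      proof (cases "good j")
        case True
        then show ?thesis by (simp add: u_def map_D_def)
      next
        case False
        have "\<not> integrable lborel (\<lambda>y. p k j 0 x (horizon K) y * rT (y, j) * map_D h (y, j))"
        proof
          assume int: "integrable lborel (\<lambda>y. p k j 0 x (horizon K) y * rT (y, j) * map_D h (y, j))"
          have "integrable lborel (\<lambda>y. rT (y, j) * (1 / h (y, j)))"
          proof (rule Bochner_Integration.integrable_bound)
            show "integrable lborel (\<lambda>y. 1 / m * (p k j 0 x (horizon K) y * rT (y, j) * map_D h (y, j)))"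
              using int by simp
            show "(\<lambda>y. rT (y, j) * (1 / h (y, j))) \<in> borel_measurable lborel"
              using measurable_slice_base[of "\<lambda>z. rT z * (1 / h z)" K borel j] j by simp
            have "norm (rT (y, j) * (1 / h (y, j))) \<le>
                norm (1 / m * (p k j 0 x (horizon K) y * rT (y, j) * map_D h (y, j)))" for y
            proof (cases "rT (y, j) = 0")
              case rT: False
              then have B: "(y, j) \<in> B" using s_supp j by simp
              define q where "q = rT (y, j) * (1 / h (y, j))"
              have q: "0 \<le> q" using hpos[OF B] s_nonneg j by (simp add: q_def)
              have le: "m \<le> p k j 0 x (horizon K) y"
                using kernel_ge[OF z B] by (simp add: state_kernel_def zx)
              have "m * q \<le> p k j 0 x (horizon K) y * q" by (rule mult_right_mono[OF le q])
              then have "q \<le> 1 / m * (p k j 0 x (horizon K) y * q)"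
                using m_pos by (simp add: pos_le_divide_eq mult.commute)
              then have "norm q \<le> norm (1 / m * (p k j 0 x (horizon K) y * q))"
                using q unfolding real_norm_def by (intro order_trans[OF _ abs_ge_self]) simp
              then show ?thesis by (simp only: q_def map_D_def mult.assoc)
            qed simp
            then show "AE y in lborel. norm (rT (y, j) * (1 / h (y, j))) \<le>
                norm (1 / m * (p k j 0 x (horizon K) y * rT (y, j) * map_D h (y, j)))" by simp
          qed
          then show False using False by (simp add: good_def)
        qed
        then show ?thesis using False by (simp add: not_integrable_integral_eq u_def)
      qed
    qed
    then show ?thesis using map_ET_eq[OF um i] z A_space by auto
  qed
  have C: "map_C K p r0 rT h = map_E0 K p r0 (\<lambda>z. 1 / fwd u z)"
  proof -
    have "map_E0 K p r0 (map_D (map_ET K p rT (map_D h))) = map_E0 K p r0 (\<lambda>z. 1 / fwd u z)"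
      by (rule map_E0_cong) (simp add: map_D_def[of "map_ET K p rT (map_D h)"] discard)
    then show ?thesis by (simp add: map_C_def)
  qed
  have I: "0 \<le> (\<integral>z. rT z * u z \<partial>L)"
    by (intro integral_nonneg_AE AE_I2 s_mult_nonneg unn)
  \<comment> \<open>If the integral vanished, \<open>fwd u\<close> would be zero on
    \<open>A\<close>, and \<open>1 / 0 = 0\<close> would make \<open>map_C\<close> of
    \<open>h\<close> zero, against the positivity of \<open>h\<close> on \<open>B\<close>.\<close>
  have "(\<integral>z. rT z * u z \<partial>L) \<noteq> 0"
  proof
    assume 0: "(\<integral>z. rT z * u z \<partial>L) = 0"
    have "fwd u z = 0" if "z \<in> A" for z
      using fwd_bounds(1,2)[OF um i unn subsetD[OF A_space that]] by (intro antisym) (simp_all add: 0)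
    then have "map_C K p r0 rT h = map_E0 K p r0 (\<lambda>z. 0)"
      unfolding C by (intro map_E0_cong) simp
    then have zero: "map_C K p r0 rT h z = 0" for z by (cases z) (simp add: map_E0_def)
    have "AE z in L. rT z = 0"
      using fixed AE_space
    proof eventually_elim
      case (elim z)
      then show ?case using zero[of z] hpos[of z] s_supp[of z] by (cases "rT z = 0") auto
    qed
    then show False using not_AE_s_zero by simp
  qed
  with I have "0 < (\<integral>z. rT z * u z \<partial>L)" by simp
  then have P: "positive_on L A (fwd u)" by (intro positive_on_fwd i unn um)
  obtain c where c: "0 < c" "\<And>z. z \<in> B \<Longrightarrow> c \<le> bwd (\<lambda>z. 1 / fwd u z) z"
    using positive_on_bwd_inverse[OF P] unfolding positive_on_def by blast
  \<comment> \<open>The fixed-point equation now hands the lower bound of the image back to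
    \<open>h\<close>; so \<open>rT / h\<close> is integrable in every regime and nothing was
    discarded after all.\<close>
  have lower: "AE z in L. z \<in> B \<longrightarrow> c \<le> h z"
    using fixed AE_space
  proof eventually_elim
    case (elim z)
    have "map_C K p r0 rT h z = bwd (\<lambda>z. 1 / fwd u z) z"
      unfolding C using F.positive_on_inverse(1)[OF P] F.positive_onD(1)[OF P] elim(2)
      by (intro map_E0_eq) auto
    then show ?case using c(2)[of z] elim(1) by auto
  qed
  show ?thesis
  proof (rule Bochner_Integration.integrable_bound)
    show "integrable L (\<lambda>z. 1 / c * rT z)" using s_int by simp
    show "AE z in L. norm (rT z * (1 / h z)) \<le> norm (1 / c * rT z)"
      using lower AE_space
    proof eventually_elim
      case (elim z)
      show ?case
      proof (cases "rT z = 0")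
        case False
        then have "c \<le> h z" using elim s_supp by auto
        then have "1 / h z \<le> 1 / c" "0 \<le> 1 / h z" using c(1) by (auto intro: divide_left_mono simp: divide_simps)
        then have "rT z * (1 / h z) \<le> rT z * (1 / c)" "0 \<le> rT z * (1 / h z)"
          using s_nonneg[OF elim(2)] by (auto intro: mult_left_mono simp del: times_divide_eq_right)
        then have "norm (rT z * (1 / h z)) \<le> 1 / c * rT z" by (simp add: mult.commute)
        then show ?thesis unfolding real_norm_def by (rule order_trans) (rule abs_ge_self)
      qed simp
    qed
  qed measurable
qed

text \<open>Once \<open>rT / h\<close> is integrable, \<open>map_C\<close> acts on \<open>h\<close>
  as \<open>sinkhorn\<close>, and the regularized competitor is a positive multiple of
  \<open>f\<close>. Equal norms make the multiple one.\<close>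

lemma map_C_fixed_unique:
  assumes f: "positive_on L B f" and ff: "\<And>z. z \<in> B \<Longrightarrow> sinkhorn f z = f z" and f1: "l2_on L B f = 1"
    and h: "normalized_positive K AT h"
    and fixed: "AE z in L. z \<in> B \<longrightarrow> map_C K p r0 rT h z = h z"
  shows "AE z in L. z \<in> B \<longrightarrow> h z = f z"
proof -
  have hm[measurable]: "h \<in> borel_measurable L" and hL2: "L2_on K AT h" "L2_norm K AT h = 1"
    using h by (simp_all add: normalized_positive_def L2_on_iff)
  have hpos: "0 < h z" if "z \<in> B" for z
    using h that by (auto simp: normalized_positive_def regime_sets_def)
  note i = integrable_of_map_C_fixed[OF h fixed]
  have pos: "AE z in L. rT z \<noteq> 0 \<longrightarrow> 0 < h z" using s_supp hpos by (intro AE_I2) auto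
  have "positive_on L A (fwd (\<lambda>z. 1 / h z))"
  proof (rule positive_on_fwd[OF _ i])
    show "0 < (\<integral>z. rT z * (1 / h z) \<partial>L)"
      by (intro integral_s_mult_pos i) (use pos hpos in \<open>auto intro: less_imp_le\<close>)
  qed (use hpos in \<open>auto intro: less_imp_le\<close>)
  note C = map_C_eq_of_integrable[OF hm i this]
  have fx: "AE z in L. z \<in> B \<longrightarrow> sinkhorn h z = h z"
    using fixed AE_space by eventually_elim (simp add: C)
  then have "AE z in L. rT z \<noteq> 0 \<longrightarrow> sinkhorn h z = h z"
    using AE_space by eventually_elim (use s_supp in auto)
  note S = sinkhorn_fixed_of_integrable[OF hm less_imp_le[OF hpos] i pos this]
  obtain t where t: "0 < t" "\<And>z. z \<in> B \<Longrightarrow> sinkhorn h z = t * f z"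
    using sinkhorn_fixed_proportional[OF S(1) f _ ff] S(3) by auto
  have ht: "AE z in L. z \<in> B \<longrightarrow> h z = t * f z"
    using fx by eventually_elim (use t in auto)
  note positive_onD(1)[OF f, measurable] B_sets[measurable]
  have "l2_on L B h = l2_on L B (\<lambda>z. t * f z)"
    unfolding l2_on_def
  proof (intro arg_cong[where f = sqrt] integral_cong_AE)
    show "AE z in L. indicator B z * (h z)\<^sup>2 = indicator B z * (t * f z)\<^sup>2"
      using ht by eventually_elim (auto simp: indicator_def)
  qed measurable
  then have "t = 1" using hL2 t(1) by (simp add: l2_on_scale f1 L2_norm_eq)
  then show ?thesis using ht by simp
qed

lemma map_C_normalized_tendsto:
  assumes f: "positive_on L B f" and ff: "\<And>z. z \<in> B \<Longrightarrow> sinkhorn f z = f z" and f1: "l2_on L B f = 1"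
    and f0: "positive_on L B f0"
  defines "F \<equiv> \<lambda>n. (map_C K p r0 rT ^^ n) f0"
  shows "L2_on K AT (F n)" "0 < L2_norm K AT (F n)"
    "(\<lambda>n. L2_norm K AT (\<lambda>z. F n z / L2_norm K AT (F n) - f z)) \<longlonglongrightarrow> 0"
proof -
  have FS: "F n z = (sinkhorn ^^ n) f0 z" if "z \<in> space L" for n z
    unfolding F_def by (rule map_C_funpow_eq[OF f0 that])
  have FP: "positive_on L B (F n)" for n
    using positive_on_funpow[OF f0, of n] by (rule positive_on_cong) (simp add: FS)
  note FN = positive_on_L2[OF FP]
  show "L2_on K AT (F n)" "0 < L2_norm K AT (F n)" using FN l2_facts(2)[OF FP] by auto
  have cong: "l2_on L B g = l2_on L B g'" if "\<And>z. z \<in> B \<Longrightarrow> g z = g' z" for g g'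
  proof -
    have "(\<lambda>z. indicator B z * (g z)\<^sup>2) = (\<lambda>z. indicat_real B z * (g' z)\<^sup>2)"
      using that by (auto simp: indicator_def)
    then show ?thesis by (simp add: l2_on_def)
  qed
  have FB: "F n z = (sinkhorn ^^ n) f0 z" if "z \<in> B" for n z using FS that B_space by auto
  have "L2_norm K AT (\<lambda>z. F n z / L2_norm K AT (F n) - f z) =
      l2_on L B (\<lambda>z. (sinkhorn ^^ n) f0 z / l2_on L B ((sinkhorn ^^ n) f0) - f z)" for n
  proof -
    note [measurable] = positive_onD(1)[OF FP[of n]] positive_onD(1)[OF f]
    define N where "N = L2_norm K AT (F n)"
    have N: "N = l2_on L B ((sinkhorn ^^ n) f0)" "0 < N"
      unfolding N_def FN using cong[OF FB] l2_facts(2)[OF FP] by auto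
    obtain c d where cd: "0 < c" "\<And>y. y \<in> B \<Longrightarrow> c \<le> F n y \<and> F n y \<le> d"
      using FP[of n] unfolding positive_on_def by blast
    obtain c' d' where cd': "0 < c'" "\<And>y. y \<in> B \<Longrightarrow> c' \<le> f y \<and> f y \<le> d'"
      using f unfolding positive_on_def by blast
    have "L2_on K AT (\<lambda>z. F n z / N - f z)"
      unfolding L2_on_iff
    proof
      show "integrable L (\<lambda>z. indicator B z * (F n z / N - f z)\<^sup>2)"
      proof (rule integrable_square_bounded[OF B_sets B_fin])
        fix z assume z: "z \<in> B"
        have "0 \<le> F n z / N" "F n z / N \<le> d / N"
          using cd cd(2)[OF z] N by (auto intro: divide_right_mono)
        then show "\<bar>F n z / N - f z\<bar> \<le> d / N + d'" using cd' cd'(2)[OF z] by linarith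
      qed measurable
    qed measurable
    then have "L2_norm K AT (\<lambda>z. F n z / N - f z) = l2_on L B (\<lambda>z. F n z / N - f z)" by (rule L2_norm_eq)
    also have "\<dots> = l2_on L B (\<lambda>z. (sinkhorn ^^ n) f0 z / N - f z)" by (intro cong) (simp add: FB)
    finally show ?thesis unfolding N_def[symmetric] by (simp only: N(1)[symmetric])
  qed
  then show "(\<lambda>n. L2_norm K AT (\<lambda>z. F n z / L2_norm K AT (F n) - f z)) \<longlonglongrightarrow> 0"
    using l2_facts(3)[OF f0 f ff f1] by simp
qed

section \<open>From the regime-wise system to the kernel problem\<close>

lemma schroedinger_system_iff:
  "schroedinger_system K p r0 rT \<phi>0 \<phi>T \<psi>0 \<psi>T \<longleftrightarrow> system_on L (state_kernel K p) r0 rT \<phi>0 \<phi>T \<psi>0 \<psi>T"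
proof -
  have T: "(\<integral>\<^sup>+w. ennreal (state_kernel K p (x, i) w * \<phi>T w) \<partial>L) =
      (\<Sum>j\<in>regimes K. \<integral>\<^sup>+y. ennreal (p i j 0 x (horizon K) y * \<phi>T (y, j)) \<partial>lborel)"
    if [measurable]: "\<phi>T \<in> borel_measurable L" and i: "i \<in> regimes K" for x i
  proof -
    have [measurable]: "(x, i) \<in> space L" using i by simp
    have "(\<lambda>w. ennreal (state_kernel K p (x, i) w * \<phi>T w)) \<in> borel_measurable L" by measurable
    from nn_integral_base[OF this] show ?thesis by (simp add: state_kernel_def)
  qed
  have O: "(\<integral>\<^sup>+w. ennreal (state_kernel K p w (y, j) * \<psi>0 w) \<partial>L) =
      (\<Sum>i\<in>regimes K. \<integral>\<^sup>+x. ennreal (p i j 0 x (horizon K) y * \<psi>0 (x, i)) \<partial>lborel)"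
    if [measurable]: "\<psi>0 \<in> borel_measurable L" and j: "j \<in> regimes K" for y j
  proof -
    have [measurable]: "(y, j) \<in> space L" using j by simp
    have "(\<lambda>w. ennreal (state_kernel K p w (y, j) * \<psi>0 w)) \<in> borel_measurable L" by measurable
    from nn_integral_base[OF this] show ?thesis by (simp add: state_kernel_def)
  qed
  \<comment> \<open>Splitting the integral over \<open>base K\<close> into regimes requires
    measurable integrands. If \<open>\<phi>T\<close> or \<open>\<psi>0\<close> is not measurable,
    both systems fail, since each includes measurability.\<close>
  show ?thesis
  proof (cases "\<phi>T \<in> borel_measurable L \<and> \<psi>0 \<in> borel_measurable L")
    case True
    have T': "(\<forall>i\<in>regimes K. AE x in lborel. ennreal (\<phi>0 (x, i)) =
          (\<integral>\<^sup>+w. ennreal (state_kernel K p (x, i) w * \<phi>T w) \<partial>L)) \<longleftrightarrow>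
        (\<forall>i\<in>regimes K. AE x in lborel. ennreal (\<phi>0 (x, i)) =
          (\<Sum>j\<in>regimes K. \<integral>\<^sup>+y. ennreal (p i j 0 x (horizon K) y * \<phi>T (y, j)) \<partial>lborel))"
      by (rule ball_cong[OF refl]) (simp only: T[OF conjunct1[OF True]])
    have O': "(\<forall>j\<in>regimes K. AE y in lborel. ennreal (\<psi>T (y, j)) =
          (\<integral>\<^sup>+w. ennreal (state_kernel K p w (y, j) * \<psi>0 w) \<partial>L)) \<longleftrightarrow>
        (\<forall>j\<in>regimes K. AE y in lborel. ennreal (\<psi>T (y, j)) =
          (\<Sum>i\<in>regimes K. \<integral>\<^sup>+x. ennreal (p i j 0 x (horizon K) y * \<psi>0 (x, i)) \<partial>lborel))"
      by (rule ball_cong[OF refl]) (simp only: O[OF conjunct2[OF True]])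
    show ?thesis
      unfolding schroedinger_system_def system_on_def AE_base_iff measurable_state_space T' O'
      by (simp only: space_state_space space_base)
  next
    case False
    moreover have "\<phi>T \<in> borel_measurable L \<and> \<psi>0 \<in> borel_measurable L"
      if "schroedinger_system K p r0 rT \<phi>0 \<phi>T \<psi>0 \<psi>T"
      using that unfolding schroedinger_system_def measurable_state_space by blast
    ultimately show ?thesis using system_onD(2,3) by blast
  qed
qed

end

text \<open>Serves to replace \<open>fwd\<close> by \<open>map_ET\<close> in the solution, as these
  agree on the state space only.\<close>

lemma system_on_cong:
  assumes sys: "system_on L k r s \<phi>0 \<phi>T \<psi>0 \<psi>T"
    and eq: "\<And>z. z \<in> space L \<Longrightarrow> \<phi>0 z = \<phi>0' z" "\<And>z. z \<in> space L \<Longrightarrow> \<psi>0 z = \<psi>0' z"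
  shows "system_on L k r s \<phi>0' \<phi>T \<psi>0' \<psi>T"
proof -
  have "\<phi>0 \<in> borel_measurable L \<longleftrightarrow> \<phi>0' \<in> borel_measurable L"
    "\<psi>0 \<in> borel_measurable L \<longleftrightarrow> \<psi>0' \<in> borel_measurable L"
    by (rule measurable_cong, erule eq)+
  moreover have "AE x in L. ennreal (\<phi>0' x) = (\<integral>\<^sup>+y. ennreal (k x y * \<phi>T y) \<partial>L)"
    if "AE x in L. ennreal (\<phi>0 x) = (\<integral>\<^sup>+y. ennreal (k x y * \<phi>T y) \<partial>L)"
    using that AE_space by eventually_elim (simp add: eq)
  moreover have "(\<integral>\<^sup>+x. ennreal (k x y * \<psi>0' x) \<partial>L) = (\<integral>\<^sup>+x. ennreal (k x y * \<psi>0 x) \<partial>L)" for y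
    by (intro nn_integral_cong) (simp add: eq)
  moreover have "AE x in L. r x = \<phi>0' x * \<psi>0' x" if "AE x in L. r x = \<phi>0 x * \<psi>0 x"
    using that AE_space by eventually_elim (simp add: eq)
  ultimately show ?thesis using sys eq unfolding system_on_def by simp
qed

lemma is_density_integral:
  fixes K :: "('d::finite, 'l::finite) model"
  assumes d: "is_density K \<rho> r" and \<rho>: "prob_space \<rho>" "sets \<rho> = sets (state_space K)"
  shows "integrable (base K) r" "(\<integral>z. r z \<partial>base K) = 1" "\<And>z. z \<in> space (base K) \<Longrightarrow> 0 \<le> r z"
proof -
  have rm: "r \<in> borel_measurable (base K)"
    using d by (simp add: is_density_def measurable_state_space)
  note [measurable] = rm
  show nn: "0 \<le> r z" if "z \<in> space (base K)" for z
    using d that by (cases z) (simp add: is_density_def)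
  have "(\<integral>\<^sup>+z. ennreal (r z) \<partial>base K) = (\<Sum>i\<in>regimes K. \<integral>\<^sup>+x. ennreal (r (x, i)) \<partial>lborel)"
    by (rule nn_integral_base) measurable
  also have "\<dots> = (\<Sum>i\<in>regimes K. emeasure \<rho> (UNIV \<times> {i}))"
  proof (rule sum.cong[OF refl])
    fix i assume i: "i \<in> regimes K"
    have "(\<lambda>x. ennreal (r (x, i))) \<in> borel_measurable lborel"
      using measurable_slice_base[OF _ i, of "\<lambda>z. ennreal (r z)" borel] by simp
    then have "(\<integral>\<^sup>+x. ennreal (r (x, i)) \<partial>lborel) = emeasure (density lborel (\<lambda>x. ennreal (r (x, i)))) UNIV"
      by (subst emeasure_density) auto
    also have "\<dots> = emeasure (slice \<rho> i) UNIV" using d i by (simp add: is_density_def)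
    also have "\<dots> = emeasure \<rho> (UNIV \<times> {i})" by (rule emeasure_slice[OF \<rho>(2) i]) simp
    finally show "(\<integral>\<^sup>+x. ennreal (r (x, i)) \<partial>lborel) = emeasure \<rho> (UNIV \<times> {i})" .
  qed
  also have "\<dots> = emeasure \<rho> (\<Union>i\<in>regimes K. UNIV \<times> {i})"
  proof (rule sum_emeasure)
    have "UNIV \<times> {i} \<in> sets (borel \<Otimes>\<^sub>M count_space (regimes K))" if "i \<in> regimes K" for i
      using that by (intro pair_measureI) auto
    then show "(\<lambda>i. UNIV \<times> {i}) ` regimes K \<subseteq> sets \<rho>" by (auto simp: \<rho>(2) state_space_def)
  qed (auto simp: disjoint_family_on_def)
  also have "(\<Union>i\<in>regimes K. UNIV \<times> {i}) = space \<rho>"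
    using sets_eq_imp_space_eq[OF \<rho>(2)] by auto
  also have "emeasure \<rho> (space \<rho>) = 1" by (rule prob_space.emeasure_space_1[OF \<rho>(1)])
  finally have one: "(\<integral>\<^sup>+z. ennreal (r z) \<partial>base K) = ennreal 1" by simp
  have "has_bochner_integral (base K) r 1"
    by (rule has_bochner_integral_nn_integral) (use nn one in auto)
  then show "integrable (base K) r" "(\<integral>z. r z \<partial>base K) = 1"
    by (auto simp: has_bochner_integral_iff)
qed

lemma state_kernel_measurable:
  fixes K :: "('d::finite, 'l::finite) model"
  assumes p: "\<And>i j. i \<in> regimes K \<Longrightarrow> j \<in> regimes K \<Longrightarrow>
    (\<lambda>(x, y). p i j 0 x (horizon K) y) \<in> borel_measurable (borel \<Otimes>\<^sub>M borel)"
  shows "(\<lambda>(z, w). state_kernel K p z w) \<in> borel_measurable (base K \<Otimes>\<^sub>M base K)"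
proof -
  let ?T = "horizon K"
  have m1: "(\<lambda>q. (fst (fst q), fst (snd q))) \<in> measurable (base K \<Otimes>\<^sub>M base K) (borel \<Otimes>\<^sub>M borel)"
    unfolding base_def by measurable
  have m2: "(\<lambda>q. snd (fst q)) \<in> measurable (base K \<Otimes>\<^sub>M base K) (count_space (regimes K))"
    and m3: "(\<lambda>q. snd (snd q)) \<in> measurable (base K \<Otimes>\<^sub>M base K) (count_space (regimes K))"
    unfolding base_def by measurable
  have "(\<lambda>q. p i j 0 (fst (fst q)) ?T (fst (snd q))) \<in> borel_measurable (base K \<Otimes>\<^sub>M base K)"
    if "i \<in> regimes K" "j \<in> regimes K" for i j
    using measurable_compose[OF m1 p[OF that]] by simp
  then have "(\<lambda>q. p i (snd (snd q)) 0 (fst (fst q)) ?T (fst (snd q))) \<in> borel_measurable (base K \<Otimes>\<^sub>M base K)"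
    if "i \<in> regimes K" for i
    by (rule measurable_compose_countable'[OF _ m3]) (use that in auto)
  then have "(\<lambda>q. p (snd (fst q)) (snd (snd q)) 0 (fst (fst q)) ?T (fst (snd q))) \<in> borel_measurable (base K \<Otimes>\<^sub>M base K)"
    by (rule measurable_compose_countable'[OF _ m2]) auto
  then show ?thesis by (simp add: state_kernel_def case_prod_beta)
qed

text \<open>The upper bound is the global one of assumption (D1); the lower bound is the minimum of
  a positive continuous function on a product of compact sets. Finitely many pairs of regimes allow
  common constants.\<close>

lemma regime_kernel_exists:
  fixes K :: "('d::finite, 'l::finite) model"
  assumes D1: "assumption_D1 K Pfam p" and T: "0 < horizon K"
    and r0: "is_density K \<rho>0 r0" "prob_space \<rho>0" "sets \<rho>0 = sets (state_space K)"
    and rT: "is_density K \<rho>T rT" "prob_space \<rho>T" "sets \<rho>T = sets (state_space K)"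
    and supp: "\<And>i. {x. r0 (x, i) \<noteq> 0} \<subseteq> A0 i" "\<And>j. {y. rT (y, j) \<noteq> 0} \<subseteq> AT j"
    and A0: "\<And>i. i \<in> regimes K \<Longrightarrow> compact (A0 i)"
    and AT: "\<And>j. j \<in> regimes K \<Longrightarrow> compact (AT j)"
    and cont: "\<And>i j. i \<in> regimes K \<Longrightarrow> j \<in> regimes K \<Longrightarrow>
      continuous_on (A0 i \<times> AT j) (\<lambda>(x, y). p i j 0 x (horizon K) y)"
    and pos: "\<And>i j x y. i \<in> regimes K \<Longrightarrow> j \<in> regimes K \<Longrightarrow> x \<in> A0 i \<Longrightarrow> y \<in> AT j \<Longrightarrow>
      0 < p i j 0 x (horizon K) y"
  shows "\<exists>m b. regime_kernel K p r0 rT A0 AT m b"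
proof -
  have meas: "(\<lambda>(x, y). p i j 0 x (horizon K) y) \<in> borel_measurable (borel \<Otimes>\<^sub>M borel)"
    and nn: "\<And>x y. 0 \<le> p i j 0 x (horizon K) y"
    and bdd: "\<exists>c. \<forall>x y. p i j 0 x (horizon K) y \<le> c"
    if "i \<in> regimes K" "j \<in> regimes K" for i j
    using D1 T that unfolding assumption_D1_def by (auto dest!: bspec spec[of _ 0] spec[of _ "horizon K"])
  define I where "I = regimes K \<times> regimes K"
  have finI: "finite I" by (simp add: I_def)
  have "\<forall>q\<in>I. \<exists>c. \<forall>x y. p (fst q) (snd q) 0 x (horizon K) y \<le> c" using bdd by (auto simp: I_def)
  then obtain c where c: "\<And>q x y. q \<in> I \<Longrightarrow> p (fst q) (snd q) 0 x (horizon K) y \<le> c q"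
    by metis
  have "\<exists>c>0. \<forall>x\<in>A0 i. \<forall>y\<in>AT j. c \<le> p i j 0 x (horizon K) y"
    if ij: "i \<in> regimes K" "j \<in> regimes K" for i j
  proof (cases "A0 i \<times> AT j = {}")
    \<comment> \<open>A regime may carry no target mass, and its support is then empty.\<close>
    case True
    then show ?thesis by (intro exI[of _ 1]) auto
  next
    case False
    then obtain z where z: "z \<in> A0 i \<times> AT j"
      "\<And>w. w \<in> A0 i \<times> AT j \<Longrightarrow> (\<lambda>(x, y). p i j 0 x (horizon K) y) z \<le> (\<lambda>(x, y). p i j 0 x (horizon K) y) w"
      using continuous_attains_inf[OF compact_Times[OF A0[OF ij(1)] AT[OF ij(2)]] False cont[OF ij]] by blast
    then show ?thesis
      using pos[OF ij, of "fst z" "snd z"]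
      by (intro exI[of _ "p i j 0 (fst z) (horizon K) (snd z)"]) (auto simp: case_prod_beta)
  qed
  then have "\<forall>q\<in>I. \<exists>c>0. \<forall>x\<in>A0 (fst q). \<forall>y\<in>AT (snd q). c \<le> p (fst q) (snd q) 0 x (horizon K) y"
    by (auto simp: I_def)
  then obtain d where d: "\<And>q. q \<in> I \<Longrightarrow> 0 < d q"
    "\<And>q x y. q \<in> I \<Longrightarrow> x \<in> A0 (fst q) \<Longrightarrow> y \<in> AT (snd q) \<Longrightarrow> d q \<le> p (fst q) (snd q) 0 x (horizon K) y"
    by metis
  define b where "b = Max (insert 0 (c ` I))"
  define m where "m = Min (insert 1 (d ` I))"
  have b: "c q \<le> b" if "q \<in> I" for q unfolding b_def using finI that by (intro Max_ge) auto
  have m: "m \<le> d q" if "q \<in> I" for q unfolding m_def using finI that by (intro Min_le) auto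
  have m0: "0 < m" unfolding m_def using finI d by (subst Min_gr_iff) auto
  note R0 = is_density_integral[OF r0] and RT = is_density_integral[OF rT]
  have "regime_kernel K p r0 rT A0 AT m b"
  proof (intro regime_kernel.intro bounded_kernel.intro sigma_finite_base bounded_kernel_axioms.intro
      regime_kernel_axioms.intro AT)
    show "(\<lambda>(x, y). state_kernel K p x y) \<in> borel_measurable (base K \<Otimes>\<^sub>M base K)"
      by (rule state_kernel_measurable[where p = p, OF meas])
    show "0 \<le> state_kernel K p z w" "state_kernel K p z w \<le> b"
      if "z \<in> space (base K)" "w \<in> space (base K)" for z w
      using that nn order_trans[OF c b, of "(snd z, snd w)"] by (auto simp: state_kernel_def I_def)
    show "m \<le> state_kernel K p z w" if "z \<in> regime_sets K A0" "w \<in> regime_sets K AT" for z w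
      using that order_trans[OF m d(2), of "(snd z, snd w)"] by (auto simp: state_kernel_def I_def regime_sets_def)
    show "z \<in> regime_sets K A0" if "z \<in> space (base K)" "r0 z \<noteq> 0" for z
      using that supp(1)[of "snd z"] by (cases z) (auto simp: regime_sets_def)
    show "z \<in> regime_sets K AT" if "z \<in> space (base K)" "rT z \<noteq> 0" for z
      using that supp(2)[of "snd z"] by (cases z) (auto simp: regime_sets_def)
  qed (use m0 R0 RT in \<open>auto simp: regime_sets_def\<close>)
  then show ?thesis by blast
qed

text \<open>Uniqueness has two levels because the product equations leave \<open>phiT'\<close>
  undetermined where \<open>rT\<close> and \<open>hphiT'\<close> both vanish, and likewise
  \<open>hphi0'\<close>. It holds where the target densities are nonzero, and almost everywhere for
  solutions with \<open>hphi0'\<close> and \<open>phiT'\<close> supported on \<open>A0\<close> and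
  \<open>AT\<close>.\<close>

theorem theorem3p3p1:
  fixes K :: "('d::finite, 'l::finite) model"
    and Pfam :: "real \<Rightarrow> 'd state \<Rightarrow> 'd path measure"
    and R :: "'d path measure"
    and \<rho>0 \<rho>T :: "'d state measure"
    and f g r0 rT :: "'d state \<Rightarrow> real"
    and p :: "'d transition_density"
    and A0 AT :: "nat \<Rightarrow> (real ^ 'd) set"
  assumes "0 < horizon K" and "1 \<le> num_regimes K"
    and "assumption_C K" and "valid_cells K"
    and "assumption_G1 K Pfam" and "assumption_G2 K Pfam R \<rho>0 \<rho>T"
    and "bridge_factors K R \<rho>0 \<rho>T f g"
    and "assumption_D1 K Pfam p" and "assumption_D2 K R f g"
    and "\<exists>d0. is_density K (marginal K R 0) d0"
    and "is_density K \<rho>0 r0" and "is_density K \<rho>T rT"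
    and "A0 = density_support r0" and "AT = density_support rT"
    and "\<And>i. i \<in> regimes K \<Longrightarrow> compact (A0 i)"
    and "\<And>j. j \<in> regimes K \<Longrightarrow> compact (AT j)"
    and "\<And>i j. i \<in> regimes K \<Longrightarrow> j \<in> regimes K \<Longrightarrow>
      continuous_on (A0 i \<times> AT j) (\<lambda>(x, y). p i j 0 x (horizon K) y)"
    and "\<And>i j x y. i \<in> regimes K \<Longrightarrow> j \<in> regimes K \<Longrightarrow> x \<in> A0 i \<Longrightarrow> y \<in> AT j \<Longrightarrow>
      0 < p i j 0 x (horizon K) y"
  shows "\<exists>f_inf.
    normalized_positive K AT f_inf \<and>
    (\<forall>j\<in>regimes K. \<forall>y. map_C K p r0 rT f_inf (y, j) = f_inf (y, j)) \<and>
    (\<forall>h. normalized_positive K AT h \<and>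
       (\<forall>j\<in>regimes K. AE y in lborel. y \<in> AT j \<longrightarrow> map_C K p r0 rT h (y, j) = h (y, j)) \<longrightarrow>
       (\<forall>j\<in>regimes K. AE y in lborel. y \<in> AT j \<longrightarrow> h (y, j) = f_inf (y, j))) \<and>
    (\<forall>f0. f0 \<in> borel_measurable (state_space K) \<and>
       (\<forall>z\<in>space (state_space K). 0 \<le> f0 z) \<and>
       bounded (f0 ` space (state_space K)) \<and>
       (\<forall>j\<in>regimes K. 0 < (INF y\<in>AT j. ereal (f0 (y, j)))) \<longrightarrow>
       (let F = (\<lambda>k. (map_C K p r0 rT ^^ k) f0);
            fs = (\<lambda>k z. F k z / L2_norm K AT (F k))
        in (\<forall>k. L2_on K AT (F k) \<and> 0 < L2_norm K AT (F k)) \<and>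
           (\<lambda>k. L2_norm K AT (\<lambda>z. fs k z - f_inf z)) \<longlonglongrightarrow> 0)) \<and>
    (let hphiT = f_inf;
         phiT = (\<lambda>z. rT z / hphiT z);
         phi0 = (map_ET K p rT \<circ> map_D) f_inf;
         hphi0 = (\<lambda>z. r0 z / phi0 z)
     in schroedinger_system K p r0 rT phi0 phiT hphi0 hphiT \<and>
        (\<forall>phi0' phiT' hphi0' hphiT'.
           schroedinger_system K p r0 rT phi0' phiT' hphi0' hphiT' \<longrightarrow>
           (\<exists>c>0.
              (\<forall>i\<in>regimes K. AE x in lborel. r0 (x, i) \<noteq> 0 \<longrightarrow>
                 phi0' (x, i) = c * phi0 (x, i) \<and> hphi0' (x, i) = hphi0 (x, i) / c) \<and>
              (\<forall>j\<in>regimes K. AE y in lborel. rT (y, j) \<noteq> 0 \<longrightarrow>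
                 phiT' (y, j) = c * phiT (y, j) \<and> hphiT' (y, j) = hphiT (y, j) / c) \<and>
              ((\<forall>i\<in>regimes K. AE x in lborel. x \<notin> A0 i \<longrightarrow> hphi0' (x, i) = 0) \<and>
               (\<forall>j\<in>regimes K. AE y in lborel. y \<notin> AT j \<longrightarrow> phiT' (y, j) = 0) \<longrightarrow>
               (\<forall>i\<in>regimes K. AE x in lborel.
                  phi0' (x, i) = c * phi0 (x, i) \<and> hphi0' (x, i) = hphi0 (x, i) / c) \<and>
               (\<forall>j\<in>regimes K. AE y in lborel.
                  phiT' (y, j) = c * phiT (y, j) \<and> hphiT' (y, j) = hphiT (y, j) / c)))))"
proof -
  have supp: "\<And>i. {x. r0 (x, i) \<noteq> 0} \<subseteq> A0 i" "\<And>j. {y. rT (y, j) \<noteq> 0} \<subseteq> AT j"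
    unfolding assms(13,14) density_support_def by (rule closure_subset)+
  have prob: "prob_space \<rho>0" "sets \<rho>0 = sets (state_space K)" "prob_space \<rho>T" "sets \<rho>T = sets (state_space K)"
    using assms(6) by (auto simp: assumption_G2_def)
  obtain m b where "regime_kernel K p r0 rT A0 AT m b"
    using regime_kernel_exists[OF assms(8,1) assms(11) prob(1,2) assms(12) prob(3,4) supp assms(15-18)] by blast
  then interpret regime_kernel K p r0 rT A0 AT m b .
  obtain f_inf where P: "positive_on L B f_inf"
    and nn: "\<And>z. z \<in> space L \<Longrightarrow> 0 \<le> f_inf z" and fixed: "\<And>z. z \<in> space L \<Longrightarrow> sinkhorn f_inf z = f_inf z"
    and norm1: "l2_on L B f_inf = 1" and C: "map_C K p r0 rT f_inf = f_inf"
    using map_C_fixed_point_exists by blast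
  have fixedB: "\<And>z. z \<in> B \<Longrightarrow> sinkhorn f_inf z = f_inf z" using fixed B_space by auto
  define phi0 where "phi0 = (map_ET K p rT \<circ> map_D) f_inf"
  have phi0: "phi0 z = fwd (\<lambda>y. 1 / f_inf y) z" if "z \<in> space L" for z
    using map_ET_eq[OF _ positive_on_inverse(1)[OF P] that] positive_onD(1)[OF P]
    by (simp add: phi0_def map_D_def)
  show ?thesis
    unfolding Let_def
  proof (intro exI[of _ f_inf] conjI)
    show "normalized_positive K AT f_inf" by (rule normalized_positive_fixed[OF P nn norm1])
    show "\<forall>j\<in>regimes K. \<forall>y. map_C K p r0 rT f_inf (y, j) = f_inf (y, j)" by (simp add: C)
    show "\<forall>h. normalized_positive K AT h \<and>
       (\<forall>j\<in>regimes K. AE y in lborel. y \<in> AT j \<longrightarrow> map_C K p r0 rT h (y, j) = h (y, j)) \<longrightarrow>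
       (\<forall>j\<in>regimes K. AE y in lborel. y \<in> AT j \<longrightarrow> h (y, j) = f_inf (y, j))"
      using map_C_fixed_unique[OF P fixedB norm1] by (simp add: AE_base_iff regime_sets_def)
    show "\<forall>f0. f0 \<in> borel_measurable (state_space K) \<and> (\<forall>z\<in>space (state_space K). 0 \<le> f0 z) \<and>
        bounded (f0 ` space (state_space K)) \<and>
        (\<forall>j\<in>regimes K. 0 < (INF y\<in>AT j. ereal (f0 (y, j)))) \<longrightarrow>
        (\<forall>k. L2_on K AT ((map_C K p r0 rT ^^ k) f0) \<and> 0 < L2_norm K AT ((map_C K p r0 rT ^^ k) f0)) \<and>
        (\<lambda>k. L2_norm K AT (\<lambda>z. (map_C K p r0 rT ^^ k) f0 z / L2_norm K AT ((map_C K p r0 rT ^^ k) f0) -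
          f_inf z)) \<longlonglongrightarrow> 0"
    proof (intro allI impI)
      fix f0 :: "'d state \<Rightarrow> real"
      assume f0: "f0 \<in> borel_measurable (state_space K) \<and> (\<forall>z\<in>space (state_space K). 0 \<le> f0 z) \<and>
        bounded (f0 ` space (state_space K)) \<and>
        (\<forall>j\<in>regimes K. 0 < (INF y\<in>AT j. ereal (f0 (y, j))))"
      have "positive_on L B f0"
      proof -
        have fm: "f0 \<in> borel_measurable L" using f0 by (simp add: measurable_state_space)
        obtain d where "\<forall>v\<in>f0 ` space (state_space K). norm v \<le> d"
          using f0 unfolding bounded_iff by blast
        then have d: "f0 z \<le> d" if "z \<in> space L" for z using that by (force simp: abs_le_iff)
        have "\<exists>c>0. \<forall>y\<in>AT j. c \<le> f0 (y, j)" if "j \<in> regimes K" for j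
        proof -
          have "0 < (INF y\<in>AT j. ereal (f0 (y, j)))" using f0 that by simp
          \<comment> \<open>A number strictly below the infimum is finite even when
            \<open>AT j\<close> is empty and the infimum infinite, so it yields a real lower
            bound.\<close>
          from dense[OF this] obtain c where c: "0 < c" "c < (INF y\<in>AT j. ereal (f0 (y, j)))"
            by blast
          then obtain c' where c': "c = ereal c'" by (cases c) auto
          have "c' \<le> f0 (y, j)" if "y \<in> AT j" for y
            using less_INF_D[OF c(2) that] by (simp add: c')
          then show ?thesis using c by (auto simp: c')
        qed
        then obtain c where c: "\<And>j. j \<in> regimes K \<Longrightarrow> 0 < c j"
          "\<And>j y. j \<in> regimes K \<Longrightarrow> y \<in> AT j \<Longrightarrow> c j \<le> f0 (y, j)"
          by metis
        define c0 where "c0 = Min (insert 1 (c ` regimes K))"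
        have "0 < c0" unfolding c0_def using c by (subst Min_gr_iff) auto
        moreover have "c0 \<le> c j" if "j \<in> regimes K" for j
          unfolding c0_def using that by (intro Min_le) auto
        then have "c0 \<le> f0 z" if "z \<in> B" for z using that c(2) by (force simp: regime_sets_def)
        moreover have "f0 z \<le> d" if "z \<in> B" for z using that d B_space by auto
        ultimately show ?thesis unfolding positive_on_def using fm by blast
      qed
      from map_C_normalized_tendsto[OF P fixedB norm1 this]
      show "(\<forall>k. L2_on K AT ((map_C K p r0 rT ^^ k) f0) \<and> 0 < L2_norm K AT ((map_C K p r0 rT ^^ k) f0)) \<and>
        (\<lambda>k. L2_norm K AT (\<lambda>z. (map_C K p r0 rT ^^ k) f0 z / L2_norm K AT ((map_C K p r0 rT ^^ k) f0) -
          f_inf z)) \<longlonglongrightarrow> 0" by blast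
    qed
    have "system_on L (state_kernel K p) r0 rT phi0 (\<lambda>z. rT z / f_inf z) (\<lambda>z. r0 z / phi0 z) f_inf"
      by (rule system_on_cong[OF system_on_solution[OF P nn fixed]]) (simp_all add: phi0)
    then show "schroedinger_system K p r0 rT ((map_ET K p rT \<circ> map_D) f_inf) (\<lambda>z. rT z / f_inf z)
        (\<lambda>z. r0 z / (map_ET K p rT \<circ> map_D) f_inf z) f_inf"
      by (simp only: schroedinger_system_iff phi0_def)
    have "\<exists>c>0.
        (\<forall>i\<in>regimes K. AE x in lborel. r0 (x, i) \<noteq> 0 \<longrightarrow>
           phi0' (x, i) = c * phi0 (x, i) \<and> hphi0' (x, i) = r0 (x, i) / phi0 (x, i) / c) \<and>
        (\<forall>j\<in>regimes K. AE y in lborel. rT (y, j) \<noteq> 0 \<longrightarrow>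
           phiT' (y, j) = c * (rT (y, j) / f_inf (y, j)) \<and> hphiT' (y, j) = f_inf (y, j) / c) \<and>
        ((\<forall>i\<in>regimes K. AE x in lborel. x \<notin> A0 i \<longrightarrow> hphi0' (x, i) = 0) \<and>
         (\<forall>j\<in>regimes K. AE y in lborel. y \<notin> AT j \<longrightarrow> phiT' (y, j) = 0) \<longrightarrow>
         (\<forall>i\<in>regimes K. AE x in lborel.
            phi0' (x, i) = c * phi0 (x, i) \<and> hphi0' (x, i) = r0 (x, i) / phi0 (x, i) / c) \<and>
         (\<forall>j\<in>regimes K. AE y in lborel.
            phiT' (y, j) = c * (rT (y, j) / f_inf (y, j)) \<and> hphiT' (y, j) = f_inf (y, j) / c))"
      if "schroedinger_system K p r0 rT phi0' phiT' hphi0' hphiT'" for phi0' phiT' hphi0' hphiT'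
    proof -
      have sys: "system_on L (state_kernel K p) r0 rT phi0' phiT' hphi0' hphiT'"
        using that by (simp only: schroedinger_system_iff)
      have A: "(x, i) \<notin> A \<longleftrightarrow> x \<notin> A0 i" and B: "(x, i) \<notin> B \<longleftrightarrow> x \<notin> AT i" if "i \<in> regimes K" for x i
        using that by (auto simp: regime_sets_def)
      have phi: "fwd (\<lambda>y. 1 / f_inf y) (x, i) = phi0 (x, i)" if "i \<in> regimes K" for x i
        using phi0[of "(x, i)"] that by simp
      show ?thesis
        using system_on_unique[OF sys P fixed] unfolding AE_base_iff
        by (simp only: A B phi cong: ball_cong)
    qed
    then show "\<forall>phi0' phiT' hphi0' hphiT'.
        schroedinger_system K p r0 rT phi0' phiT' hphi0' hphiT' \<longrightarrow>
        (\<exists>c>0.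
          (\<forall>i\<in>regimes K. AE x in lborel. r0 (x, i) \<noteq> 0 \<longrightarrow>
             phi0' (x, i) = c * (map_ET K p rT \<circ> map_D) f_inf (x, i) \<and>
             hphi0' (x, i) = r0 (x, i) / (map_ET K p rT \<circ> map_D) f_inf (x, i) / c) \<and>
          (\<forall>j\<in>regimes K. AE y in lborel. rT (y, j) \<noteq> 0 \<longrightarrow>
             phiT' (y, j) = c * (rT (y, j) / f_inf (y, j)) \<and> hphiT' (y, j) = f_inf (y, j) / c) \<and>
          ((\<forall>i\<in>regimes K. AE x in lborel. x \<notin> A0 i \<longrightarrow> hphi0' (x, i) = 0) \<and>
           (\<forall>j\<in>regimes K. AE y in lborel. y \<notin> AT j \<longrightarrow> phiT' (y, j) = 0) \<longrightarrow>
           (\<forall>i\<in>regimes K. AE x in lborel.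
              phi0' (x, i) = c * (map_ET K p rT \<circ> map_D) f_inf (x, i) \<and>
              hphi0' (x, i) = r0 (x, i) / (map_ET K p rT \<circ> map_D) f_inf (x, i) / c) \<and>
           (\<forall>j\<in>regimes K. AE y in lborel.
              phiT' (y, j) = c * (rT (y, j) / f_inf (y, j)) \<and> hphiT' (y, j) = f_inf (y, j) / c)))"
      unfolding phi0_def by blast
  qed
qed

end
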